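(* Let $k\ge 2$ and $m\ge 1$ be integers, let $a_1,a_2\in\mathbb{R}$ and $0\le l\le 1$. In the hierarchical normal model described in the context, take the prior $\boldsymbol\beta\sim N_k(\mathbf{0},\mathbf{A})$ with $\mathbf{A}$ a fixed positive-definite $k\times k$ matrix, and suppose that there are constants $C_1,C_2>0$ such that for all $k\times k$ orthonormal $\mathbf{H}$ and all $\mathbf{D}=\mathrm{diag}(d_1,\dots,d_k)$ with $d_1>d_2>\cdots>d_k>0$, $$\frac{C_1[\prod_{i<j}(d_i-d_j)]^l}{|\mathbf{I}+\mathbf{D}|^{a_2-a_1}|\mathbf{D}|^{a_1}}\le \pi(\mathbf{H},\mathbf{D})\le \frac{C_2[\prod_{i<j}(d_i-d_j)]^l}{|\mathbf{I}+\mathbf{D}|^{a_2-a_1}|\mathbf{D}|^{a_1}}.$$ Then the posterior distribution exists if and only if $a_1<1$ and $a_2>1-\frac{m}{2}+(k-1)l$.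
   Context: Model: $p=mk$, and $\mathbf{X}=(\mathbf{X}_1,\dots,\mathbf{X}_m)\in\mathbb{R}^p$ with $\mathbf{X}_i\in\mathbb{R}^k$. Independently for $i=1,\dots,m$, $\mathbf{X}_i\mid\boldsymbol\theta_i\sim N_k(\boldsymbol\theta_i,\mathbf{I})$ and $\boldsymbol\theta_i\mid\boldsymbol\beta,\mathbf{V}\sim N_k(\boldsymbol\beta,\mathbf{V})$, where $\boldsymbol\beta\in\mathbb{R}^k$ and $\mathbf{V}$ is a $k\times k$ positive-definite matrix; $\boldsymbol\theta=(\boldsymbol\theta_1,\dots,\boldsymbol\theta_m)$. The hyperprior is a (possibly improper) density $\pi(\boldsymbol\beta)\pi(\mathbf{V})$. Change of variables: write $\mathbf{V}=\mathbf{H}^t\mathbf{D}\mathbf{H}$ with $\mathbf{H}$ orthonormal and $\mathbf{D}=\mathrm{diag}(d_1,\dots,d_k)$, $d_1>\cdots>d_k>0$ the eigenvalues of $\mathbf{V}$. The prior on $\mathbf{V}$ is rewritten as $\pi(\mathbf{V})\,d\mathbf{V}=\pi(\mathbf{H},\mathbf{D})I_{[d_1>\cdots>d_k]}\,d\mathbf{D}\,d\mathbf{H}$, where $d\mathbf{V}=\prod_{i\le j}dV_{ij}$, $d\mathbf{D}=\prod_i dd_i$, $d\mathbf{H}$ is the invariant Haar measure on orthonormal matrices, and $\pi(\mathbf{H},\mathbf{D})=\pi(\mathbf{H}^t\mathbf{D}\mathbf{H})\prod_{i<j}(d_i-d_j)$. $|\cdot|$ of a matrix is its determinant. The marginal density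 is $m(\mathbf{x})=\iiint f(\mathbf{x}|\boldsymbol\theta)\pi(\boldsymbol\theta|\boldsymbol\beta,\mathbf{V})\pi(\boldsymbol\beta)\pi(\mathbf{V})\,d\mathbf{V}\,d\boldsymbol\beta\,d\boldsymbol\theta$, where $f(\mathbf{x}|\boldsymbol\theta)$ and $\pi(\boldsymbol\theta|\boldsymbol\beta,\mathbf{V})$ are the normal densities of the model. The posterior distribution (given $\mathbf{X}=\mathbf{x}$, for a given $\mathbf{x}\in\mathbb{R}^p$) is said to exist (be proper) if $0<m(\mathbf{x})<\infty$. *)

theory Defs
  imports "HOL-Analysis.Analysis"
begin

text \<open>
  The dimension \<open>k\<close> is \<open>CARD('k)\<close> and the number of groups \<open>m\<close> is \<open>CARD('m)\<close>.  A point of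
  \<open>\<real>\<^sup>p\<close>, \<open>p = m k\<close>, is an element of \<open>real ^ 'k ^ 'm\<close>, whose \<open>i\<close>-th block is \<open>x $ i\<close>.
  The linear order on \<open>'k\<close> plays the role of the order of the indices \<open>1, \<dots>, k\<close>.
\<close>

definition pos_def :: "real ^ 'k ^ 'k \<Rightarrow> bool" where
  "pos_def V \<longleftrightarrow> transpose V = V \<and> (\<forall>x. x \<noteq> 0 \<longrightarrow> 0 < x \<bullet> (V *v x))"

definition diag_mat :: "real ^ 'k \<Rightarrow> real ^ 'k ^ 'k" where
  "diag_mat d = (\<chi> i j. if i = j then d $ i else 0)"

definition mvn_density :: "real ^ 'k \<Rightarrow> real ^ 'k ^ 'k \<Rightarrow> real ^ 'k \<Rightarrow> real" where
  "mvn_density \<mu> \<Sigma> x =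
     exp (- ((x - \<mu>) \<bullet> (matrix_inv \<Sigma> *v (x - \<mu>))) / 2) / sqrt ((2 * pi) ^ CARD('k) * det \<Sigma>)"

definition likelihood :: "real ^ 'k ^ 'm \<Rightarrow> real ^ 'k ^ 'm \<Rightarrow> real" where
  "likelihood x \<theta> = (\<Prod>i\<in>UNIV. mvn_density (\<theta> $ i) (mat 1) (x $ i))"

definition theta_density :: "real ^ 'k ^ 'm \<Rightarrow> real ^ 'k \<Rightarrow> real ^ 'k ^ 'k \<Rightarrow> real" where
  "theta_density \<theta> \<beta> V = (\<Prod>i\<in>UNIV. mvn_density \<beta> V (\<theta> $ i))"

definition sym_of_upper ::
  "('k::{finite,linorder} \<times> 'k::{finite,linorder} \<Rightarrow> real) \<Rightarrow> real ^ 'k::{finite,linorder} ^ 'k::{finite,linorder}" where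
  "sym_of_upper v = (\<chi> i j. v (min i j, max i j))"

text \<open>
  The measure \<open>dV = \<Prod>\<^bsub>i \<le> j\<^esub> dV\<^sub>i\<^sub>j\<close>: the product of Lebesgue measures over the entries on and
  above the diagonal, transported to the symmetric matrices.  (Lebesgue measure of
  \<open>real ^ 'k ^ 'k\<close> would not do, since it gives the symmetric matrices measure zero when \<open>k \<ge> 2\<close>.)
\<close>

definition sym_lborel :: "(real ^ 'k::{finite,linorder} ^ 'k::{finite,linorder}) measure" where
  "sym_lborel = distr (\<Pi>\<^sub>M p\<in>{(i, j). i \<le> j}. lborel) borel sym_of_upper"

lemma measurable_sym_of_upper:
  "(sym_of_upper :: _ \<Rightarrow> real ^ 'k::{finite,linorder} ^ 'k::{finite,linorder})
     \<in> measurable (\<Pi>\<^sub>M p\<in>{(i, j). i \<le> j}. lborel) borel"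
proof -
  let ?M = "\<Pi>\<^sub>M p\<in>{(i :: 'k, j). i \<le> j}. (lborel :: real measure)"
  have comp: "(\<lambda>v. v (min i j, max i j)) \<in> borel_measurable ?M" for i j :: 'k
  proof -
    have "(min i j, max i j) \<in> {(i, j). i \<le> j}" by (auto simp: min_def max_def)
    from measurable_component_singleton[OF this, of "\<lambda>_. lborel :: real measure"]
    show ?thesis by simp
  qed
  show ?thesis
  proof (subst borel_measurable_euclidean_space, intro ballI)
    fix b :: "real ^ 'k::{finite,linorder} ^ 'k::{finite,linorder}" assume "b \<in> Basis"
    then obtain i j where b: "b = axis i (axis j 1)"
      by (auto simp: Basis_vec_def)
    have "(\<lambda>v. sym_of_upper v \<bullet> b) = (\<lambda>v. v (min i j, max i j))"
      by (simp add: b inner_axis sym_of_upper_def fun_eq_iff)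
    with comp[of i j] show "(\<lambda>v. sym_of_upper v \<bullet> b) \<in> borel_measurable ?M"
      by simp
  qed
qed

text \<open>
  A possibly improper prior density on the positive-definite matrices.  Nothing is required of
  its values at other matrices.
\<close>

definition prior_V :: "(real ^ 'k ^ 'k \<Rightarrow> real) \<Rightarrow> bool" where
  "prior_V \<pi>V \<longleftrightarrow> \<pi>V \<in> borel_measurable (restrict_space borel {V. pos_def V})
     \<and> (\<forall>V. pos_def V \<longrightarrow> 0 \<le> \<pi>V V)"

definition vandermonde :: "real ^ 'k::{finite,linorder} \<Rightarrow> real" where
  "vandermonde d = (\<Prod>(i, j)\<in>{(i, j). i < j}. d $ i - d $ j)"

text \<open>
  The prior \<open>\<pi>(H, D)\<close>, \<open>D = diag_mat d\<close>, in the coordinates \<open>V = H\<^sup>t D H\<close>; the factor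
  \<open>vandermonde d\<close> is the Jacobian of this change of variables (up to a constant, with the
  invariant measure \<open>dH\<close>).
\<close>

definition prior_HD ::
  "(real ^ 'k::{finite,linorder} ^ 'k::{finite,linorder} \<Rightarrow> real) \<Rightarrow>
   real ^ 'k::{finite,linorder} ^ 'k::{finite,linorder} \<Rightarrow> real ^ 'k::{finite,linorder} \<Rightarrow> real" where
  "prior_HD \<pi>V H d = \<pi>V (transpose H ** diag_mat d ** H) * vandermonde d"

definition marginal ::
  "(real ^ 'k::{finite,linorder} \<Rightarrow> real) \<Rightarrow>
   (real ^ 'k::{finite,linorder} ^ 'k::{finite,linorder} \<Rightarrow> real) \<Rightarrow>
   real ^ 'k::{finite,linorder} ^ 'm \<Rightarrow> ennreal" where
  "marginal \<pi>\<beta> \<pi>V x =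
     (\<integral>\<^sup>+ \<theta>. (\<integral>\<^sup>+ \<beta>. (\<integral>\<^sup>+ V. ennreal (likelihood x \<theta> * theta_density \<theta> \<beta> V * \<pi>\<beta> \<beta> * \<pi>V V)
          * indicator {V. pos_def V} V \<partial>sym_lborel) \<partial>lborel) \<partial>lborel)"

definition posterior_exists ::
  "(real ^ 'k::{finite,linorder} \<Rightarrow> real) \<Rightarrow>
   (real ^ 'k::{finite,linorder} ^ 'k::{finite,linorder} \<Rightarrow> real) \<Rightarrow>
   real ^ 'k::{finite,linorder} ^ 'm \<Rightarrow> bool" where
  "posterior_exists \<pi>\<beta> \<pi>V x \<longleftrightarrow> 0 < marginal \<pi>\<beta> \<pi>V x \<and> marginal \<pi>\<beta> \<pi>V x < \<infinity>"

end

theory Submission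
  imports Defs "HOL-Probability.Probability"
begin

text \<open>
  Integrating out \<open>\<theta>\<close> and \<open>\<beta>\<close> leaves a factor comparable with \<open>\<bar>I + V\<bar>\<close> to the power \<open>- m / 2\<close>, so the
  question is when a function of the eigenvalues of \<open>V\<close> has a finite integral against \<open>dV\<close>.

  Sufficiency needs only the upper half of the Weyl integration formula, up to a constant: the set of
  matrices with spectrum in a small cube around \<open>d\<close> has measure at most a constant times the volume of
  the cube times the Vandermonde product of \<open>d\<close>.  This is a covering argument, without the Jacobian of
  the spectral decomposition.  The eigenvalue integral is then dominated by a product of one-dimensional
  integrals.

  Necessity uses explicit sets of matrices.  If \<open>a\<^sub>1 \<ge> 1\<close>, the integral over a single diagonal entry
  already diverges at the boundary of the positive-definite cone.  If \<open>a\<^sub>2\<close> is too small, the divergence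
  comes from matrices with one eigenvalue of size \<open>t\<close> and the others bounded, which occupy volume about
  \<open>t\<close> to the power \<open>k - 1\<close> per unit length of \<open>t\<close>.
\<close>

section \<open>Invariant measures\<close>

text \<open>An unspecified constant is harmless throughout, since only finiteness is at stake. What
  must be exact is the invariance of \<open>sym_lborel\<close> under orthogonal conjugation; it
  comes from the uniqueness of translation-invariant measures, not from computing a determinant.

  With respect to dV the prior carries the Vandermonde product to the power l - 1, because the
  Jacobian is divided out. For necessity, l \<le> 1 turns upper bounds of the Vandermonde product
  into lower bounds of the density; for sufficiency the Jacobian returns, and l \<ge> 0 lets an
  upper bound act on the power l.

  The critical exponent is the same count in both directions. The largest eigenvalue t occurs in k -
  1 factors of the Vandermonde product, so it contributes t to the power (k - 1) l - a2 - m / 2,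
  which is integrable at infinity exactly when the exponent is below -1. The exponent a1 acts only
  at 0: for large t it cancels between the two determinants.\<close>

type_synonym 'k sqmat = "((real, 'k) vec, 'k) vec"
type_synonym 'k rvec = "(real, 'k) vec"

text \<open>The uniqueness argument for Haar measure: the double integral of the indicators of
  \<open>x \<in> A\<close> and \<open>y - x \<in> K\<close>, evaluated in both orders by Fubini,
  gives N(A) M(K) = M(A) N(K), and the common value on \<open>K\<close> cancels. Symmetry of
  \<open>K\<close> absorbs the sign produced by shifting x. The subgroup \<open>S\<close> is there
  because \<open>sym_lborel\<close> lives on all matrices but is invariant only under symmetric
  translations.\<close>

lemma translation_invariant_measure_unique:
  fixes M N :: "'a::euclidean_space measure"
  assumes sets: "sets M = sets borel" "sets N = sets borel"
    and sf: "sigma_finite_measure M" "sigma_finite_measure N"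
    and S: "\<And>x y. x \<in> S \<Longrightarrow> y \<in> S \<Longrightarrow> x + y \<in> S" "\<And>x. x \<in> S \<Longrightarrow> - x \<in> S"
    and ae: "AE x in M. x \<in> S" "AE x in N. x \<in> S"
    and inv: "\<And>c. c \<in> S \<Longrightarrow> distr M borel (\<lambda>x. x + c) = M" "\<And>c. c \<in> S \<Longrightarrow> distr N borel (\<lambda>x. x + c) = N"
    and K: "K \<in> sets borel" "\<And>x. - x \<in> K \<longleftrightarrow> x \<in> K"
    and KM: "emeasure M K = emeasure N K" "emeasure M K \<noteq> 0" "emeasure M K \<noteq> \<infinity>"
  shows "M = N"
proof (rule measure_eqI)
  show "sets M = sets N" using sets by simp
  fix A assume "A \<in> sets M"
  hence A [measurable]: "A \<in> sets borel" by (simp add: sets)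
  note K(1) [measurable] sets [measurable_cong]
  interpret pair_sigma_finite M N
    using sf by (simp add: pair_sigma_finite_def)
  have shiftM: "(\<integral>\<^sup>+y. f y \<partial>M) = (\<integral>\<^sup>+y. f (y + c) \<partial>M)" if "c \<in> S" "f \<in> borel_measurable borel" for c and f :: "'a \<Rightarrow> ennreal"
    by (subst inv(1)[OF that(1), symmetric], subst nn_integral_distr) (use that in \<open>auto simp: sets\<close>)
  have shiftN: "(\<integral>\<^sup>+y. f y \<partial>N) = (\<integral>\<^sup>+y. f (y + c) \<partial>N)" if "c \<in> S" "f \<in> borel_measurable borel" for c and f :: "'a \<Rightarrow> ennreal"
    by (subst inv(2)[OF that(1), symmetric], subst nn_integral_distr) (use that in \<open>auto simp: sets\<close>)
  have "emeasure N A * emeasure M K = (\<integral>\<^sup>+x. indicator A x * emeasure M K \<partial>N)"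
    by (simp add: nn_integral_multc sets)
  also have "\<dots> = (\<integral>\<^sup>+x. (\<integral>\<^sup>+y. indicator A x * indicator K (y - x) \<partial>M) \<partial>N)"
  proof (rule nn_integral_cong_AE)
    show "AE x in N. indicator A x * emeasure M K = (\<integral>\<^sup>+y. indicator A x * indicator K (y - x) \<partial>M)"
      using ae(2)
    proof eventually_elim
      case (elim x)
      have "emeasure M K = (\<integral>\<^sup>+y. indicator K y \<partial>M)" by (simp add: sets)
      also have "\<dots> = (\<integral>\<^sup>+y. indicator K (y - x) \<partial>M)"
        using shiftM[of "-x" "indicator K"] elim S by simp
      finally show ?case by (simp add: nn_integral_cmult)
    qed
  qed
  also have "\<dots> = (\<integral>\<^sup>+y. (\<integral>\<^sup>+x. indicator A x * indicator K (y - x) \<partial>N) \<partial>M)"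
    by (rule Fubini') measurable
  also have "\<dots> = (\<integral>\<^sup>+y. (\<integral>\<^sup>+x. indicator A (x + y) * indicator K x \<partial>N) \<partial>M)"
  proof (rule nn_integral_cong_AE)
    show "AE y in M. (\<integral>\<^sup>+x. indicator A x * indicator K (y - x) \<partial>N) = 
       (\<integral>\<^sup>+x. indicator A (x + y) * indicator K x \<partial>N)"
      using ae(1)
    proof eventually_elim
      case (elim y)
      have "indicator K (- x) = (indicator K x :: ennreal)" for x
        using K(2)[of x] by (simp add: indicator_def)
      thus ?case
        using shiftN[OF elim, of "\<lambda>x. indicator A x * indicator K (y - x)"] by simp
    qed
  qed
  also have "\<dots> = (\<integral>\<^sup>+x. (\<integral>\<^sup>+y. indicator A (x + y) * indicator K x \<partial>M) \<partial>N)"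
    by (rule Fubini'[symmetric]) measurable
  also have "\<dots> = (\<integral>\<^sup>+x. emeasure M A * indicator K x \<partial>N)"
  proof (rule nn_integral_cong_AE)
    show "AE x in N. (\<integral>\<^sup>+y. indicator A (x + y) * indicator K x \<partial>M) = emeasure M A * indicator K x"
      using ae(2)
    proof eventually_elim
      case (elim x)
      have "emeasure M A = (\<integral>\<^sup>+y. indicator A y \<partial>M)" by (simp add: sets)
      also have "\<dots> = (\<integral>\<^sup>+y. indicator A (x + y) \<partial>M)"
        using shiftM[OF elim, of "indicator A"] by (simp add: add.commute)
      finally show ?case by (simp add: nn_integral_multc)
    qed
  qed
  also have "\<dots> = emeasure M A * emeasure N K" by (simp add: nn_integral_cmult sets)
  finally have "emeasure N A * emeasure M K = emeasure M A * emeasure M K" by (simp add: KM(1))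
  thus "emeasure M A = emeasure N A"
    using KM(2,3) ennreal_mult_cancel_left[of "emeasure M K" "emeasure N A" "emeasure M A"]
    by (simp add: mult.commute)
qed

text \<open>An orthogonal map turns a shift by the preimage of c into a shift by c, so the image
  measure is again translation invariant; it also fixes the unit ball, which pins down the
  constant.\<close>

lemma lborel_orthogonal:
  fixes f :: "'a::euclidean_space \<Rightarrow> 'a"
  assumes f: "orthogonal_transformation f"
  shows "distr lborel borel f = lborel"
proof -
  have lin: "linear f" and nf: "\<And>v. norm (f v) = norm v"
    using f by (auto simp: orthogonal_transformation)
  have bij: "bij f" using f by (rule orthogonal_transformation_bij)
  have [measurable]: "f \<in> borel_measurable borel"
    by (intro borel_measurable_continuous_onI linear_continuous_on) (use lin linear_conv_bounded_linear in blast)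
  have ball: "f -` cball 0 1 = cball 0 1"
    by (auto simp: nf)
  have "emeasure (lborel :: 'a measure) (cball 0 1) \<noteq> 0"
  proof -
    have "emeasure lborel (cball 0 1 :: 'a set) > 0"
      by (subst emeasure_cball) (auto simp: unit_ball_vol_pos)
    thus ?thesis by simp
  qed
  moreover have "emeasure (lborel :: 'a measure) (cball 0 1) \<noteq> \<infinity>"
    using emeasure_bounded_finite[of "cball 0 1 :: 'a set"] by simp
  moreover have "sigma_finite_measure (distr lborel borel f)"
  proof -
    obtain g where g: "orthogonal_transformation g" "\<And>x. f (g x) = x" "\<And>x. g (f x) = x"
    proof
      show "orthogonal_transformation (inv f)" using f by (rule orthogonal_transformation_inv)
      show "f (inv f x) = x" for x using bij by (simp add: bij_is_surj surj_f_inv_f)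
      show "inv f (f x) = x" for x using bij by (simp add: bij_is_inj)
    qed
    show ?thesis
    proof
      show "\<exists>A. countable A \<and> A \<subseteq> sets (distr lborel borel f) \<and> \<Union> A = space (distr lborel borel f) \<and>
             (\<forall>a\<in>A. emeasure (distr lborel borel f) a \<noteq> \<infinity>)"
      proof (intro exI conjI ballI)
        let ?A = "range (\<lambda>n::nat. cball 0 (real n)) :: 'a set set"
        show "countable ?A" by simp
        show "?A \<subseteq> sets (distr lborel borel f)" by auto
        show "\<Union>?A = space (distr lborel borel f)" by (auto simp: real_arch_simple)
        fix a assume "a \<in> ?A"
        then obtain n where a: "a = cball 0 (real n)" by auto
        have "f -` a = a" by (auto simp: a nf)
        thus "emeasure (distr lborel borel f) a \<noteq> \<infinity>"
          using emeasure_bounded_finite[of a] by (simp add: emeasure_distr a)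
      qed
    qed
  qed
  ultimately have facts: "emeasure (lborel :: 'a measure) (cball 0 1) \<noteq> 0" "emeasure (lborel :: 'a measure) (cball 0 1) \<noteq> \<infinity>" "sigma_finite_measure (distr lborel borel f)"
    by auto
  have tr: "distr lborel borel (\<lambda>x. x + c) = (lborel :: 'a measure)" for c
    using lborel_affine[of 1 c] by (simp add: add.commute density_1)
  show ?thesis
  proof (rule translation_invariant_measure_unique[where S = UNIV and K = "cball 0 1"])
    fix c :: 'a
    obtain c' where c': "f c' = c" using bij by (metis bij_is_surj surjD)
    have "distr (distr lborel borel f) borel (\<lambda>x. x + c) = distr lborel borel (\<lambda>x. f x + c)"
      by (simp add: distr_distr comp_def)
    also have "(\<lambda>x. f x + c) = (\<lambda>x. f (x + c'))"
      using c' lin by (simp add: linear_add)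
    also have "distr lborel borel (\<lambda>x. f (x + c')) = distr (distr lborel borel (\<lambda>x. x + c')) borel f"
      by (simp add: distr_distr comp_def)
    finally show "distr (distr lborel borel f) borel (\<lambda>x. x + c) = distr lborel borel f" by (simp add: tr)
  next
    show eq: "emeasure (distr lborel borel f) (cball 0 1) = emeasure lborel (cball 0 1 :: 'a set)"
      by (simp add: emeasure_distr ball)
    show "emeasure (distr lborel borel f) (cball 0 1) \<noteq> 0" "emeasure (distr lborel borel f) (cball 0 1) \<noteq> \<infinity>"
      unfolding eq by (fact facts(1), fact facts(2))
  qed (simp_all add: tr sigma_finite_lborel facts(3))
qed

lemma nn_integral_lborel_orthogonal:
  fixes f :: "'a::euclidean_space \<Rightarrow> 'a"
  assumes f: "orthogonal_transformation f" and g: "g \<in> borel_measurable borel"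
  shows "(\<integral>\<^sup>+x. g (f x) \<partial>lborel) = (\<integral>\<^sup>+x. g x \<partial>lborel)"
proof -
  have "linear f" using f by (auto simp: orthogonal_transformation)
  hence [measurable]: "f \<in> borel_measurable borel"
    by (intro borel_measurable_continuous_onI linear_continuous_on) (use linear_conv_bounded_linear in blast)
  have "(\<integral>\<^sup>+x. g x \<partial>lborel) = (\<integral>\<^sup>+x. g x \<partial>distr lborel borel f)"
    by (simp add: lborel_orthogonal[OF f])
  also have "\<dots> = (\<integral>\<^sup>+x. g (f x) \<partial>lborel)" using g by (subst nn_integral_distr) auto
  finally show ?thesis by simp
qed

section \<open>Lebesgue measure on vectors of blocks as a product measure\<close>

lemma measurable_vec_component [measurable]:
  "(\<lambda>x :: 'a::euclidean_space ^ 'm. x $ i) \<in> borel_measurable borel"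
  by (intro borel_measurable_continuous_onI continuous_intros)

lemma measurable_vec_lambda_PiM [measurable]:
  "vec_lambda \<in> measurable (\<Pi>\<^sub>M i\<in>(UNIV::'m::finite set). (lborel :: 'a::euclidean_space measure)) borel"
proof (subst borel_measurable_euclidean_space, intro ballI)
  fix b :: "'a ^ 'm" assume "b \<in> Basis"
  then obtain i u where b: "b = axis i u" by (auto simp: Basis_vec_def)
  show "(\<lambda>x. vec_lambda x \<bullet> b) \<in> borel_measurable (\<Pi>\<^sub>M i\<in>(UNIV::'m set). (lborel :: 'a measure))"
    by (simp add: b inner_axis)
qed

text \<open>Stated for Euclidean blocks because it is used at two levels: vector blocks separate the
  integral over \<theta> into its m groups, and real entries separate the coordinates in an
  eigenbasis.\<close>

lemma lborel_vec_eq_PiM: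
  "(lborel :: ('a::euclidean_space ^ 'm) measure) = distr (\<Pi>\<^sub>M i\<in>UNIV. lborel) borel vec_lambda"
proof (rule lborel_eqI)
  interpret product_sigma_finite "\<lambda>_::'m. lborel :: 'a measure" by standard
  show "sets (distr (\<Pi>\<^sub>M i\<in>UNIV. lborel) borel vec_lambda) = sets borel" by simp
  fix l u :: "'a ^ 'm" assume le: "\<And>b. b \<in> Basis \<Longrightarrow> l \<bullet> b \<le> u \<bullet> b"
  have le': "l $ i \<bullet> b \<le> u $ i \<bullet> b" if "b \<in> Basis" for i b
    using le[of "axis i b"] that by (auto simp: inner_axis Basis_vec_def)
  have "emeasure (distr (\<Pi>\<^sub>M i\<in>UNIV. lborel) borel vec_lambda) (box l u) =
        emeasure (\<Pi>\<^sub>M i\<in>UNIV. lborel) (vec_lambda -` box l u \<inter> space (\<Pi>\<^sub>M i\<in>(UNIV::'m set). (lborel :: 'a measure)))"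
    by (subst emeasure_distr) auto
  also have "vec_lambda -` box l u \<inter> space (\<Pi>\<^sub>M i\<in>(UNIV::'m set). (lborel :: 'a measure)) = (\<Pi>\<^sub>E i\<in>UNIV. box (l $ i) (u $ i))"
    by (auto simp: space_PiM box_def Basis_vec_def inner_axis PiE_iff)
  also have "emeasure (\<Pi>\<^sub>M i\<in>UNIV. lborel) \<dots> = (\<Prod>i\<in>UNIV. emeasure lborel (box (l $ i) (u $ i)))"
    by (subst emeasure_PiM) auto
  also have "\<dots> = (\<Prod>i\<in>UNIV. \<Prod>b\<in>Basis. ennreal ((u $ i - l $ i) \<bullet> b))"
    using le' by (intro prod.cong refl) (simp add: emeasure_lborel_box prod_ennreal inner_diff_left)
  also have "\<dots> = ennreal (\<Prod>i\<in>UNIV. \<Prod>b\<in>Basis. (u $ i - l $ i) \<bullet> b)"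
    using le' by (simp add: prod_ennreal inner_diff_left prod_nonneg)
  also have "(\<Prod>i\<in>UNIV. \<Prod>b\<in>Basis. (u $ i - l $ i) \<bullet> b) = (\<Prod>b\<in>Basis. (u - l) \<bullet> b)"
  proof -
    have "(Basis :: ('a ^ 'm) set) = (\<lambda>(i, b). axis i b) ` (UNIV \<times> Basis)"
      by (auto simp: Basis_vec_def)
    moreover have "inj_on (\<lambda>(i, b). axis i b) (UNIV \<times> (Basis :: 'a set) :: ('m \<times> 'a) set)"
      by (auto simp: inj_on_def axis_eq_axis nonzero_Basis)
    ultimately have "(\<Prod>b\<in>Basis. (u - l) \<bullet> b) = (\<Prod>(i, b)\<in>UNIV \<times> Basis. (u - l) \<bullet> axis i b)"
      using prod.reindex[of "\<lambda>(i, b). axis i b" "UNIV \<times> Basis" "\<lambda>b. (u - l) \<bullet> b"]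
      by (simp add: case_prod_unfold comp_def)
    also have "\<dots> = (\<Prod>i\<in>UNIV. \<Prod>b\<in>Basis. (u $ i - l $ i) \<bullet> b)"
      by (simp add: prod.cartesian_product inner_axis)
    finally show ?thesis by simp
  qed
  finally show "emeasure (distr (\<Pi>\<^sub>M i\<in>UNIV. lborel) borel vec_lambda) (box l u) = (\<Prod>b\<in>Basis. (u - l) \<bullet> b)"
    by simp
qed

lemma nn_integral_lborel_vec_prod:
  fixes h :: "'m::finite \<Rightarrow> 'a::euclidean_space \<Rightarrow> ennreal"
  assumes [measurable]: "\<And>i. h i \<in> borel_measurable borel"
  shows "(\<integral>\<^sup>+\<theta>. (\<Prod>i\<in>UNIV. h i (\<theta> $ i)) \<partial>lborel) = (\<Prod>i\<in>UNIV. \<integral>\<^sup>+t. h i t \<partial>lborel)"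
proof -
  interpret product_sigma_finite "\<lambda>_::'m. lborel :: 'a measure" by standard
  show ?thesis
    by (subst lborel_vec_eq_PiM, subst nn_integral_distr)
      (auto simp: product_nn_integral_prod)
qed

section \<open>The measure dV: boxes and symmetric translations\<close>

lemma sets_sym_lborel [measurable_cong, simp]: "sets sym_lborel = sets borel"
  by (simp add: sym_lborel_def)

lemma space_sym_lborel [simp]: "space sym_lborel = UNIV"
  by (simp add: sym_lborel_def)

lemma measurable_vec_entry [measurable]: "(\<lambda>V::real^'a^'b. V $ i $ j) \<in> borel_measurable borel"
  by (intro borel_measurable_continuous_onI continuous_intros)

lemma sets_symmetric [measurable]: "{V. transpose V = (V :: 'k::{finite,linorder} sqmat)} \<in> sets borel"
proof -
  have "{V. transpose V = (V :: 'k::{finite,linorder} sqmat)} = (\<Inter>i. \<Inter>j. {V. V $ i $ j = V $ j $ i})"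
    by (auto simp: vec_eq_iff transpose_def)
  also have "\<dots> \<in> sets borel" by measurable
  finally show ?thesis .
qed

lemma AE_sym_lborel: "AE V in sym_lborel. transpose V = (V :: 'k::{finite,linorder} sqmat)"
  unfolding sym_lborel_def
  by (subst AE_distr_iff[OF measurable_sym_of_upper])
     (use sets_symmetric in \<open>simp_all add: sym_of_upper_def transpose_def min.commute max.commute\<close>)

text \<open>Only the entries that are coordinates of dV are constrained. Among all matrices such a
  box is a cylinder, free below the diagonal; where actual symmetry matters it has to be added
  through \<open>AE_sym_lborel\<close>.\<close>

definition sym_box :: "('k \<Rightarrow> 'k \<Rightarrow> real) \<Rightarrow> ('k \<Rightarrow> 'k \<Rightarrow> real) \<Rightarrow> ('k::{finite,linorder} sqmat) set" where
  "sym_box l u = {V. \<forall>i j. i \<le> j \<longrightarrow> l i j \<le> V $ i $ j \<and> V $ i $ j \<le> u i j}"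

lemma sym_box_measurable [measurable]: "sym_box l u \<in> sets borel"
proof -
  have "sym_box l u = (\<Inter>i. \<Inter>j. {V. i \<le> j \<longrightarrow> l i j \<le> V $ i $ j \<and> V $ i $ j \<le> u i j})"
    by (auto simp: sym_box_def)
  also have "\<dots> \<in> sets borel" by measurable
  finally show ?thesis .
qed

lemma emeasure_sym_box:
  fixes l u :: "'k::{finite,linorder} \<Rightarrow> 'k \<Rightarrow> real"
  assumes "\<And>i j. i \<le> j \<Longrightarrow> l i j \<le> u i j"
  shows "emeasure sym_lborel (sym_box l u) = ennreal (\<Prod>(i, j)\<in>{(i, j). i \<le> j}. u i j - l i j)"
proof -
  let ?P = "{(i :: 'k, j). i \<le> j}"
  interpret product_sigma_finite "\<lambda>_::'k \<times> 'k. lborel :: real measure" by standard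
  have "emeasure sym_lborel (sym_box l u) =
        emeasure (\<Pi>\<^sub>M p\<in>?P. lborel) (sym_of_upper -` sym_box l u \<inter> space (\<Pi>\<^sub>M p\<in>?P. (lborel :: real measure)))"
    unfolding sym_lborel_def by (subst emeasure_distr[OF measurable_sym_of_upper]) auto
  also have "sym_of_upper -` sym_box l u \<inter> space (\<Pi>\<^sub>M p\<in>?P. (lborel :: real measure)) =
      (\<Pi>\<^sub>E p\<in>?P. {l (fst p) (snd p)..u (fst p) (snd p)})"
    by (auto simp: space_PiM sym_box_def sym_of_upper_def PiE_iff min_def max_def)
  also have "emeasure (\<Pi>\<^sub>M p\<in>?P. lborel) \<dots> = (\<Prod>p\<in>?P. ennreal (u (fst p) (snd p) - l (fst p) (snd p)))"
    using assms by (subst emeasure_PiM) (auto intro!: prod.cong simp: emeasure_lborel_Icc)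
  also have "\<dots> = ennreal (\<Prod>(i, j)\<in>?P. u i j - l i j)"
    using assms by (subst prod_ennreal) (auto simp: case_prod_unfold)
  finally show ?thesis .
qed

lemma sigma_finite_sym_lborel: "sigma_finite_measure (sym_lborel :: ('k::{finite,linorder} sqmat) measure)"
proof
  let ?A = "range (\<lambda>n::nat. sym_box (\<lambda>_ _. - real n) (\<lambda>_ _. real n)) :: ('k::{finite,linorder} sqmat) set set"
  show "\<exists>A. countable A \<and> A \<subseteq> sets sym_lborel \<and> \<Union> A = space (sym_lborel :: ('k::{finite,linorder} sqmat) measure) \<and>
             (\<forall>a\<in>A. emeasure sym_lborel a \<noteq> \<infinity>)"
  proof (intro exI conjI ballI)
    show "countable ?A" by simp
    show "?A \<subseteq> sets sym_lborel" by auto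
    show "\<Union>?A = space (sym_lborel :: ('k::{finite,linorder} sqmat) measure)"
    proof -
      have "V \<in> \<Union>?A" for V :: "'k sqmat"
      proof -
        obtain n :: nat where n: "norm V \<le> real n" using real_arch_simple by blast
        have "\<bar>V $ i $ j\<bar> \<le> real n" for i j
          using Finite_Cartesian_Product.norm_nth_le[of V i] component_le_norm_cart[of "V $ i" j] n by linarith
        hence "V \<in> sym_box (\<lambda>_ _. - real n) (\<lambda>_ _. real n)"
          by (auto simp: sym_box_def abs_le_iff minus_le_iff)
        thus ?thesis by blast
      qed
      thus ?thesis by auto
    qed
    fix a assume "a \<in> ?A"
    then obtain n where "a = sym_box (\<lambda>_ _. - real n) (\<lambda>_ _. real n)" by auto
    thus "emeasure sym_lborel a \<noteq> \<infinity>" by (simp add: emeasure_sym_box)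
  qed
qed

text \<open>In the coordinates on and above the diagonal this is a coordinatewise shift of a product
  of Lebesgue measures. Symmetry of \<open>C\<close> makes the entries below the diagonal move
  along.\<close>

lemma sym_lborel_translation:
  fixes C :: "'k::{finite,linorder} sqmat"
  assumes C: "transpose C = C"
  shows "distr sym_lborel borel (\<lambda>V. V + C) = sym_lborel"
proof -
  let ?P = "{(i :: 'k, j). i \<le> j}"
  let ?M = "\<Pi>\<^sub>M p\<in>?P. (lborel :: real measure)"
  let ?t = "\<lambda>v. \<lambda>p\<in>?P. v p + C $ fst p $ snd p"
  interpret product_sigma_finite "\<lambda>_::'k \<times> 'k. lborel :: real measure" by standard
  have [measurable]: "?t \<in> measurable ?M ?M" by measurable
  have "distr ?M ?M ?t = ?M"
  proof (rule PiM_eqI)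
    fix A :: "'k \<times> 'k \<Rightarrow> real set" assume A: "\<And>i. i \<in> ?P \<Longrightarrow> A i \<in> sets lborel"
    have [simp]: "(\<lambda>x. x + c) -` B \<in> sets borel" if "B \<in> sets borel" for B and c :: real
      using measurable_sets[of "\<lambda>x. x + c" borel borel B] that by simp
    have "emeasure (distr ?M ?M ?t) (Pi\<^sub>E ?P A) = emeasure ?M (?t -` Pi\<^sub>E ?P A \<inter> space ?M)"
      using A by (subst emeasure_distr) (auto intro!: sets_PiM_I_finite)
    also have "?t -` Pi\<^sub>E ?P A \<inter> space ?M = (\<Pi>\<^sub>E p\<in>?P. (\<lambda>x. x + C $ fst p $ snd p) -` A p)"
      by (auto simp: space_PiM PiE_iff)
    also have "emeasure ?M \<dots> = (\<Prod>p\<in>?P. emeasure lborel ((\<lambda>x. x + C $ fst p $ snd p) -` A p))"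
      using A by (subst emeasure_PiM) auto
    also have "\<dots> = (\<Prod>p\<in>?P. emeasure lborel (A p))"
    proof (rule prod.cong[OF refl])
      fix p assume "p \<in> ?P"
      hence "A p \<in> sets borel" using A by auto
      thus "emeasure lborel ((\<lambda>x. x + C $ fst p $ snd p) -` A p) = emeasure lborel (A p)"
        by (subst (2) lborel_distr_plus[symmetric, of "C $ fst p $ snd p"])
           (simp add: emeasure_distr add.commute[of _ "C $ fst p $ snd p"])
    qed
    finally show "emeasure (distr ?M ?M ?t) (Pi\<^sub>E ?P A) = (\<Prod>p\<in>?P. emeasure lborel (A p))" .
  qed auto
  hence *: "sym_lborel = distr (distr ?M ?M ?t) borel sym_of_upper" by (simp add: sym_lborel_def)
  have "distr sym_lborel borel (\<lambda>V. V + C) = distr ?M borel (\<lambda>v. sym_of_upper v + C)"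
    unfolding sym_lborel_def using measurable_sym_of_upper by (subst distr_distr) (auto simp: comp_def)
  also have "\<dots> = distr ?M borel (\<lambda>v. sym_of_upper (?t v))"
  proof (rule distr_cong)
    fix v
    have "C $ min i j $ max i j = C $ i $ j" for i j
      using arg_cong[OF C, of "\<lambda>D. D $ i $ j"] by (auto simp: min_def max_def transpose_def)
    thus "sym_of_upper v + C = sym_of_upper (?t v)"
      by (auto simp: sym_of_upper_def vec_eq_iff min_le_iff_disj le_max_iff_disj)
  qed auto
  also have "\<dots> = sym_lborel"
    by (subst *, subst distr_distr[OF measurable_sym_of_upper]) (auto simp: comp_def)
  finally show ?thesis .
qed

section \<open>Invariance of dV under orthogonal conjugation\<close>

lemma matrix_add_rdistrib: "(B + C) ** A = B ** A + C ** (A :: 'a::semiring_1 ^ 'n ^ 'm)"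
  by (vector matrix_matrix_mult_def sum.distrib[symmetric] distrib_right)

lemma transpose_add: "transpose (A + B) = transpose A + transpose (B :: 'a::plus ^ 'n ^ 'm)"
  by (simp add: transpose_def vec_eq_iff)

lemma transpose_minus: "transpose (- A) = - transpose (A :: 'a::uminus ^ 'n ^ 'm)"
  by (simp add: transpose_def vec_eq_iff)

lemma norm_matrix_squared: "(norm (V :: real ^ 'a ^ 'b))\<^sup>2 = trace (V ** transpose V)"
  by (simp add: norm_vec_def L2_set_def trace_def matrix_matrix_mult_def transpose_def power2_eq_square
     sum_nonneg real_sqrt_mult_self)

text \<open>The norm of a matrix as a vector of vectors is the Frobenius norm, a trace, and traces
  are invariant under cyclic permutation. This provides conjugation-invariant balls as test sets for
  the uniqueness theorem.\<close>

lemma norm_orthogonal_conj: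
  fixes U V :: "'k::finite sqmat"
  assumes U: "orthogonal_matrix U"
  shows "norm (U ** V ** transpose U) = norm V"
proof -
  have UU: "transpose U ** U = mat 1" using U by (simp add: orthogonal_matrix_def)
  have "(U ** V ** transpose U) ** transpose (U ** V ** transpose U)
      = U ** V ** (transpose U ** U) ** transpose V ** transpose U"
    by (simp add: matrix_transpose_mul matrix_mul_assoc)
  also have "\<dots> = U ** (V ** transpose V ** transpose U)" by (simp add: UU matrix_mul_assoc)
  finally have "trace ((U ** V ** transpose U) ** transpose (U ** V ** transpose U)) = 
    trace ((V ** transpose V ** transpose U) ** U)" by (simp only: trace_mul_sym[of U])
  also have "(V ** transpose V ** transpose U) ** U = V ** transpose V"
    by (simp add: UU flip: matrix_mul_assoc)
  finally have "(norm (U ** V ** transpose U))\<^sup>2 = (norm V)\<^sup>2" by (simp add: norm_matrix_squared)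
  thus ?thesis by (simp add: power2_eq_iff_nonneg)
qed

lemma continuous_on_matrix_mult [continuous_intros]:
  fixes f :: "'a::topological_space \<Rightarrow> real ^ 'b ^ 'c" and g :: "'a \<Rightarrow> real ^ 'd ^ 'b"
  assumes "continuous_on S f" "continuous_on S g"
  shows "continuous_on S (\<lambda>x. f x ** g x)"
  unfolding matrix_matrix_mult_def using assms
  by (intro continuous_on_vec_lambda continuous_intros)

lemma conj_measurable [measurable]: "(\<lambda>V. A ** V ** B) \<in> borel_measurable borel"
  for A :: "real ^ 'a ^ 'b" and B :: "real ^ 'c ^ 'd"
  by (intro borel_measurable_continuous_onI continuous_intros)

text \<open>Conjugation by \<open>U\<close> carries translation by
  \<open>transpose U ** C ** U\<close> to translation by \<open>C\<close>, so the image measure is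
  invariant under symmetric translations and agrees with \<open>sym_lborel\<close> on the Frobenius
  unit ball. No Jacobian in upper triangular coordinates is computed.\<close>

theorem sym_lborel_conj:
  fixes U :: "'k::{finite,linorder} sqmat"
  assumes U: "orthogonal_matrix U"
  shows "distr sym_lborel borel (\<lambda>V. U ** V ** transpose U) = sym_lborel"
proof -
  let ?f = "\<lambda>V. U ** V ** transpose U" and ?g = "\<lambda>V. transpose U ** V ** U"
  have UU: "transpose U ** U = mat 1" "U ** transpose U = mat 1" using U by (simp_all add: orthogonal_matrix_def)
  have fg: "?f (?g V) = V" for V
  proof -
    have "?f (?g V) = (U ** transpose U) ** V ** (U ** transpose U)" by (simp only: matrix_mul_assoc)
    thus ?thesis by (simp add: UU)
  qed
  have trf: "transpose (?f V) = ?f V" if "transpose V = V" for V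
    using that by (simp add: matrix_transpose_mul matrix_mul_assoc)
  have trg: "transpose (?g V) = ?g V" if "transpose V = V" for V
    using that by (simp add: matrix_transpose_mul matrix_mul_assoc)
  have ball: "?f -` cball 0 r = cball 0 r" for r
    by (auto simp: norm_orthogonal_conj[OF U])
  have fin: "emeasure sym_lborel (cball 0 r :: ('k sqmat) set) \<noteq> \<infinity>" for r
  proof -
    have "cball 0 r \<subseteq> (sym_box (\<lambda>_ _. - \<bar>r\<bar>) (\<lambda>_ _. \<bar>r\<bar>) :: ('k sqmat) set)"
    proof
      fix V :: "'k sqmat" assume "V \<in> cball 0 r"
      hence n: "norm V \<le> \<bar>r\<bar>" by simp
      have "\<bar>V $ i $ j\<bar> \<le> \<bar>r\<bar>" for i j
        using Finite_Cartesian_Product.norm_nth_le[of V i] component_le_norm_cart[of "V $ i" j] n by linarith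
      thus "V \<in> sym_box (\<lambda>_ _. - \<bar>r\<bar>) (\<lambda>_ _. \<bar>r\<bar>)"
        by (auto simp: sym_box_def abs_le_iff minus_le_iff)
    qed
    hence "emeasure sym_lborel (cball 0 r :: ('k sqmat) set) \<le> emeasure sym_lborel (sym_box (\<lambda>_ _. - \<bar>r\<bar>) (\<lambda>_ _. \<bar>r\<bar>) :: ('k sqmat) set)"
      by (intro emeasure_mono) auto
    also have "\<dots> < \<infinity>" by (simp add: emeasure_sym_box)
    finally show ?thesis by simp
  qed
  have pos: "emeasure sym_lborel (cball 0 1 :: ('k sqmat) set) \<noteq> 0"
  proof -
    \<comment> \<open>With entries of absolute value at most 1 / k^2, the sum of all of them is at
      most 1 and dominates the Frobenius norm. The intersection with the symmetric matrices controls
      the entries that the box leaves free, without changing its measure.\<close>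
    let ?e = "1 / (real CARD('k) * real CARD('k))"
    have e: "?e > 0" by simp
    have "emeasure sym_lborel (sym_box (\<lambda>_ _. - ?e) (\<lambda>_ _. ?e) \<inter> {V. transpose V = V} :: ('k sqmat) set)
       \<le> emeasure sym_lborel (cball 0 1 :: ('k sqmat) set)"
    proof (rule emeasure_mono)
      show "(sym_box (\<lambda>_ _. - ?e) (\<lambda>_ _. ?e) \<inter> {V. transpose V = V} :: ('k sqmat) set) \<subseteq> cball 0 1"
      proof clarify
        fix V :: "'k sqmat" assume V: "V \<in> sym_box (\<lambda>_ _. - ?e) (\<lambda>_ _. ?e)" "transpose V = V"
        have "\<bar>V $ i $ j\<bar> \<le> ?e" for i j
        proof (cases "i \<le> j")
          case True thus ?thesis using V by (auto simp: sym_box_def abs_le_iff minus_le_iff)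
        next
          case False 
          moreover have "V $ i $ j = V $ j $ i" using arg_cong[OF V(2), of "\<lambda>D. D $ i $ j"] by (simp add: transpose_def)
          ultimately show ?thesis using V(1) by (auto simp: sym_box_def abs_le_iff minus_le_iff)
        qed
        note ij = this
        have "norm V \<le> (\<Sum>i\<in>UNIV. norm (V $ i))"
          unfolding norm_vec_def by (rule L2_set_le_sum) simp
        also have "\<dots> \<le> (\<Sum>i\<in>(UNIV::'k set). \<Sum>j\<in>(UNIV::'k set). \<bar>V $ i $ j\<bar>)"
          by (intro sum_mono norm_le_l1_cart)
        also have "\<dots> \<le> (\<Sum>i\<in>(UNIV::'k set). \<Sum>j\<in>(UNIV::'k set). ?e)"
          by (intro sum_mono ij)
        also have "\<dots> = 1" by simp
        finally show "V \<in> cball 0 1" by simp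
      qed
    qed simp
    also have "emeasure sym_lborel (sym_box (\<lambda>_ _. - ?e) (\<lambda>_ _. ?e) \<inter> {V. transpose V = V} :: ('k sqmat) set)
      = emeasure sym_lborel (sym_box (\<lambda>_ _. - ?e) (\<lambda>_ _. ?e) :: ('k sqmat) set)"
    proof (rule emeasure_eq_AE)
      show "AE V in sym_lborel. (V \<in> sym_box (\<lambda>_ _. - ?e) (\<lambda>_ _. ?e) \<inter> {V. transpose V = V}) =
        ((V :: 'k sqmat) \<in> sym_box (\<lambda>_ _. - ?e) (\<lambda>_ _. ?e))"
        using AE_sym_lborel by eventually_elim auto
      show "sym_box (\<lambda>_ _. - ?e) (\<lambda>_ _. ?e) \<inter> {V. transpose V = (V :: 'k sqmat)} \<in> sets sym_lborel" by simp
    qed simp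
    finally have "emeasure sym_lborel (sym_box (\<lambda>_ _. - ?e) (\<lambda>_ _. ?e) :: 'k sqmat set)
      \<le> emeasure sym_lborel (cball 0 1 :: 'k sqmat set)" .
    moreover have "emeasure sym_lborel (sym_box (\<lambda>_ _. - ?e) (\<lambda>_ _. ?e) :: 'k sqmat set) > 0"
      using e by (subst emeasure_sym_box) (auto intro!: prod_pos simp: ennreal_less_zero_iff)
    ultimately show ?thesis by (metis not_less zero_less_iff_neq_zero)
  qed
  show ?thesis
  proof (rule translation_invariant_measure_unique[where S = "{V. transpose V = V}" and K = "cball 0 1"])
    show "sigma_finite_measure (distr sym_lborel borel ?f)"
    proof
      show "\<exists>A. countable A \<and> A \<subseteq> sets (distr sym_lborel borel ?f) \<and> \<Union> A = space (distr sym_lborel borel ?f) \<and>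
             (\<forall>a\<in>A. emeasure (distr sym_lborel borel ?f) a \<noteq> \<infinity>)"
        by (rule exI[of _ "range (\<lambda>n::nat. cball 0 (real n))"])
           (use fin in \<open>auto simp: real_arch_simple emeasure_distr ball\<close>)
    qed
    show "AE V in distr sym_lborel borel ?f. V \<in> {V. transpose V = V}"
    proof (subst AE_distr_iff)
      show "{V \<in> space borel. V \<in> {V. transpose V = (V :: 'k sqmat)}} \<in> sets borel" by simp
      show "AE V in sym_lborel. ?f V \<in> {V. transpose V = V}"
        using AE_sym_lborel by eventually_elim (auto intro: trf)
    qed auto
    fix C :: "'k sqmat" assume C: "C \<in> {V. transpose V = V}"
    have "distr (distr sym_lborel borel ?f) borel (\<lambda>x. x + C) = distr sym_lborel borel (\<lambda>x. ?f x + C)"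
      by (simp add: distr_distr comp_def)
    also have "(\<lambda>x. ?f x + C) = (\<lambda>x. ?f (x + ?g C))"
      by (simp only: matrix_add_ldistrib matrix_add_rdistrib fg)
    also have "distr sym_lborel borel (\<lambda>x. ?f (x + ?g C)) = distr (distr sym_lborel borel (\<lambda>x. x + ?g C)) borel ?f"
      by (simp add: distr_distr comp_def)
    also have "distr sym_lborel borel (\<lambda>x. x + ?g C) = sym_lborel"
      using C by (intro sym_lborel_translation trg) simp
    finally show "distr (distr sym_lborel borel ?f) borel (\<lambda>x. x + C) = distr sym_lborel borel ?f" .
  next
    show "emeasure (distr sym_lborel borel ?f) (cball 0 1) = emeasure sym_lborel (cball 0 1 :: 'k sqmat set)"
      by (simp add: emeasure_distr ball)
    thus "emeasure (distr sym_lborel borel ?f) (cball 0 1) \<noteq> 0" "emeasure (distr sym_lborel borel ?f) (cball 0 1) \<noteq> \<infinity>"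
      using pos fin by simp_all
  qed (simp_all add: sigma_finite_sym_lborel sym_lborel_translation AE_sym_lborel transpose_add transpose_minus)
qed

section \<open>Spectral decomposition\<close>

lemma symmetric_matrix_dot:
  fixes V :: "'k::finite sqmat"
  assumes "transpose V = V"
  shows "x \<bullet> (V *v y) = (V *v x) \<bullet> y"
  using assms by (metis dot_lmul_matrix vector_transpose_matrix)

text \<open>Induction on the dimension of an invariant subspace: a maximiser of the quadratic form
  on the unit sphere of \<open>S\<close> is an eigenvector, and by symmetry of \<open>V\<close> its
  orthogonal complement in \<open>S\<close> is again invariant.\<close>

lemma symmetric_matrix_eigenbasis:
  fixes V :: "'k::finite sqmat"
  assumes sym: "transpose V = V"
  shows "subspace S \<Longrightarrow> (\<And>x. x \<in> S \<Longrightarrow> V *v x \<in> S) \<Longrightarrow>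
    \<exists>B. B \<subseteq> S \<and> pairwise orthogonal B \<and> (\<forall>b\<in>B. norm b = 1 \<and> (\<exists>c. V *v b = c *\<^sub>R b)) \<and> S \<subseteq> span B"
proof (induction "dim S" arbitrary: S rule: less_induct)
  case less
  show ?case
  proof (cases "S \<subseteq> {0}")
    case True
    thus ?thesis by (intro exI[of _ "{}"]) auto
  next
    case False
    then obtain s where s: "s \<in> S" "s \<noteq> 0" by auto
    let ?K = "S \<inter> sphere 0 1"
    let ?q = "\<lambda>x. x \<bullet> (V *v x)"
    have "s /\<^sub>R norm s \<in> ?K" using s less.prems(1) by (simp add: subspace_scale)
    hence ne: "?K \<noteq> {}" by blast
    have "compact ?K"
      using less.prems(1) by (intro closed_Int_compact closed_subspace compact_sphere)
    moreover have "continuous_on ?K ?q"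
      by (intro continuous_intros linear_continuous_on matrix_vector_mul_bounded_linear)
    ultimately obtain u where u: "u \<in> ?K" "\<And>y. y \<in> ?K \<Longrightarrow> ?q y \<le> ?q u"
      using continuous_attains_sup[OF _ ne] by blast
    define c where "c = ?q u"
    have uS: "u \<in> S" and nu: "norm u = 1" using u(1) by auto
    have uu: "u \<bullet> u = 1" using nu by (simp add: norm_eq_1)
    have le: "?q x \<le> c * (x \<bullet> x)" if x: "x \<in> S" for x
    proof (cases "x = 0")
      case False
      have "x /\<^sub>R norm x \<in> ?K" using x False less.prems(1) by (simp add: subspace_scale)
      hence "?q (x /\<^sub>R norm x) \<le> c" using u(2) c_def by blast
      moreover have "?q (x /\<^sub>R norm x) = ?q x / (x \<bullet> x)"
        by (simp add: matrix_vector_mult_scaleR divide_inverse power2_norm_eq_inner[symmetric] power2_eq_square)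
      ultimately show ?thesis using False by (simp add: divide_le_eq split: if_splits)
    qed simp
    \<comment> \<open>First-order condition at the maximum. Along u + t w the bound
      \<open>le\<close> reads 2 t a \<le> t^2 b for every t; taking t = a / B with B positive and at
      least b forces a = 0.\<close>
    have orth: "w \<bullet> (V *v u) = 0" if w: "w \<in> S" "w \<bullet> u = 0" for w
    proof (rule ccontr)
      assume a0: "w \<bullet> (V *v u) \<noteq> 0"
      define a where "a = w \<bullet> (V *v u)"
      define b where "b = c * (w \<bullet> w) - ?q w"
      have ineq: "2 * t * a \<le> t\<^sup>2 * b" for t
      proof -
        have "u + t *\<^sub>R w \<in> S" using w(1) uS less.prems(1) by (simp add: subspace_add subspace_scale)
        hence "?q (u + t *\<^sub>R w) \<le> c * ((u + t *\<^sub>R w) \<bullet> (u + t *\<^sub>R w))" by (rule le)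
        moreover have "?q (u + t *\<^sub>R w) = c + 2 * t * a + t\<^sup>2 * ?q w"
        proof -
          have "u \<bullet> (V *v w) = a"
            using symmetric_matrix_dot[OF sym, of u w] by (simp add: a_def inner_commute)
          thus ?thesis
            by (simp add: matrix_vector_right_distrib matrix_vector_mult_scaleR inner_add_left inner_add_right c_def a_def power2_eq_square algebra_simps)
        qed
        moreover have "(u + t *\<^sub>R w) \<bullet> (u + t *\<^sub>R w) = 1 + t\<^sup>2 * (w \<bullet> w)"
          using w(2) uu by (simp add: inner_add_left inner_add_right inner_commute power2_eq_square)
        ultimately have "c + 2 * t * a + t\<^sup>2 * ?q w \<le> c * (1 + t\<^sup>2 * (w \<bullet> w))" by (simp only:)
        thus ?thesis by (simp add: b_def algebra_simps)
      qed
      have a0': "a \<noteq> 0" using a0 a_def by simp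
      define B where "B = \<bar>b\<bar> + 1"
      have B: "B > 0" "b \<le> B" by (auto simp: B_def)
      have "2 * (a / B) * a \<le> (a / B)\<^sup>2 * b" by (rule ineq)
      also have "\<dots> \<le> (a / B)\<^sup>2 * B" using B by (intro mult_left_mono) auto
      also have "\<dots> = a\<^sup>2 / B" using B by (simp add: power2_eq_square)
      finally have "2 * a\<^sup>2 / B \<le> a\<^sup>2 / B" by (simp add: power2_eq_square)
      hence "a\<^sup>2 \<le> 0" using B by (simp add: divide_le_cancel)
      thus False using a0' by simp
    qed
    have eig: "V *v u = c *\<^sub>R u"
    proof -
      define w where "w = V *v u - c *\<^sub>R u"
      have wu: "w \<bullet> u = 0"
        using uu by (simp add: w_def inner_diff_left c_def inner_commute[of "V *v u" u])
      have wS: "w \<in> S" using uS less.prems by (simp add: w_def subspace_diff subspace_scale)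
      have "w \<bullet> w = w \<bullet> (V *v u) - c * (w \<bullet> u)"
        by (subst (2) w_def) (simp add: inner_diff_right)
      also have "\<dots> = 0" using orth[OF wS wu] wu by simp
      finally have "w = 0" by simp
      thus ?thesis by (simp add: w_def)
    qed
    define S' where "S' = {x \<in> S. x \<bullet> u = 0}"
    have sub': "subspace S'"
      using less.prems(1) by (auto simp: S'_def subspace_def inner_add_left)
    have inv': "V *v x \<in> S'" if "x \<in> S'" for x
    proof -
      have "(V *v x) \<bullet> u = x \<bullet> (V *v u)" using symmetric_matrix_dot[OF sym, of x u] by simp
      also have "\<dots> = 0" using that by (simp add: eig S'_def)
      finally show ?thesis using that less.prems(2) by (simp add: S'_def)
    qed
    have "u \<notin> S'" using uu by (simp add: S'_def)
    moreover have "S' \<subseteq> S" by (auto simp: S'_def)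
    ultimately have "S' \<subset> S" using uS by blast
    hence "dim S' < dim S"
      using sub' less.prems(1) by (metis dim_psubset span_eq_iff)
    from less.hyps[OF this sub' inv'] obtain B where B: "B \<subseteq> S'" "pairwise orthogonal B"
       "\<And>b. b \<in> B \<Longrightarrow> norm b = 1 \<and> (\<exists>c. V *v b = c *\<^sub>R b)" "S' \<subseteq> span B" by blast
    show ?thesis
    proof (intro exI[of _ "insert u B"] conjI ballI)
      show "insert u B \<subseteq> S" using uS B(1) by (auto simp: S'_def)
      show "pairwise orthogonal (insert u B)"
        using B(1,2) by (auto simp: pairwise_insert orthogonal_def S'_def inner_commute)
      show "norm b = 1" "\<exists>c. V *v b = c *\<^sub>R b" if "b \<in> insert u B" for b
        using that B(3) eig nu by auto
      show "S \<subseteq> span (insert u B)"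
      proof
        fix x assume x: "x \<in> S"
        have "x - (x \<bullet> u) *\<^sub>R u \<in> S'"
          using x uS uu less.prems(1) by (simp add: S'_def subspace_diff subspace_scale inner_diff_left)
        hence "x - (x \<bullet> u) *\<^sub>R u \<in> span B" using B(4) by blast
        thus "x \<in> span (insert u B)" by (auto simp: span_insert)
      qed
    qed
  qed
qed

theorem symmetric_matrix_diagonalization:
  fixes V :: "'k::finite sqmat"
  assumes sym: "transpose V = V"
  obtains H d where "orthogonal_matrix H" "V = transpose H ** diag_mat d ** H"
proof -
  obtain B where B: "pairwise orthogonal B" "\<And>b. b \<in> B \<Longrightarrow> norm b = 1" 
       "\<And>b. b \<in> B \<Longrightarrow> (\<exists>c. V *v b = c *\<^sub>R b)" "UNIV \<subseteq> span B"
    using symmetric_matrix_eigenbasis[OF sym, of UNIV] by auto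
  have ind: "independent B"
    using B(1) B(2)[of 0] by (intro pairwise_orthogonal_independent) auto
  hence fin: "finite B" by (rule independent_imp_finite)
  have "card B = dim (UNIV :: 'k rvec set)"
    using ind B(4) by (intro basis_card_eq_dim) auto
  hence "card B = CARD('k)" by simp
  then obtain f :: "'k \<Rightarrow> 'k rvec" where f: "bij_betw f UNIV B"
    using fin by (metis finite_same_card_bij finite_class.finite_UNIV)
  have fB: "f i \<in> B" for i using f by (auto simp: bij_betw_def)
  have "\<forall>i. \<exists>c. V *v f i = c *\<^sub>R f i" using B(3) fB by blast
  then obtain d where d: "\<And>i. V *v f i = d i *\<^sub>R f i" by metis
  \<comment> \<open>The eigenvectors are the rows of \<open>H\<close>, as the convention V = H^t D H
    requires.\<close>
  define H where "H = (\<chi> i. f i)"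
  have H: "orthogonal_matrix H"
    unfolding orthogonal_matrix_orthonormal_rows
  proof (intro conjI allI impI)
    show "norm (row i H) = 1" for i using B(2)[OF fB] by (simp add: row_def H_def)
    fix i j :: 'k assume "i \<noteq> j"
    hence "f i \<noteq> f j" using f by (auto simp: bij_betw_def inj_on_def)
    thus "orthogonal (row i H) (row j H)"
      using B(1) fB by (simp add: row_def H_def pairwise_def)
  qed
  have "V ** transpose H = transpose H ** diag_mat (\<chi> i. d i)"
  proof -
    have "(V ** transpose H) $ i $ j = (V *v f j) $ i" for i j
      by (simp add: matrix_matrix_mult_def matrix_vector_mult_def transpose_def H_def)
    moreover have "(transpose H ** diag_mat (\<chi> i. d i)) $ i $ j = d j * f j $ i" for i j
      by (simp add: matrix_matrix_mult_def transpose_def H_def diag_mat_def if_distrib[of "(*) _"] cong: if_cong)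
    ultimately show ?thesis by (simp add: vec_eq_iff d)
  qed
  hence "V ** transpose H ** H = transpose H ** diag_mat (\<chi> i. d i) ** H" by simp
  moreover have "V ** transpose H ** H = V"
    using H by (simp add: orthogonal_matrix_def flip: matrix_mul_assoc)
  ultimately show ?thesis using H that by metis
qed

section \<open>Calculus of the matrices H^t D H\<close>

definition conj_diag :: "'k::finite sqmat \<Rightarrow> 'k rvec \<Rightarrow> 'k sqmat" where
  "conj_diag H d = transpose H ** diag_mat d ** H"

lemma transpose_diag_mat [simp]: "transpose (diag_mat d) = diag_mat d"
  by (auto simp: transpose_def diag_mat_def vec_eq_iff)

lemma transpose_conj_diag [simp]: "transpose (conj_diag H d) = conj_diag H d"
  by (simp add: conj_diag_def matrix_transpose_mul matrix_mul_assoc)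

lemma diag_mat_mult_vec: "diag_mat d *v x = (\<chi> i. d $ i * x $ i)"
  by (simp add: matrix_vector_mult_def diag_mat_def vec_eq_iff if_distrib[of "\<lambda>a. a * _"] cong: if_cong)

lemma conj_diag_nth: "conj_diag H d $ i $ j = (\<Sum>l\<in>UNIV. d $ l * H $ l $ i * H $ l $ j)"
  by (simp add: conj_diag_def matrix_matrix_mult_def transpose_def diag_mat_def sum_distrib_right
        if_distrib[of "\<lambda>a. _ * a"] if_distrib[of "\<lambda>a. a * _"] mult_ac cong: if_cong)

lemma conj_diag_quadratic: "x \<bullet> (conj_diag H d *v x) = (\<Sum>i\<in>UNIV. d $ i * ((H *v x) $ i)\<^sup>2)"
proof -
  have "x \<bullet> (conj_diag H d *v x) = x \<bullet> (transpose H *v (diag_mat d *v (H *v x)))"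
    by (simp add: conj_diag_def matrix_vector_mul_assoc matrix_mul_assoc)
  also have "\<dots> = (H *v x) \<bullet> (diag_mat d *v (H *v x))"
    by (metis dot_lmul_matrix vector_transpose_matrix transpose_transpose)
  finally show ?thesis by (simp add: diag_mat_mult_vec inner_vec_def power2_eq_square mult_ac)
qed

lemma orthogonal_matrix_inner:
  assumes "orthogonal_matrix (H :: 'k::finite sqmat)"
  shows "(H *v x) \<bullet> (H *v y) = x \<bullet> y"
  using assms by (metis orthogonal_matrix_def dot_lmul_matrix vector_transpose_matrix matrix_vector_mul_assoc matrix_vector_mul_lid)

lemma orthogonal_matrix_sum_squares:
  assumes "orthogonal_matrix (H :: 'k::finite sqmat)"
  shows "(\<Sum>i\<in>UNIV. ((H *v x) $ i)\<^sup>2) = x \<bullet> x"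
  using orthogonal_matrix_inner[OF assms, of x x] by (simp add: inner_vec_def power2_eq_square)

lemma det_diag_mat: "det (diag_mat d) = (\<Prod>i\<in>UNIV. d $ i)"
  by (subst det_diagonal) (auto simp: diag_mat_def)

lemma mat1_plus_diag_mat: "mat 1 + diag_mat d = diag_mat (\<chi> i. 1 + d $ i)"
  by (auto simp: mat_def diag_mat_def vec_eq_iff)

lemma det_orthogonal_sq: "orthogonal_matrix (H :: 'k::finite sqmat) \<Longrightarrow> det (transpose H) * det H = 1"
  by (metis det_I det_mul orthogonal_matrix_def)

lemma det_conj_diag:
  assumes "orthogonal_matrix H"
  shows "det (conj_diag H d) = (\<Prod>i\<in>UNIV. d $ i)"
proof -
  have "det (conj_diag H d) = (det (transpose H) * det H) * det (diag_mat d)"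
    by (simp add: conj_diag_def det_mul)
  thus ?thesis using det_orthogonal_sq[OF assms] by (simp add: det_diag_mat)
qed

lemma mat1_plus_conj_diag:
  assumes "orthogonal_matrix H"
  shows "mat 1 + conj_diag H d = conj_diag H (\<chi> i. 1 + d $ i)"
  using assms by (simp add: conj_diag_def orthogonal_matrix_def matrix_add_ldistrib matrix_add_rdistrib
     mat1_plus_diag_mat[symmetric])

lemma trace_conj_diag:
  assumes H: "orthogonal_matrix H"
  shows "trace (conj_diag H d) = (\<Sum>i\<in>UNIV. d $ i)"
proof -
  have "trace (conj_diag H d) = trace (diag_mat d ** H ** transpose H)"
    unfolding conj_diag_def using trace_mul_sym[of "transpose H" "diag_mat d ** H"]
    by (simp add: matrix_mul_assoc)
  also have "\<dots> = trace (diag_mat d)"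
    using H by (simp add: orthogonal_matrix_def flip: matrix_mul_assoc)
  finally show ?thesis by (simp add: trace_def diag_mat_def)
qed

lemma conj_diag_mult:
  assumes H: "orthogonal_matrix H"
  shows "conj_diag H d ** conj_diag H e = conj_diag H (\<chi> i. d $ i * e $ i)"
proof -
  have "conj_diag H d ** conj_diag H e = transpose H ** diag_mat d ** (H ** transpose H) ** diag_mat e ** H"
    by (simp add: conj_diag_def matrix_mul_assoc)
  also have "\<dots> = transpose H ** (diag_mat d ** diag_mat e) ** H"
    using H by (simp add: orthogonal_matrix_def matrix_mul_assoc)
  also have "diag_mat d ** diag_mat e = diag_mat (\<chi> i. d $ i * e $ i)"
    by (simp add: matrix_matrix_mult_def diag_mat_def vec_eq_iff if_distrib[of "\<lambda>a. a * _"] if_distrib[of "\<lambda>a. _ * a"] cong: if_cong)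
  finally show ?thesis by (simp add: conj_diag_def)
qed

lemma pos_def_conj_diag:
  assumes H: "orthogonal_matrix H"
  shows "pos_def (conj_diag H d) \<longleftrightarrow> (\<forall>i. 0 < d $ i)"
proof
  assume pd: "pos_def (conj_diag H d)"
  show "\<forall>i. 0 < d $ i"
  proof
    fix i
    define x where "x = transpose H *v axis i 1"
    have Hx: "H *v x = axis i 1"
      unfolding x_def using H by (simp add: matrix_vector_mul_assoc orthogonal_matrix_def del: transpose_matrix_vector)
    hence "x \<noteq> 0" by auto
    hence "0 < x \<bullet> (conj_diag H d *v x)" using pd by (simp add: pos_def_def)
    also have "\<dots> = d $ i"
      by (simp add: conj_diag_quadratic Hx axis_def if_distrib[of "\<lambda>a. a\<^sup>2"] if_distrib[of "\<lambda>a. _ * a"] cong: if_cong)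
    finally show "0 < d $ i" .
  qed
next
  assume d: "\<forall>i. 0 < d $ i"
  show "pos_def (conj_diag H d)"
    unfolding pos_def_def
  proof (intro conjI allI impI)
    fix x :: "'a rvec" assume "x \<noteq> 0"
    have "H *v x \<noteq> 0"
    proof
      assume "H *v x = 0"
      hence "x \<bullet> x = 0" using orthogonal_matrix_inner[OF H, of x x] by simp
      thus False using \<open>x \<noteq> 0\<close> by simp
    qed
    then obtain i where i: "(H *v x) $ i \<noteq> 0" by (auto simp: vec_eq_iff)
    have "0 < (\<Sum>i\<in>UNIV. d $ i * ((H *v x) $ i)\<^sup>2)"
      by (rule sum_pos2[of _ i]) (use d i in \<open>auto simp: less_imp_le\<close>)
    thus "0 < x \<bullet> (conj_diag H d *v x)" by (simp add: conj_diag_quadratic)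
  qed simp
qed

text \<open>Two rankings are matched: \<open>r\<close> counts the smaller indices, \<open>s\<close>
  counts the larger values. Both are bijections onto the numbers below k, and \<sigma> sends an
  index to the one whose value has the same rank.\<close>

lemma exists_decreasing_reindexing:
  fixes d :: "'k::{finite,linorder} \<Rightarrow> real"
  assumes inj: "inj d"
  obtains \<sigma> :: "'k \<Rightarrow> 'k" where "bij \<sigma>" "\<And>i j. i < j \<Longrightarrow> d (\<sigma> j) < d (\<sigma> i)"
proof -
  define r where "r i = card {j. j < i}" for i :: 'k
  define s where "s i = card {j. d i < d j}" for i
  have r_mono: "r i < r j" if "i < j" for i j
    unfolding r_def by (rule psubset_card_mono) (use that in auto)
  have s_mono: "s i < s j" if "d j < d i" for i j
    unfolding s_def by (rule psubset_card_mono) (use that in auto)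
  have inj_r: "inj r" by (rule injI) (metis r_mono neq_iff)
  have inj_s: "inj s" by (rule injI) (metis s_mono neq_iff inj injD)
  have r_lt: "r i < CARD('k)" for i
    unfolding r_def by (rule psubset_card_mono) auto
  have s_lt: "s i < CARD('k)" for i
    unfolding s_def by (rule psubset_card_mono) auto
  have rr: "range r = {..<CARD('k)}"
    by (rule card_subset_eq) (use r_lt inj_r in \<open>auto simp: card_image\<close>)
  have rs: "range s = {..<CARD('k)}"
    by (rule card_subset_eq) (use s_lt inj_s in \<open>auto simp: card_image\<close>)
  define \<sigma> where "\<sigma> i = inv s (r i)" for i
  have s\<sigma>: "s (\<sigma> i) = r i" for i
    unfolding \<sigma>_def by (rule f_inv_into_f) (use rs r_lt in auto)
  have "inj \<sigma>" by (rule injI) (metis s\<sigma> inj_r injD)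
  hence "bij \<sigma>" by (simp add: bij_betw_def finite_UNIV_inj_surj)
  moreover have "d (\<sigma> j) < d (\<sigma> i)" if "i < j" for i j
  proof (rule ccontr)
    assume "\<not> d (\<sigma> j) < d (\<sigma> i)"
    moreover have "d (\<sigma> j) \<noteq> d (\<sigma> i)"
      using \<open>inj \<sigma>\<close> inj that by (auto dest: injD)
    ultimately have "d (\<sigma> i) < d (\<sigma> j)" by simp
    hence "s (\<sigma> j) < s (\<sigma> i)" by (rule s_mono)
    thus False using r_mono[OF that] by (simp add: s\<sigma>)
  qed
  ultimately show ?thesis using that by blast
qed

lemma conj_diag_reindex:
  assumes H: "orthogonal_matrix (H :: 'k::finite sqmat)" and \<sigma>: "bij (\<sigma> :: 'k \<Rightarrow> 'k)"
  shows "orthogonal_matrix (\<chi> i. H $ \<sigma> i)" "conj_diag (\<chi> i. H $ \<sigma> i) (\<chi> i. d $ \<sigma> i) = conj_diag H d"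
proof -
  show "orthogonal_matrix (\<chi> i. H $ \<sigma> i)"
    using H \<sigma> by (auto simp: orthogonal_matrix_orthonormal_rows row_def bij_betw_def inj_eq)
  show "conj_diag (\<chi> i. H $ \<sigma> i) (\<chi> i. d $ \<sigma> i) = conj_diag H d"
    using sum.reindex_bij_betw[OF \<sigma>, of "\<lambda>l. d $ l * H $ l $ i * H $ l $ j" for i j]
    by (simp add: vec_eq_iff conj_diag_nth)
qed

text \<open>A strictly decreasing order is available only for distinct eigenvalues. The assumption
  has the form in which \<open>AE_simple_spectrum\<close> later supplies it almost
  everywhere.\<close>

lemma symmetric_ordered_diagonalization:
  fixes V :: "'k::{finite,linorder} sqmat"
  assumes V: "transpose V = V"
    and simple: "\<And>H d. orthogonal_matrix H \<Longrightarrow> V = conj_diag H d \<Longrightarrow> inj (($) d)"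
  obtains H d where "orthogonal_matrix H" "V = conj_diag H d" "\<And>i j. i < j \<Longrightarrow> d $ j < d $ i"
proof -
  obtain H d where H: "orthogonal_matrix H" "V = conj_diag H d"
    using symmetric_matrix_diagonalization[OF V] by (metis conj_diag_def)
  obtain \<sigma> :: "'k \<Rightarrow> 'k" where \<sigma>: "bij \<sigma>" "\<And>i j. i < j \<Longrightarrow> d $ \<sigma> j < d $ \<sigma> i"
    using exists_decreasing_reindexing[OF simple[OF H]] by metis
  show ?thesis
    using that[OF conj_diag_reindex(1)[OF H(1) \<sigma>(1)], of "\<chi> i. d $ \<sigma> i"]
       conj_diag_reindex(2)[OF H(1) \<sigma>(1)] H(2) \<sigma>(2) by auto
qed

section \<open>Covering the orthogonal group\<close>

lemma orthogonal_matrix_entry_le: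
  assumes "orthogonal_matrix (H :: 'k::finite sqmat)"
  shows "\<bar>H $ i $ j\<bar> \<le> 1"
proof -
  have "norm (row i H) = 1" using assms by (simp add: orthogonal_matrix_orthonormal_rows)
  moreover have "row i H = H $ i" by (simp add: row_def)
  ultimately show ?thesis using component_le_norm_cart[of "H $ i" j] by simp
qed

text \<open>Put P = I + E in P^t P = I: then E + E^t = - E^t E, so the deviation from skewness is of
  second order.\<close>

lemma orthogonal_near_identity_skew:
  fixes P :: "'k::finite sqmat"
  assumes P: "orthogonal_matrix P" and e: "\<And>i j. \<bar>(P - mat 1) $ i $ j\<bar> \<le> e"
  shows "\<bar>(P - mat 1) $ i $ j + (P - mat 1) $ j $ i\<bar> \<le> real CARD('k) * e\<^sup>2"
proof -
  define E where "E = P - mat 1"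
  have P_eq: "P = mat 1 + E" by (simp add: E_def)
  have "(transpose P ** P) $ i $ j = (mat 1 + E + transpose E + transpose E ** E) $ i $ j"
    unfolding P_eq by (simp add: transpose_add matrix_add_ldistrib matrix_add_rdistrib transpose_mat)
  moreover have "transpose P ** P = mat 1" using P by (simp add: orthogonal_matrix_def)
  ultimately have "(mat 1 :: 'k sqmat) $ i $ j = (mat 1 + E + transpose E + transpose E ** E) $ i $ j" by (simp only:)
  hence "E $ i $ j + E $ j $ i = - (\<Sum>l\<in>UNIV. E $ l $ i * E $ l $ j)"
    by (simp add: transpose_def matrix_matrix_mult_def)
  hence "\<bar>E $ i $ j + E $ j $ i\<bar> \<le> (\<Sum>l\<in>UNIV. \<bar>E $ l $ i * E $ l $ j\<bar>)"
    by (simp add: sum_abs)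
  also have "\<dots> \<le> (\<Sum>l\<in>(UNIV :: 'k set). e\<^sup>2)"
    using e by (intro sum_mono) (auto simp: E_def abs_mult power2_eq_square intro!: mult_mono order_trans[OF abs_ge_zero e])
  finally show ?thesis by (simp add: E_def)
qed

text \<open>The entries below the diagonal are controlled because \<open>Q ** transpose P - mat 1\<close> is skew up to
  second order.\<close>

lemma orthogonal_determined_by_upper:
  fixes P Q :: "'k::{finite,linorder} sqmat"
  assumes P: "orthogonal_matrix P" and Q: "orthogonal_matrix Q"
    and P1: "\<And>i j. \<bar>(P - mat 1) $ i $ j\<bar> \<le> \<delta>" and Q1: "\<And>i j. \<bar>(Q - mat 1) $ i $ j\<bar> \<le> \<delta>"
    and \<delta>: "6 * (real CARD('k))\<^sup>2 * \<delta> \<le> 1"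
    and \<eta>: "\<And>i j. i < j \<Longrightarrow> \<bar>Q $ i $ j - P $ i $ j\<bar> \<le> \<eta>" "0 \<le> \<eta>"
  shows "\<bar>(Q ** transpose P - mat 1) $ i $ j\<bar> \<le> 2 * \<eta>"
proof -
  define k where "k = real CARD('k)"
  have k1: "k \<ge> 1" by (simp add: k_def Suc_leI)
  have \<delta>0: "\<delta> \<ge> 0" using order_trans[OF abs_ge_zero P1] .
  define E where "E = Q ** transpose P - mat 1"
  define e where "e = Max (range (\<lambda>(i, j). \<bar>E $ i $ j\<bar>))"
  have eM: "\<bar>E $ i $ j\<bar> \<le> e" for i j
    unfolding e_def by (rule Max_ge) auto
  have "e \<in> range (\<lambda>(i, j). \<bar>E $ i $ j\<bar>)" unfolding e_def by (rule Max_in) auto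
  then obtain i0 j0 where e_eq: "e = \<bar>E $ i0 $ j0\<bar>" by auto
  have e0: "e \<ge> 0" by (simp add: e_eq)
  have PP: "transpose P ** P = mat 1" "P ** transpose P = mat 1" using P by (simp_all add: orthogonal_matrix_def)
  have oQP: "orthogonal_matrix (Q ** transpose P)"
    using P Q by (simp add: orthogonal_matrix_mul)
  have EP: "E ** P = Q - P"
  proof -
    have "Q ** transpose P ** P = Q" by (simp add: PP flip: matrix_mul_assoc)
    moreover have "(Q ** transpose P - mat 1) ** P = Q ** transpose P ** P - P"
      by (simp add: vec_eq_iff matrix_matrix_mult_def mat_def sum_subtractf left_diff_distrib
            if_distrib[of "\<lambda>a. a * _"] cong: if_cong)
    ultimately show ?thesis by (simp add: E_def)
  qed
  have EPT: "E = (Q - P) ** transpose P"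
    using arg_cong[OF EP, of "\<lambda>M. M ** transpose P"] by (simp add: PP flip: matrix_mul_assoc)
  \<comment> \<open>A crude a priori bound of order \<delta>. It serves to turn the quadratic
    skewness defect k e^2 into a small multiple of e, which can then be absorbed.\<close>
  have ek: "e \<le> 2 * k * \<delta>"
  proof -
    have QP: "\<bar>(Q - P) $ i $ l\<bar> \<le> 2 * \<delta>" for i l
      using P1[of i l] Q1[of i l] by simp
    have "\<bar>E $ i0 $ j0\<bar> \<le> (\<Sum>l\<in>UNIV. \<bar>(Q - P) $ i0 $ l * P $ j0 $ l\<bar>)"
      by (subst EPT) (simp add: matrix_matrix_mult_def transpose_def sum_abs)
    also have "\<dots> \<le> (\<Sum>l\<in>(UNIV :: 'k set). 2 * \<delta> * 1)"
      unfolding abs_mult using QP orthogonal_matrix_entry_le[OF P] \<delta>0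
      by (intro sum_mono mult_mono) auto
    finally show ?thesis by (simp add: e_eq k_def)
  qed
  have up: "\<bar>E $ i $ j\<bar> \<le> \<eta> + k * \<delta> * e" if "i < j" for i j
  proof -
    have "(E ** P) $ i $ j = E $ i $ j + (\<Sum>l\<in>UNIV. E $ i $ l * (P - mat 1) $ l $ j)"
      by (simp add: matrix_matrix_mult_def mat_def right_diff_distrib sum_subtractf
            if_distrib[of "\<lambda>a. _ * a"] cong: if_cong)
    hence "E $ i $ j = (Q $ i $ j - P $ i $ j) - (\<Sum>l\<in>UNIV. E $ i $ l * (P - mat 1) $ l $ j)"
      by (simp add: EP)
    also have "\<bar>\<dots>\<bar> \<le> \<bar>Q $ i $ j - P $ i $ j\<bar> + \<bar>\<Sum>l\<in>UNIV. E $ i $ l * (P - mat 1) $ l $ j\<bar>"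
      by (rule abs_triangle_ineq4)
    also have "\<bar>\<Sum>l\<in>UNIV. E $ i $ l * (P - mat 1) $ l $ j\<bar> \<le> (\<Sum>l\<in>UNIV. \<bar>E $ i $ l * (P - mat 1) $ l $ j\<bar>)"
      by (rule sum_abs)
    also have "\<dots> \<le> (\<Sum>l\<in>(UNIV :: 'k set). e * \<delta>)"
      unfolding abs_mult using eM P1 e0 by (intro sum_mono mult_mono) auto
    finally show ?thesis using \<eta>(1)[OF that] by (simp add: k_def mult_ac)
  qed
  have sk: "\<bar>E $ i $ j + E $ j $ i\<bar> \<le> k * e\<^sup>2" for i j
    using orthogonal_near_identity_skew[OF oQP, of e i j] eM by (simp add: E_def k_def)
  have ke2: "k * e\<^sup>2 \<le> 2 * k\<^sup>2 * \<delta> * e"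
  proof -
    have "k * e\<^sup>2 = (k * e) * e" by (simp add: power2_eq_square)
    also have "\<dots> \<le> (k * (2 * k * \<delta>)) * e" using ek e0 k1 by (intro mult_right_mono mult_left_mono) auto
    finally show ?thesis by (simp add: power2_eq_square mult_ac)
  qed
  \<comment> \<open>The constant 6 is chosen here: k \<delta> + 2 k^2 \<delta> \<le> 3 k^2 \<delta>
    \<le> 1 / 2. The bound e \<le> \<eta> + e / 2 that follows can be solved for e, whence the
    factor 2 in the conclusion.\<close>
  have small: "k * \<delta> * e + 2 * k\<^sup>2 * \<delta> * e \<le> e / 2"
  proof -
    have "k * \<delta> \<le> k\<^sup>2 * \<delta>" using k1 \<delta>0 by (intro mult_right_mono) (auto simp: power2_eq_square)
    hence "k * \<delta> + 2 * k\<^sup>2 * \<delta> \<le> 1 / 2" using \<delta> unfolding k_def by linarith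
    from mult_right_mono[OF this e0] show ?thesis by (simp add: algebra_simps)
  qed
  have nn: "0 \<le> k * \<delta> * e" "0 \<le> k\<^sup>2 * \<delta> * e" using k1 \<delta>0 e0 by auto
  have all: "\<bar>E $ i $ j\<bar> \<le> \<eta> + e / 2" for i j
  proof (cases i j rule: linorder_cases)
    case less thus ?thesis using up[OF less] small nn by linarith
  next
    case equal
    have "\<bar>E $ i $ i\<bar> \<le> \<eta> + e / 2" using sk[of i i] ke2 small nn \<eta>(2) by linarith
    thus ?thesis using equal by simp
  next
    case greater
    thus ?thesis using up[OF greater] sk[of i j] ke2 small nn by linarith
  qed
  have "e \<le> 2 * \<eta>" using all[of i0 j0] e_eq by linarith
  thus ?thesis using eM[of i j] by (simp add: E_def)
qed

lemma floor_divide_eq_imp_close: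
  fixes a b h :: real
  assumes h: "0 < h" and eq: "\<lfloor>b / h\<rfloor> = \<lfloor>a / h\<rfloor>"
  shows "\<bar>a - b\<bar> \<le> h"
proof -
  have "\<bar>a - b\<bar> = \<bar>a / h - b / h\<bar> * h" using h by (simp add: diff_divide_distrib[symmetric] abs_divide)
  also have "\<bar>a / h - b / h\<bar> \<le> 1" using eq by linarith
  hence "\<bar>a / h - b / h\<bar> * h \<le> 1 * h" using h by (intro mult_right_mono) auto
  finally show ?thesis by simp
qed

lemma compact_orthogonal_matrices: "compact {H :: 'k::finite sqmat. orthogonal_matrix H}"
proof (rule compact_eq_bounded_closed[THEN iffD2], intro conjI)
  show "bounded {H :: 'k sqmat. orthogonal_matrix H}"
  proof (rule boundedI)
    fix H :: "'k sqmat" assume "H \<in> {H. orthogonal_matrix H}"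
    hence "norm (H $ i) = 1" for i
      by (simp add: orthogonal_matrix_orthonormal_rows row_def)
    hence "norm H = L2_set (\<lambda>i::'k. 1) UNIV" by (simp add: norm_vec_def)
    thus "norm H \<le> sqrt (real CARD('k))" by (simp add: L2_set_def)
  qed
  have "{H :: 'k sqmat. orthogonal_matrix H} = (\<lambda>H. transpose H ** H) -` {mat 1}"
    by (auto simp: orthogonal_matrix)
  moreover have "closed ((\<lambda>H :: 'k sqmat. transpose H ** H) -` {mat 1})"
    by (intro closed_vimage closed_singleton continuous_on_matrix_mult continuous_intros)
      (auto simp: transpose_def intro!: continuous_intros)
  ultimately show "closed {H :: 'k sqmat. orthogonal_matrix H}" by simp
qed

text \<open>Near a fixed orthogonal matrix, the entries above the diagonal control the others, so it
  is enough to place these on a grid. The exponent k (k - 1) / 2 is the dimension of the orthogonal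
  group and must be exact: it cancels a power of the side length in
  \<open>spectral_set_cube\<close>.\<close>

lemma orthogonal_matrix_covering:
  obtains C :: real where "C > 0"
    "\<And>\<epsilon>. 0 < \<epsilon> \<Longrightarrow> \<epsilon> \<le> 1 \<Longrightarrow> \<exists>R :: 'k::{finite,linorder} sqmat set. finite R \<and> (\<forall>U\<in>R. orthogonal_matrix U) \<and>
       real (card R) \<le> C * (1 / \<epsilon>) ^ card {(i :: 'k, j). i < j} \<and>
       (\<forall>H. orthogonal_matrix H \<longrightarrow> (\<exists>U\<in>R. \<forall>i j. \<bar>(H ** transpose U - mat 1) $ i $ j\<bar> \<le> \<epsilon>))"
proof -
  let ?O = "{H :: 'k sqmat. orthogonal_matrix H}"
  let ?P = "{(i :: 'k, j). i < j}"
  let ?n = "card ?P"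
  define k where "k = real CARD('k)"
  have k1: "k \<ge> 1" by (simp add: k_def Suc_leI)
  define \<delta> where "\<delta> = 1 / (6 * k\<^sup>2)"
  have \<delta>: "\<delta> > 0" "6 * k\<^sup>2 * \<delta> \<le> 1" using k1 by (auto simp: \<delta>_def)
  \<comment> \<open>The radius is divided by k because multiplication by \<open>transpose G\<close>
    sums k terms, with entries of \<open>G\<close> bounded by 1.\<close>
  have "\<delta> / k > 0" using \<delta> k1 by simp
  then obtain F where F: "finite F" "F \<subseteq> ?O" "?O \<subseteq> (\<Union>x\<in>F. ball x (\<delta> / k))"
    using seq_compact_imp_totally_bounded[of ?O] compact_orthogonal_matrices compact_eq_seq_compact_metric
    by metis
  have near: "\<exists>G\<in>F. \<forall>i j. \<bar>(H ** transpose G - mat 1) $ i $ j\<bar> \<le> \<delta>" if H: "orthogonal_matrix H" for H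
  proof -
    from H F(3) obtain G where G: "G \<in> F" "dist G H < \<delta> / k" by (auto simp: subset_iff)
    have oG: "orthogonal_matrix G" using G F by auto
    have "H ** transpose G - mat 1 = (H - G) ** transpose G"
    proof -
      have "G ** transpose G = mat 1" using oG by (simp add: orthogonal_matrix_def)
      thus ?thesis by (simp add: vec_eq_iff matrix_matrix_mult_def left_diff_distrib sum_subtractf)
    qed
    moreover have "\<bar>((H - G) ** transpose G) $ i $ j\<bar> \<le> \<delta>" for i j
    proof -
      have "\<bar>(H - G) $ i $ l\<bar> \<le> \<delta> / k" for l
        using Finite_Cartesian_Product.norm_nth_le[of "H - G" i] component_le_norm_cart[of "(H - G) $ i" l] G(2)
        by (simp add: dist_norm norm_minus_commute)
      hence "(\<Sum>l\<in>UNIV. \<bar>(H - G) $ i $ l * G $ j $ l\<bar>) \<le> (\<Sum>l\<in>(UNIV :: 'k set). \<delta> / k * 1)"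
        unfolding abs_mult using orthogonal_matrix_entry_le[OF oG] \<delta> k1 by (intro sum_mono mult_mono) auto
      also have "\<dots> = \<delta>" using k1 by (simp add: k_def)
      finally have "(\<Sum>l\<in>UNIV. \<bar>(H - G) $ i $ l * G $ j $ l\<bar>) \<le> \<delta>" .
      moreover have "\<bar>((H - G) ** transpose G) $ i $ j\<bar> \<le> (\<Sum>l\<in>UNIV. \<bar>(H - G) $ i $ l * G $ j $ l\<bar>)"
        unfolding matrix_matrix_mult_def transpose_def by (simp add: sum_abs)
      ultimately show ?thesis by simp
    qed
    ultimately show ?thesis using G(1) by metis
  qed
  then obtain ctr where ctr: "\<And>H. orthogonal_matrix H \<Longrightarrow> ctr H \<in> F"
     "\<And>H i j. orthogonal_matrix H \<Longrightarrow> \<bar>(H ** transpose (ctr H) - mat 1) $ i $ j\<bar> \<le> \<delta>" by metis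
  show ?thesis
  proof (rule that)
    \<comment> \<open>Each entry has 2 M + 1 \<le> 4 / \<epsilon> + 3 \<le> 7 / \<epsilon> grid
      positions. The added 1 makes the constant positive without a discussion of
      \<open>F\<close>.\<close>
    show "real (card F) * 7 ^ ?n + 1 > 0" by (simp add: add_nonneg_pos)
    fix \<epsilon> :: real assume \<epsilon>: "0 < \<epsilon>" "\<epsilon> \<le> 1"
    \<comment> \<open>A cell is a centre from \<open>F\<close> together with the grid positions of
      the entries above the diagonal relative to it. The mesh is \<epsilon> / 2 because
      \<open>orthogonal_determined_by_upper\<close> loses a factor 2.\<close>
    define key where "key H = (ctr H, \<lambda>p\<in>?P. \<lfloor>(H ** transpose (ctr H)) $ fst p $ snd p / (\<epsilon> / 2)\<rfloor>)" for H
    define M where "M = \<lceil>2 / \<epsilon>\<rceil>"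
    have keyin: "key H \<in> F \<times> (?P \<rightarrow>\<^sub>E {-M..M})" if H: "orthogonal_matrix H" for H
    proof -
      have "orthogonal_matrix (H ** transpose (ctr H))"
        using H ctr(1)[OF H] F(2) by (intro orthogonal_matrix_mul) auto
      hence b: "\<bar>(H ** transpose (ctr H)) $ i $ j\<bar> \<le> 1" for i j by (rule orthogonal_matrix_entry_le)
      have "\<lfloor>(H ** transpose (ctr H)) $ i $ j / (\<epsilon> / 2)\<rfloor> \<in> {-M..M}" for i j
      proof -
        let ?z = "(H ** transpose (ctr H)) $ i $ j"
        have "?z / (\<epsilon> / 2) \<le> 2 / \<epsilon>" "- (2 / \<epsilon>) \<le> ?z / (\<epsilon> / 2)"
          using b[of i j] \<epsilon> by (auto simp: field_simps abs_le_iff)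
        moreover have "2 / \<epsilon> \<le> real_of_int M" by (simp add: M_def)
        ultimately have "?z / (\<epsilon> / 2) \<le> real_of_int M" "real_of_int (- M) \<le> ?z / (\<epsilon> / 2)" by linarith+
        thus ?thesis by (simp add: le_floor_iff floor_le_iff)
      qed
      thus ?thesis using ctr(1)[OF H] by (auto simp: key_def)
    qed
    \<comment> \<open>Every occupied cell is represented by an orthogonal matrix inside it; the grid
      points themselves belong to no orthogonal matrix in general.\<close>
    define rep where "rep \<kappa> = (SOME H. orthogonal_matrix H \<and> key H = \<kappa>)" for \<kappa>
    have rep: "orthogonal_matrix (rep (key H)) \<and> key (rep (key H)) = key H" if "orthogonal_matrix H" for H
      unfolding rep_def by (rule someI[of _ H]) (use that in auto)
    define R where "R = rep ` key ` ?O"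
    have finK: "finite (F \<times> (?P \<rightarrow>\<^sub>E {-M..M}))" using F(1) by (intro finite_cartesian_product finite_PiE) auto
    have sub: "key ` ?O \<subseteq> F \<times> (?P \<rightarrow>\<^sub>E {-M..M})"
      by (rule image_subsetI, rule keyin) simp
    show "\<exists>R :: 'k sqmat set. finite R \<and> (\<forall>U\<in>R. orthogonal_matrix U) \<and>
       real (card R) \<le> (real (card F) * 7 ^ ?n + 1) * (1 / \<epsilon>) ^ ?n \<and>
       (\<forall>H. orthogonal_matrix H \<longrightarrow> (\<exists>U\<in>R. \<forall>i j. \<bar>(H ** transpose U - mat 1) $ i $ j\<bar> \<le> \<epsilon>))"
    proof (intro exI[of _ R] conjI ballI allI impI)
      show "finite R" unfolding R_def using finite_subset[OF sub finK] by simp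
      show "orthogonal_matrix U" if "U \<in> R" for U using that rep by (auto simp: R_def)
      have "card R \<le> card (key ` ?O)"
        unfolding R_def by (rule card_image_le) (use finite_subset[OF sub finK] in simp)
      also have "\<dots> \<le> card (F \<times> (?P \<rightarrow>\<^sub>E {-M..M}))" by (rule card_mono[OF finK sub])
      also have "\<dots> = card F * nat (2 * M + 1) ^ ?n" 
        by (simp add: card_cartesian_product card_PiE add.commute)
      finally have "real (card R) \<le> real (card F) * real (nat (2 * M + 1)) ^ ?n"
        by (metis of_nat_le_iff of_nat_mult of_nat_power)
      also have "real (nat (2 * M + 1)) \<le> 7 / \<epsilon>"
      proof -
        have "real_of_int M \<le> 2 / \<epsilon> + 1" unfolding M_def by linarith
        moreover have "2 / \<epsilon> > 0" using \<epsilon> by simp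
        hence "M \<ge> 0" unfolding M_def by linarith
        moreover have "3 \<le> 3 / \<epsilon>" using \<epsilon> by (simp add: field_simps)
        moreover have "7 / \<epsilon> = 2 * (2 / \<epsilon>) + 3 / \<epsilon>" using \<epsilon> by (simp add: field_simps)
        ultimately show ?thesis by linarith
      qed
      hence "real (card F) * real (nat (2 * M + 1)) ^ ?n \<le> real (card F) * (7 / \<epsilon>) ^ ?n"
        by (intro mult_left_mono power_mono) auto
      also have "\<dots> \<le> (real (card F) * 7 ^ ?n + 1) * (1 / \<epsilon>) ^ ?n"
        using \<epsilon> by (simp add: power_divide field_simps)
      finally show "real (card R) \<le> (real (card F) * 7 ^ ?n + 1) * (1 / \<epsilon>) ^ ?n" .
      fix H :: "'k sqmat" assume H: "orthogonal_matrix H"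
      define U where "U = rep (key H)"
      define G where "G = ctr H"
      have U: "orthogonal_matrix U" "key U = key H" using rep[OF H] by (auto simp: U_def)
      have G: "ctr U = G" using U(2) by (simp add: key_def G_def)
      have oG: "orthogonal_matrix G" using ctr(1)[OF H] F(2) by (auto simp: G_def)
      have "\<bar>(H ** transpose G ** transpose (U ** transpose G) - mat 1) $ i $ j\<bar> \<le> 2 * (\<epsilon> / 2)" for i j
      proof (rule orthogonal_determined_by_upper)
        show "orthogonal_matrix (U ** transpose G)" "orthogonal_matrix (H ** transpose G)"
          using U H oG by (auto intro: orthogonal_matrix_mul)
        show "\<bar>(U ** transpose G - mat 1) $ i $ j\<bar> \<le> \<delta>" for i j using ctr(2)[OF U(1)] G by simp
        show "\<bar>(H ** transpose G - mat 1) $ i $ j\<bar> \<le> \<delta>" for i j using ctr(2)[OF H] by (simp add: G_def)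
        show "6 * (real CARD('k))\<^sup>2 * \<delta> \<le> 1" using \<delta>(2) by (simp add: k_def)
        show "0 \<le> \<epsilon> / 2" using \<epsilon> by simp
        fix i j :: 'k assume ij: "i < j"
        let ?a = "(H ** transpose G) $ i $ j" and ?b = "(U ** transpose G) $ i $ j"
        have "snd (key U) (i, j) = snd (key H) (i, j)" using U(2) by simp
        hence fl: "\<lfloor>?b / (\<epsilon> / 2)\<rfloor> = \<lfloor>?a / (\<epsilon> / 2)\<rfloor>" using ij G by (simp add: key_def G_def)
        thus "\<bar>?a - ?b\<bar> \<le> \<epsilon> / 2" using \<epsilon> by (intro floor_divide_eq_imp_close) auto
      qed
      moreover have "H ** transpose G ** transpose (U ** transpose G) = H ** transpose U"
      proof -
        have "H ** transpose G ** transpose (U ** transpose G) = H ** (transpose G ** G) ** transpose U"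
          by (simp add: matrix_transpose_mul matrix_mul_assoc)
        also have "transpose G ** G = mat 1" using oG by (simp add: orthogonal_matrix_def)
        finally show ?thesis by simp
      qed
      ultimately show "\<exists>U\<in>R. \<forall>i j. \<bar>(H ** transpose U - mat 1) $ i $ j\<bar> \<le> \<epsilon>"
        using H by (intro bexI[of _ U]) (auto simp: R_def U_def)
    qed
  qed
qed

section \<open>The Weyl integration formula as an upper bound\<close>

text \<open>With P = I + E, the first-order part of an off-diagonal entry of P^t D P is d_i E_ij +
  d_j E_ji, which by skewness is (d_i - d_j) E_ij up to second order. This is where the factors of
  the Vandermonde product come from. On the diagonal the first-order part vanishes.\<close>

lemma conj_diag_near_identity:
  fixes P :: "'k::finite sqmat"
  assumes P: "orthogonal_matrix P" and e: "\<And>i j. \<bar>(P - mat 1) $ i $ j\<bar> \<le> \<epsilon>"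
    and d: "\<And>i. \<bar>d $ i\<bar> \<le> \<rho>"
  shows "\<bar>conj_diag P d $ i $ i - d $ i\<bar> \<le> 2 * real CARD('k) * \<rho> * \<epsilon>\<^sup>2"
    and "i \<noteq> j \<Longrightarrow> \<bar>conj_diag P d $ i $ j\<bar> \<le> \<bar>d $ i - d $ j\<bar> * \<epsilon> + 2 * real CARD('k) * \<rho> * \<epsilon>\<^sup>2"
proof -
  define k where "k = real CARD('k)"
  define E where "E = P - mat 1"
  have eE: "\<bar>E $ i $ j\<bar> \<le> \<epsilon>" for i j using e by (simp add: E_def)
  have \<epsilon>0: "\<epsilon> \<ge> 0" using order_trans[OF abs_ge_zero eE] .
  have \<rho>0: "\<rho> \<ge> 0" using order_trans[OF abs_ge_zero d] .
  have sk: "\<bar>E $ i $ j + E $ j $ i\<bar> \<le> k * \<epsilon>\<^sup>2" for i j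
    using orthogonal_near_identity_skew[OF P e] by (simp add: E_def k_def)
  have Pn: "P $ i $ j = (if i = j then 1 else 0) + E $ i $ j" for i j by (simp add: E_def mat_def)
  define S where "S i j = (\<Sum>l\<in>UNIV. d $ l * E $ l $ i * E $ l $ j)" for i j
  have S: "\<bar>S i j\<bar> \<le> k * \<rho> * \<epsilon>\<^sup>2" for i j
  proof -
    have "\<bar>S i j\<bar> \<le> (\<Sum>l\<in>UNIV. \<bar>d $ l * E $ l $ i * E $ l $ j\<bar>)" unfolding S_def by (rule sum_abs)
    also have "\<dots> \<le> (\<Sum>l\<in>(UNIV :: 'k set). \<rho> * \<epsilon> * \<epsilon>)"
      unfolding abs_mult using d eE \<epsilon>0 \<rho>0 by (intro sum_mono mult_mono) auto
    finally show ?thesis by (simp add: k_def power2_eq_square mult_ac)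
  qed
  have expand: "conj_diag P d $ i $ j = (if i = j then d $ i else 0) + d $ i * E $ i $ j + d $ j * E $ j $ i + S i j" for i j
  proof -
    have "d $ l * P $ l $ i * P $ l $ j = (if l = i then (if i = j then d $ i else 0) + d $ i * E $ i $ j else 0)
       + (if l = j then d $ j * E $ j $ i else 0) + d $ l * E $ l $ i * E $ l $ j" for l
      unfolding Pn by (simp add: algebra_simps)
    thus ?thesis unfolding conj_diag_nth S_def by (simp add: sum.distrib)
  qed
  show "\<bar>conj_diag P d $ i $ i - d $ i\<bar> \<le> 2 * real CARD('k) * \<rho> * \<epsilon>\<^sup>2"
  proof -
    have "conj_diag P d $ i $ i - d $ i = d $ i * (E $ i $ i + E $ i $ i) + S i i"
      by (simp add: expand algebra_simps)
    also have "\<bar>\<dots>\<bar> \<le> \<bar>d $ i\<bar> * \<bar>E $ i $ i + E $ i $ i\<bar> + \<bar>S i i\<bar>" by (metis abs_mult abs_triangle_ineq)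
    also have "\<dots> \<le> \<rho> * (k * \<epsilon>\<^sup>2) + k * \<rho> * \<epsilon>\<^sup>2"
      using d[of i] sk[of i i] S[of i i] \<rho>0 by (intro add_mono mult_mono) auto
    finally show ?thesis by (simp add: k_def mult_ac)
  qed
  assume ij: "i \<noteq> j"
  have "conj_diag P d $ i $ j = (d $ i - d $ j) * E $ i $ j + d $ j * (E $ i $ j + E $ j $ i) + S i j"
    using ij by (simp add: expand algebra_simps)
  also have "\<bar>\<dots>\<bar> \<le> \<bar>d $ i - d $ j\<bar> * \<bar>E $ i $ j\<bar> + \<bar>d $ j\<bar> * \<bar>E $ i $ j + E $ j $ i\<bar> + \<bar>S i j\<bar>"
    unfolding abs_mult[symmetric] by linarith
  also have "\<dots> \<le> \<bar>d $ i - d $ j\<bar> * \<epsilon> + \<rho> * (k * \<epsilon>\<^sup>2) + k * \<rho> * \<epsilon>\<^sup>2"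
    using d sk S \<rho>0 eE by (intro add_mono mult_mono) auto
  finally show "\<bar>conj_diag P d $ i $ j\<bar> \<le> \<bar>d $ i - d $ j\<bar> * \<epsilon> + 2 * real CARD('k) * \<rho> * \<epsilon>\<^sup>2"
    by (simp add: k_def mult_ac)
qed

lemma conj_diag_conj: "U ** conj_diag H d ** transpose U = conj_diag (H ** transpose U) d"
  by (simp add: conj_diag_def matrix_transpose_mul matrix_mul_assoc)

text \<open>Measurability of this set is not established even for Borel \<open>E\<close>, so all
  volume estimates are stated for some Borel superset.\<close>

definition spectral_set :: "'k::finite rvec set \<Rightarrow> 'k sqmat set" where
  "spectral_set E = {conj_diag H d | H d. orthogonal_matrix H \<and> d \<in> E}"

lemma prod_upper_pairs:
  fixes f :: "'k::{finite,linorder} \<times> 'k \<Rightarrow> 'a::comm_monoid_mult"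
  shows "(\<Prod>p\<in>{(i, j). i \<le> j}. f p) = (\<Prod>i\<in>UNIV. f (i, i)) * (\<Prod>p\<in>{(i, j). i < j}. f p)"
proof -
  have "{(i :: 'k, j). i \<le> j} = (\<lambda>i. (i, i)) ` UNIV \<union> {(i, j). i < j}" by auto
  also have "prod f \<dots> = prod f ((\<lambda>i. (i, i)) ` UNIV) * prod f {(i, j). i < j}"
    by (rule prod.union_disjoint) auto
  also have "prod f ((\<lambda>i. (i, i)) ` UNIV) = (\<Prod>i\<in>UNIV. f (i, i))"
    by (subst prod.reindex) (auto simp: inj_on_def)
  finally show ?thesis .
qed

lemma abs_vandermonde: "\<bar>vandermonde d\<bar> = (\<Prod>p\<in>{(i, j). i < j}. \<bar>d $ fst p - d $ snd p\<bar>)"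
  by (simp add: vandermonde_def abs_prod case_prod_unfold)

lemma continuous_vandermonde: "continuous_on UNIV (vandermonde :: 'k::{finite,linorder} rvec \<Rightarrow> real)"
  unfolding vandermonde_def case_prod_unfold by (intro continuous_intros)

lemma vandermonde_measurable [measurable]: "(vandermonde :: 'k::{finite,linorder} rvec \<Rightarrow> real) \<in> borel_measurable borel"
  by (intro borel_measurable_continuous_onI continuous_vandermonde)

text \<open>The local form of the Weyl integration formula, as an upper bound: the orthogonal group is
  covered by about \<open>s\<close> to the power \<open>- k (k - 1) / 2\<close> sets of diameter \<open>s\<close>, and over each of them the
  matrices with spectrum in a cube of side \<open>s\<close> lie in a conjugate of a box of sides about \<open>s\<close> on the
  diagonal and \<open>s \<bar>x\<^sub>i - x\<^sub>j\<bar>\<close> off it.\<close>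

lemma spectral_set_cube:
  obtains C :: real where "C > 0"
    "\<And>(x :: 'k::{finite,linorder} rvec) \<eta>. \<eta> > 0 \<Longrightarrow> \<exists>\<epsilon>>0. \<forall>a b s. 0 < s \<and> s < \<epsilon> \<and> x \<in> cbox a b \<and> (\<forall>i. b $ i - a $ i = s) \<longrightarrow>
       (\<exists>B\<in>sets borel. spectral_set (cbox a b) \<subseteq> B \<and>
          emeasure sym_lborel B \<le> ennreal (C * (s ^ CARD('k) * (\<bar>vandermonde x\<bar> + \<eta>))))"
proof -
  let ?P = "{(i :: 'k, j). i < j}"
  let ?n = "card ?P"
  define k where "k = real CARD('k)"
  have k1: "k \<ge> 1" by (simp add: k_def Suc_leI)
  obtain C0 :: real where C0: "C0 > 0"
    "\<And>\<epsilon>. 0 < \<epsilon> \<Longrightarrow> \<epsilon> \<le> 1 \<Longrightarrow> \<exists>R :: 'k sqmat set. finite R \<and> (\<forall>U\<in>R. orthogonal_matrix U) \<and>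
       real (card R) \<le> C0 * (1 / \<epsilon>) ^ ?n \<and>
       (\<forall>H. orthogonal_matrix H \<longrightarrow> (\<exists>U\<in>R. \<forall>i j. \<bar>(H ** transpose U - mat 1) $ i $ j\<bar> \<le> \<epsilon>))"
    by (rule orthogonal_matrix_covering[where 'k = 'k], rule that) auto
  show ?thesis
  proof (rule that)
    show "C0 * 2 ^ ?n > 0" using C0 by simp
    fix x :: "'k rvec" and \<eta> :: real assume \<eta>: "\<eta> > 0"
    define \<rho> where "\<rho> = norm x + 1"
    have \<rho>: "\<rho> \<ge> 1" by (simp add: \<rho>_def)
    \<comment> \<open>Up to the powers of s and 2 that are split off below, \<open>g s\<close> is
      the volume of the enclosing box for a cube of side s. Continuity at 0, where it equals the
      Vandermonde product, makes the surplus smaller than \<eta>.\<close>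
    define g where "g s = (1 + 4 * k * \<rho> * s) ^ CARD('k) * (\<Prod>p\<in>?P. \<bar>x $ fst p - x $ snd p\<bar> + (2 + 2 * k * \<rho>) * s)" for s
    have "isCont g 0" unfolding g_def by (intro continuous_intros)
    moreover have "g 0 = \<bar>vandermonde x\<bar>" by (simp add: g_def abs_vandermonde)
    ultimately obtain \<epsilon>1 where \<epsilon>1: "\<epsilon>1 > 0" "\<And>s. \<bar>s\<bar> < \<epsilon>1 \<Longrightarrow> \<bar>g s - \<bar>vandermonde x\<bar>\<bar> < \<eta>"
      using \<eta> by (auto simp: continuous_at_eps_delta dist_real_def)
    show "\<exists>\<epsilon>>0. \<forall>a b s. 0 < s \<and> s < \<epsilon> \<and> x \<in> cbox a b \<and> (\<forall>i. b $ i - a $ i = s) \<longrightarrow>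
       (\<exists>B\<in>sets borel. spectral_set (cbox a b) \<subseteq> B \<and>
          emeasure sym_lborel B \<le> ennreal (C0 * 2 ^ ?n * (s ^ CARD('k) * (\<bar>vandermonde x\<bar> + \<eta>))))"
    proof (intro exI[of _ "min \<epsilon>1 1"] conjI allI impI)
      show "min \<epsilon>1 1 > 0" using \<epsilon>1 by simp
      fix a b s assume "0 < s \<and> s < min \<epsilon>1 1 \<and> x \<in> cbox a b \<and> (\<forall>i. b $ i - a $ i = s)"
      hence s: "0 < s" "s < \<epsilon>1" "s < 1" and x: "x \<in> cbox a b" and ab: "\<And>i. b $ i - a $ i = s" by auto
      obtain R :: "'k sqmat set" where R: "finite R" "\<And>U. U \<in> R \<Longrightarrow> orthogonal_matrix U" 
         "real (card R) \<le> C0 * (1 / s) ^ ?n"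
         "\<And>H. orthogonal_matrix H \<Longrightarrow> (\<exists>U\<in>R. \<forall>i j. \<bar>(H ** transpose U - mat 1) $ i $ j\<bar> \<le> s)"
        using C0(2)[of s] s by auto
      \<comment> \<open>The second-order error of \<open>conj_diag_near_identity\<close>; \<rho>
        bounds every d in the cube because s < 1.\<close>
      define \<kappa> where "\<kappa> = 2 * k * \<rho> * s\<^sup>2"
      have \<kappa>: "\<kappa> \<ge> 0" using k1 \<rho> by (simp add: \<kappa>_def)
      \<comment> \<open>Both coordinates may move by s within the cube, so \<bar>d_i - d_j\<bar> is
        at most \<bar>x_i - x_j\<bar> + 2 s.\<close>
      define h where "h i j = (\<bar>x $ i - x $ j\<bar> + 2 * s) * s + \<kappa>" for i j
      have h: "h i j \<ge> 0" for i j using \<kappa> s by (simp add: h_def)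
      define lo where "lo i j = (if i = j then a $ i - \<kappa> else - h i j)" for i j
      define up where "up i j = (if i = j then b $ i + \<kappa> else h i j)" for i j
      define Bx where "Bx = sym_box lo up"
      define B where "B = (\<Union>U\<in>R. (\<lambda>V. U ** V ** transpose U) -` Bx)"
      have meas: "(\<lambda>V. U ** V ** transpose U) -` Bx \<in> sets borel" for U
        using measurable_sets[OF conj_measurable[of U "transpose U"], of Bx] by (simp add: Bx_def)
      have "B \<in> sets borel" unfolding B_def using R(1) meas by (intro sets.finite_UN) auto
      moreover have "spectral_set (cbox a b) \<subseteq> B"
      proof
        fix V assume "V \<in> spectral_set (cbox a b)"
        then obtain H d where H: "orthogonal_matrix H" "d \<in> cbox a b" "V = conj_diag H d" by (auto simp: spectral_set_def)
        obtain U where U: "U \<in> R" "\<And>i j. \<bar>(H ** transpose U - mat 1) $ i $ j\<bar> \<le> s" using R(4)[OF H(1)] by auto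
        define Q where "Q = H ** transpose U"
        have Q: "orthogonal_matrix Q" using H R(2)[OF U(1)] by (auto simp: Q_def intro: orthogonal_matrix_mul)
        have dab: "a $ i \<le> d $ i" "d $ i \<le> b $ i" for i using H(2) by (auto simp: mem_box_cart)
        have xab: "a $ i \<le> x $ i" "x $ i \<le> b $ i" for i using x by (auto simp: mem_box_cart)
        have dx: "\<bar>d $ i - x $ i\<bar> \<le> s" for i using dab[of i] xab[of i] ab[of i] by linarith
        have d\<rho>: "\<bar>d $ i\<bar> \<le> \<rho>" for i
          using dx[of i] component_le_norm_cart[of x i] s(3) by (simp add: \<rho>_def)
        have W: "U ** V ** transpose U = conj_diag Q d" by (simp add: H(3) conj_diag_conj Q_def)
        have "conj_diag Q d \<in> Bx"
          unfolding Bx_def sym_box_def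
        proof (intro CollectI allI impI)
          fix i j :: 'k
          show "lo i j \<le> conj_diag Q d $ i $ j \<and> conj_diag Q d $ i $ j \<le> up i j"
          proof (cases "i = j")
            case True
            have "\<bar>conj_diag Q d $ i $ i - d $ i\<bar> \<le> \<kappa>"
              using conj_diag_near_identity(1)[OF Q, of s d \<rho> i] U(2) d\<rho> by (simp add: Q_def \<kappa>_def k_def)
            thus ?thesis using True dab[of i] by (auto simp: lo_def up_def)
          next
            case False
            have "\<bar>conj_diag Q d $ i $ j\<bar> \<le> \<bar>d $ i - d $ j\<bar> * s + \<kappa>"
              using conj_diag_near_identity(2)[OF Q, of s d \<rho> i j] U(2) d\<rho> False by (simp add: Q_def \<kappa>_def k_def)
            also have "\<dots> \<le> h i j" unfolding h_def 
              using dx[of i] dx[of j] s(1) by (intro add_right_mono mult_right_mono) auto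
            finally show ?thesis using False by (auto simp: lo_def up_def)
          qed
        qed
        thus "V \<in> B" unfolding B_def using W by (intro UN_I[OF U(1)]) simp
      qed
      moreover have "emeasure sym_lborel B \<le> ennreal (C0 * 2 ^ ?n * (s ^ CARD('k) * (\<bar>vandermonde x\<bar> + \<eta>)))"
      proof -
        have 1: "emeasure sym_lborel ((\<lambda>V. U ** V ** transpose U) -` Bx) = emeasure sym_lborel Bx" if "U \<in> R" for U
          by (subst (2) sym_lborel_conj[OF R(2)[OF that], symmetric])
             (simp add: emeasure_distr Bx_def)
        define vol where "vol = (\<Prod>(i, j)\<in>{(i, j). i \<le> j}. up i j - lo i j)"
        have lu: "lo i j \<le> up i j" for i j using ab[of i] h[of i j] s \<kappa> by (auto simp: lo_def up_def)
        have vol0: "vol \<ge> 0" unfolding vol_def using lu by (intro prod_nonneg) auto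
        have vol: "vol = 2 ^ ?n * s ^ ?n * s ^ CARD('k) * g s"
        proof -
          have "vol = (\<Prod>i\<in>UNIV. up i i - lo i i) * (\<Prod>p\<in>?P. up (fst p) (snd p) - lo (fst p) (snd p))"
            unfolding vol_def by (subst prod_upper_pairs) (simp add: case_prod_unfold)
          also have "(\<Prod>i\<in>UNIV. up i i - lo i i) = (\<Prod>i\<in>(UNIV :: 'k set). s * (1 + 4 * k * \<rho> * s))"
          proof (rule prod.cong[OF refl])
            fix i
            have "up i i - lo i i = (b $ i - a $ i) + 2 * \<kappa>" by (simp add: up_def lo_def)
            thus "up i i - lo i i = s * (1 + 4 * k * \<rho> * s)"
              by (simp add: ab \<kappa>_def power2_eq_square algebra_simps)
          qed
          also have "(\<Prod>p\<in>?P. up (fst p) (snd p) - lo (fst p) (snd p)) = 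
              (\<Prod>p\<in>?P. (2 * s) * (\<bar>x $ fst p - x $ snd p\<bar> + (2 + 2 * k * \<rho>) * s))"
            by (rule prod.cong[OF refl]) (auto simp: up_def lo_def h_def \<kappa>_def power2_eq_square algebra_simps)
          finally show ?thesis
            by (simp add: prod.distrib power_mult_distrib g_def)
        qed
        have "emeasure sym_lborel B \<le> (\<Sum>U\<in>R. emeasure sym_lborel ((\<lambda>V. U ** V ** transpose U) -` Bx))"
          unfolding B_def using meas R(1) by (intro emeasure_subadditive_finite) auto
        also have "\<dots> = (\<Sum>U\<in>R. ennreal vol)"
          using 1 lu by (simp add: Bx_def emeasure_sym_box vol_def)
        also have "\<dots> = ennreal (real (card R) * vol)" using vol0 by (simp add: ennreal_mult ennreal_of_nat_eq_real_of_nat)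
        also have "real (card R) * vol \<le> C0 * (1 / s) ^ ?n * vol"
          using R(3) vol0 by (rule mult_right_mono)
        \<comment> \<open>The number of covering sets, of order s^(-n), cancels the factor s^n
          contributed by the n off-diagonal sides. The volume s^k of the eigenvalue cube
          remains.\<close>
        also have "\<dots> = C0 * 2 ^ ?n * (s ^ CARD('k) * g s)"
          using s(1) by (simp add: vol power_divide)
        also have "\<dots> \<le> C0 * 2 ^ ?n * (s ^ CARD('k) * (\<bar>vandermonde x\<bar> + \<eta>))"
          using \<epsilon>1(2)[of s] s C0(1) by (intro mult_left_mono) auto
        finally show ?thesis by (simp add: ennreal_leI)
      qed
      ultimately show "\<exists>B\<in>sets borel. spectral_set (cbox a b) \<subseteq> B \<and>
          emeasure sym_lborel B \<le> ennreal (C0 * 2 ^ ?n * (s ^ CARD('k) * (\<bar>vandermonde x\<bar> + \<eta>)))"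
        by blast
    qed
  qed
qed

section \<open>From cubes to Borel sets of spectra\<close>

definition vandermonde_measure :: "'k::{finite,linorder} rvec measure" where
  "vandermonde_measure = density lborel (\<lambda>d. ennreal \<bar>vandermonde d\<bar>)"

lemma sets_vandermonde_measure [measurable_cong, simp]: "sets vandermonde_measure = sets borel"
  by (simp add: vandermonde_measure_def)

lemma emeasure_vandermonde_measure:
  "E \<in> sets borel \<Longrightarrow> emeasure vandermonde_measure E = (\<integral>\<^sup>+d. ennreal \<bar>vandermonde d\<bar> * indicator E d \<partial>lborel)"
  unfolding vandermonde_measure_def by (subst emeasure_density) auto

lemma emeasure_lborel_cube:
  fixes c d :: "'k::finite rvec"
  assumes s: "0 < s" and "\<And>i. d $ i - c $ i = s"
  shows "emeasure lborel (box c d) = ennreal (s ^ CARD('k))"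
proof -
  have le: "c \<bullet> b \<le> d \<bullet> b" "(d - c) \<bullet> b = s" if b: "b \<in> Basis" for b
  proof -
    obtain i where "b = axis i 1" using b by (auto simp: Basis_vec_def)
    thus "c \<bullet> b \<le> d \<bullet> b" "(d - c) \<bullet> b = s" using assms(2)[of i] s by (auto simp: inner_axis)
  qed
  have "emeasure lborel (box c d) = (\<Prod>b\<in>(Basis :: 'k rvec set). (d - c) \<bullet> b)"
    using le by (simp add: emeasure_lborel_box inner_diff_left)
  also have "(\<Prod>b\<in>(Basis :: 'k rvec set). (d - c) \<bullet> b) = (\<Prod>b\<in>(Basis :: 'k rvec set). s)"
    using le by (intro prod.cong) auto
  also have "\<dots> = s ^ CARD('k)" by simp
  finally show ?thesis .
qed

text \<open>Outer regularity puts \<open>E\<close> in an open set of nearly the same measure, and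
  non-overlapping dyadic cubes inside it, each small at the scale of one of its points of
  \<open>E\<close>, cover \<open>E\<close>. \<open>C\<close> is fixed before \<open>E\<close>, while
  \<open>L\<close> may depend on the bounding cube, since \<eta> tends to 0 afterwards.\<close>

lemma spectral_set_approx:
  obtains C :: real where "C > 0"
    "\<And>(E :: 'k::{finite,linorder} rvec set) r. E \<in> sets borel \<Longrightarrow> r > 0 \<Longrightarrow> E \<subseteq> cbox (vec (-r)) (vec r) \<Longrightarrow>
      \<exists>L\<ge>0. \<forall>\<eta>>0. \<exists>B\<in>sets borel. spectral_set E \<subseteq> B \<and>
         emeasure sym_lborel B \<le> ennreal C * (emeasure vandermonde_measure E + ennreal (L * \<eta>))"
proof -
  obtain C :: real where C: "C > 0"
    "\<And>(x :: 'k rvec) \<eta>. \<eta> > 0 \<Longrightarrow> \<exists>\<epsilon>>0. \<forall>a b s. 0 < s \<and> s < \<epsilon> \<and> x \<in> cbox a b \<and> (\<forall>i. b $ i - a $ i = s) \<longrightarrow>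
       (\<exists>B\<in>sets borel. spectral_set (cbox a b) \<subseteq> B \<and>
          emeasure sym_lborel B \<le> ennreal (C * (s ^ CARD('k) * (\<bar>vandermonde x\<bar> + \<eta>))))"
    by (rule spectral_set_cube[where 'k = 'k], rule that) auto
  show ?thesis
  proof (rule that[OF C(1)])
    fix E :: "'k rvec set" and r :: real
    assume E [measurable]: "E \<in> sets borel" and r: "r > 0" and Er: "E \<subseteq> cbox (vec (-r)) (vec r)"
    let ?Q = "cbox (vec (-r)) (vec r) :: 'k rvec set"
    have "compact ((\<lambda>d. \<bar>vandermonde d\<bar>) ` ?Q)"
      by (intro compact_continuous_image continuous_intros continuous_on_subset[OF continuous_vandermonde] compact_cbox) auto
    then obtain M where M: "\<And>d. d \<in> ?Q \<Longrightarrow> \<bar>vandermonde d\<bar> \<le> M"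
      using bounded_imp_bdd_above[OF compact_imp_bounded] unfolding bdd_above_def by (metis imageI)
    have M0: "M \<ge> 0" using M[of 0] r by (auto simp: mem_box_cart)
    \<comment> \<open>M \<eta> pays for the excess of the open set over \<open>E\<close>; the other
      term is 2 \<eta> times the volume of the bounding cube.\<close>
    define L where "L = M + 2 * (2 * r) ^ CARD('k)"
    have volQ: "emeasure lborel ?Q = ennreal ((2 * r) ^ CARD('k))"
    proof -
      have "emeasure lborel ?Q = emeasure lborel (box (vec (-r)) (vec r) :: 'k rvec set)"
        by (simp add: emeasure_lborel_box_eq emeasure_lborel_cbox_eq)
      also have "\<dots> = ennreal ((2 * r) ^ CARD('k))" using r by (intro emeasure_lborel_cube) auto
      finally show ?thesis .
    qed
    show "\<exists>L\<ge>0. \<forall>\<eta>>0. \<exists>B\<in>sets borel. spectral_set E \<subseteq> B \<and>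
         emeasure sym_lborel B \<le> ennreal C * (emeasure vandermonde_measure E + ennreal (L * \<eta>))"
    proof (intro exI[of _ L] conjI allI impI)
      show "L \<ge> 0" using M0 r by (simp add: L_def)
      fix \<eta> :: real assume \<eta>: "\<eta> > 0"
      obtain U where U: "open U" "E \<subseteq> U" "emeasure lborel (U - E) < ennreal \<eta>"
        using outer_regular_lborel[of E \<eta>] \<eta> E by auto
      have [measurable]: "U \<in> sets borel" using U(1) by simp
      \<comment> \<open>The radius secures three things: the ball stays in \<open>U\<close>, the
        Vandermonde product varies by at most \<eta>, and the cube estimate applies. The bound 2
        \<delta> on the side is the diameter of the ball that will contain the cube.\<close>
      have "\<forall>x\<in>E. \<exists>\<delta>>0. ball x \<delta> \<subseteq> U \<and> (\<forall>y\<in>ball x \<delta>. \<bar>\<bar>vandermonde y\<bar> - \<bar>vandermonde x\<bar>\<bar> \<le> \<eta>) \<and>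
         (\<forall>a b s. 0 < s \<and> s < 2 * \<delta> \<and> x \<in> cbox a b \<and> (\<forall>i. b $ i - a $ i = s) \<longrightarrow>
       (\<exists>B\<in>sets borel. spectral_set (cbox a b) \<subseteq> B \<and>
          emeasure sym_lborel B \<le> ennreal (C * (s ^ CARD('k) * (\<bar>vandermonde x\<bar> + \<eta>)))))"
      proof
        fix x assume x: "x \<in> E"
        obtain \<delta>1 where \<delta>1: "\<delta>1 > 0" "ball x \<delta>1 \<subseteq> U" using U x openE by blast
        have "isCont (\<lambda>y. \<bar>vandermonde y\<bar>) x"
          using continuous_vandermonde[where 'k = 'k] by (intro continuous_intros) (simp add: continuous_on_eq_continuous_at)
        then obtain \<delta>2 where \<delta>2: "\<delta>2 > 0" "\<And>y. dist y x < \<delta>2 \<Longrightarrow> \<bar>\<bar>vandermonde y\<bar> - \<bar>vandermonde x\<bar>\<bar> < \<eta>"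
          using \<eta> by (auto simp: continuous_at_eps_delta dist_real_def)
        obtain \<epsilon> where \<epsilon>: "\<epsilon> > 0" "\<forall>a b s. 0 < s \<and> s < \<epsilon> \<and> x \<in> cbox a b \<and> (\<forall>i. b $ i - a $ i = s) \<longrightarrow>
           (\<exists>B\<in>sets borel. spectral_set (cbox a b) \<subseteq> B \<and>
              emeasure sym_lborel B \<le> ennreal (C * (s ^ CARD('k) * (\<bar>vandermonde x\<bar> + \<eta>))))"
          using C(2)[OF \<eta>, of x] by blast
        define \<delta> where "\<delta> = min (min \<delta>1 \<delta>2) (\<epsilon> / 2)"
        show "\<exists>\<delta>>0. ball x \<delta> \<subseteq> U \<and> (\<forall>y\<in>ball x \<delta>. \<bar>\<bar>vandermonde y\<bar> - \<bar>vandermonde x\<bar>\<bar> \<le> \<eta>) \<and>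
         (\<forall>a b s. 0 < s \<and> s < 2 * \<delta> \<and> x \<in> cbox a b \<and> (\<forall>i. b $ i - a $ i = s) \<longrightarrow>
       (\<exists>B\<in>sets borel. spectral_set (cbox a b) \<subseteq> B \<and>
          emeasure sym_lborel B \<le> ennreal (C * (s ^ CARD('k) * (\<bar>vandermonde x\<bar> + \<eta>)))))"
        proof (intro exI[of _ \<delta>] conjI ballI)
          show "\<delta> > 0" using \<delta>1 \<delta>2 \<epsilon> by (simp add: \<delta>_def)
          show "ball x \<delta> \<subseteq> U" using \<delta>1(2) by (auto simp: \<delta>_def)
          show "\<bar>\<bar>vandermonde y\<bar> - \<bar>vandermonde x\<bar>\<bar> \<le> \<eta>" if "y \<in> ball x \<delta>" for y
            using \<delta>2(2)[of y] that by (simp add: \<delta>_def dist_commute less_imp_le)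
          have "s < \<epsilon>" if "s < 2 * \<delta>" for s using that by (simp add: \<delta>_def)
          thus "\<forall>a b s. 0 < s \<and> s < 2 * \<delta> \<and> x \<in> cbox a b \<and> (\<forall>i. b $ i - a $ i = s) \<longrightarrow>
            (\<exists>B\<in>sets borel. spectral_set (cbox a b) \<subseteq> B \<and>
          emeasure sym_lborel B \<le> ennreal (C * (s ^ CARD('k) * (\<bar>vandermonde x\<bar> + \<eta>))))"
            using \<epsilon>(2) by blast
        qed
      qed
      from bchoice[OF this] obtain \<delta> where \<delta>_all: "\<forall>x\<in>E. \<delta> x > 0 \<and> ball x (\<delta> x) \<subseteq> U \<and>
         (\<forall>y\<in>ball x (\<delta> x). \<bar>\<bar>vandermonde y\<bar> - \<bar>vandermonde x\<bar>\<bar> \<le> \<eta>) \<and>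
         (\<forall>a b s. 0 < s \<and> s < 2 * \<delta> x \<and> x \<in> cbox a b \<and> (\<forall>i. b $ i - a $ i = s) \<longrightarrow>
       (\<exists>B\<in>sets borel. spectral_set (cbox a b) \<subseteq> B \<and>
          emeasure sym_lborel B \<le> ennreal (C * (s ^ CARD('k) * (\<bar>vandermonde x\<bar> + \<eta>)))))" ..
      note \<delta> = \<delta>_all[THEN bspec, THEN conjunct1] \<delta>_all[THEN bspec, THEN conjunct2, THEN conjunct1]
        \<delta>_all[THEN bspec, THEN conjunct2, THEN conjunct2, THEN conjunct1, rule_format]
        \<delta>_all[THEN bspec, THEN conjunct2, THEN conjunct2, THEN conjunct2, rule_format]
      \<comment> \<open>The covering lemma asks for a gauge on the whole space; the radius 1 off
        \<open>E\<close> is an arbitrary value.\<close>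
      define g where "g x = ball x (if x \<in> E then \<delta> x else 1)" for x
      have g: "gauge g" using \<delta>(1) by (auto simp: gauge_def g_def)
      have boxne: "box (vec (-r)) (vec r) \<noteq> ({} :: 'k rvec set)"
      proof -
        have "(0 :: 'k rvec) \<in> box (vec (-r)) (vec r)" using r by (simp add: mem_box_cart)
        thus ?thesis by blast
      qed
      obtain \<D> where D: "countable \<D>"  "\<Union>\<D> \<subseteq> ?Q"
        "\<And>K. K \<in> \<D> \<Longrightarrow> interior K \<noteq> {} \<and> (\<exists>c d. K = cbox c d)"
        "pairwise (\<lambda>A B. interior A \<inter> interior B = {}) \<D>"
        "\<And>K. K \<in> \<D> \<Longrightarrow> \<exists>x \<in> E \<inter> K. K \<subseteq> g x"
        "\<And>u v. cbox u v \<in> \<D> \<Longrightarrow> \<exists>n. \<forall>i \<in> Basis. v \<bullet> i - u \<bullet> i = (vec r \<bullet> i - vec (-r) \<bullet> i) / 2^n"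
        "E \<subseteq> \<Union>\<D>"
        by (rule covering_lemma[OF Er boxne g]) blast
      \<comment> \<open>One \<eta> comes from the cube estimate, the other from moving between x and
        the points of the cube.\<close>
      define f where "f d = ennreal (\<bar>vandermonde d\<bar> + 2 * \<eta>)" for d :: "'k rvec"
      have [measurable]: "f \<in> borel_measurable borel" unfolding f_def by measurable
      have "\<forall>K\<in>\<D>. \<exists>B. B \<in> sets borel \<and> spectral_set K \<subseteq> B \<and> interior K \<subseteq> U \<and>
         emeasure sym_lborel B \<le> ennreal C * (\<integral>\<^sup>+d. f d * indicator (interior K) d \<partial>lborel)"
      proof
        fix K assume K: "K \<in> \<D>"
        obtain c d where cd: "K = cbox c d" using D(3)[OF K] by blast
        obtain x where x: "x \<in> E" "x \<in> K" "K \<subseteq> g x" using D(5)[OF K] by auto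
        have Kx: "K \<subseteq> ball x (\<delta> x)" using x by (simp add: g_def)
        obtain n where n: "\<forall>i \<in> Basis. d \<bullet> i - c \<bullet> i = (vec r \<bullet> i - vec (-r) \<bullet> i) / 2^n"
          using D(6) K cd by blast
        define s where "s = 2 * r / 2 ^ n"
        have s: "s > 0" using r by (simp add: s_def)
        have dc: "d $ i - c $ i = s" for i
          using n[rule_format, of "axis i 1"] by (simp add: inner_axis s_def axis_in_Basis_iff)
        have "c \<in> K" "d \<in> K" using dc s by (auto simp: cd mem_box_cart intro: less_imp_le) (metis diff_gt_0_iff_gt less_imp_le)+
        hence "c \<in> ball x (\<delta> x)" "d \<in> ball x (\<delta> x)" using Kx by blast+
        hence "dist c d < 2 * \<delta> x" using dist_triangle3[of c d x] by simp
        moreover have "s \<le> dist c d"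
          using component_le_norm_cart[of "d - c" undefined] dc[of undefined] s by (simp add: dist_norm norm_minus_commute)
        ultimately have s2: "s < 2 * \<delta> x" by simp
        obtain B where B: "B \<in> sets borel" "spectral_set K \<subseteq> B" 
            "emeasure sym_lborel B \<le> ennreal (C * (s ^ CARD('k) * (\<bar>vandermonde x\<bar> + \<eta>)))"
          using \<delta>(4)[OF x(1), of s c d] s s2 x(2) dc cd by auto
        note B(3)
        also have "ennreal (C * (s ^ CARD('k) * (\<bar>vandermonde x\<bar> + \<eta>))) = 
            ennreal C * (ennreal (\<bar>vandermonde x\<bar> + \<eta>) * emeasure lborel (box c d))"
          using C(1) s \<eta> dc by (simp add: emeasure_lborel_cube ennreal_mult mult_ac)
        also have "ennreal (\<bar>vandermonde x\<bar> + \<eta>) * emeasure lborel (box c d) = 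
            (\<integral>\<^sup>+d'. ennreal (\<bar>vandermonde x\<bar> + \<eta>) * indicator (box c d) d' \<partial>lborel)"
          by (simp add: nn_integral_cmult_indicator)
        also have "\<dots> \<le> (\<integral>\<^sup>+d'. f d' * indicator (interior K) d' \<partial>lborel)"
        proof (rule nn_integral_mono)
          fix y :: "'k rvec"
          show "ennreal (\<bar>vandermonde x\<bar> + \<eta>) * indicator (box c d) y \<le> f y * indicator (interior K) y"
          proof (cases "y \<in> box c d")
            case True
            hence "y \<in> K" using cd box_subset_cbox by blast
            hence "\<bar>\<bar>vandermonde y\<bar> - \<bar>vandermonde x\<bar>\<bar> \<le> \<eta>" using \<delta>(3)[OF x(1)] Kx by blast
            hence "\<bar>vandermonde x\<bar> + \<eta> \<le> \<bar>vandermonde y\<bar> + 2 * \<eta>" by linarith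
            hence "ennreal (\<bar>vandermonde x\<bar> + \<eta>) \<le> f y" unfolding f_def by (rule ennreal_leI)
            thus ?thesis using True by (simp add: cd interior_cbox)
          qed simp
        qed
        finally have "emeasure sym_lborel B \<le> ennreal C * (\<integral>\<^sup>+d. f d * indicator (interior K) d \<partial>lborel)"
          by (simp add: mult_left_mono)
        moreover have "interior K \<subseteq> U" using interior_subset[of K] Kx \<delta>(2)[OF x(1)] by blast
        ultimately show "\<exists>B. B \<in> sets borel \<and> spectral_set K \<subseteq> B \<and> interior K \<subseteq> U \<and>
           emeasure sym_lborel B \<le> ennreal C * (\<integral>\<^sup>+d. f d * indicator (interior K) d \<partial>lborel)"
          using B(1,2) by blast
      qed
      from bchoice[OF this] obtain B where B_all: "\<forall>K\<in>\<D>. B K \<in> sets borel \<and> spectral_set K \<subseteq> B K \<and> interior K \<subseteq> U \<and>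
         emeasure sym_lborel (B K) \<le> ennreal C * (\<integral>\<^sup>+d. f d * indicator (interior K) d \<partial>lborel)"
        ..
      note B = B_all[THEN bspec, THEN conjunct1] B_all[THEN bspec, THEN conjunct2, THEN conjunct1]
        B_all[THEN bspec, THEN conjunct2, THEN conjunct2, THEN conjunct1]
        B_all[THEN bspec, THEN conjunct2, THEN conjunct2, THEN conjunct2]
      define BB where "BB = (\<Union>K\<in>\<D>. B K)"
      have BB: "BB \<in> sets borel" unfolding BB_def using B(1) D(1) by (intro sets.countable_UN') auto
      moreover have "spectral_set E \<subseteq> BB"
      proof
        fix V assume "V \<in> spectral_set E"
        then obtain H d where H: "orthogonal_matrix H" "d \<in> E" "V = conj_diag H d" by (auto simp: spectral_set_def)
        obtain K where K: "K \<in> \<D>" "d \<in> K" using D(7) H(2) by blast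
        have "V \<in> spectral_set K" using H K by (auto simp: spectral_set_def)
        thus "V \<in> BB" using B(2) K(1) by (auto simp: BB_def)
      qed
      moreover have "emeasure sym_lborel BB \<le> ennreal C * (emeasure vandermonde_measure E + ennreal (L * \<eta>))"
      proof -
        \<comment> \<open>Interiors are used because the cubes may share boundary points, so that
          only the interiors are disjoint and their measures add up.\<close>
        define \<nu> where "\<nu> = density lborel f"
        have \<nu>: "emeasure \<nu> X = (\<integral>\<^sup>+d. f d * indicator X d \<partial>lborel)" if "X \<in> sets borel" for X
          unfolding \<nu>_def using that by (subst emeasure_density) auto
        have BM: "(\<lambda>x. indicator (B K) x) \<in> borel_measurable sym_lborel" if "K \<in> \<D>" for K
          using B(1)[OF that] by simp
        have "emeasure sym_lborel BB = (\<integral>\<^sup>+V. indicator BB V \<partial>sym_lborel)" using BB by simp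
        also have "\<dots> \<le> (\<integral>\<^sup>+V. (\<integral>\<^sup>+K. indicator (B K) V \<partial>count_space \<D>) \<partial>sym_lborel)"
        proof (rule nn_integral_mono)
          fix V
          show "indicator BB V \<le> (\<integral>\<^sup>+K. indicator (B K) V \<partial>count_space \<D> :: ennreal)"
          proof (cases "V \<in> BB")
            case True
            then obtain K where K: "K \<in> \<D>" "V \<in> B K" by (auto simp: BB_def)
            have "indicator (B K) V \<le> (\<integral>\<^sup>+K. indicator (B K) V \<partial>count_space \<D> :: ennreal)"
              using nn_integral_ge_point[OF K(1), of "\<lambda>K. indicator (B K) V"] .
            thus ?thesis using True K by simp
          qed simp
        qed
        also have "\<dots> = (\<integral>\<^sup>+K. (\<integral>\<^sup>+V. indicator (B K) V \<partial>sym_lborel) \<partial>count_space \<D>)"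
          using D(1) BM by (rule nn_integral_count_space_nn_integral)
        also have "\<dots> \<le> (\<integral>\<^sup>+K. ennreal C * emeasure \<nu> (interior K) \<partial>count_space \<D>)"
          using B(1,4) by (intro nn_integral_mono) (simp add: \<nu>)
        also have "\<dots> = ennreal C * (\<integral>\<^sup>+K. emeasure \<nu> (interior K) \<partial>count_space \<D>)"
          by (rule nn_integral_cmult) simp
        also have "(\<integral>\<^sup>+K. emeasure \<nu> (interior K) \<partial>count_space \<D>) = emeasure \<nu> (\<Union>K\<in>\<D>. interior K)"
          using D(1,4) by (intro emeasure_UN_countable[symmetric]) (auto simp: \<nu>_def disjoint_family_on_def pairwise_def)
        also have "\<dots> \<le> emeasure \<nu> (U \<inter> ?Q)"
        proof (rule emeasure_mono)
          show "(\<Union>K\<in>\<D>. interior K) \<subseteq> U \<inter> ?Q" using B(3) D(2) interior_subset by blast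
        qed (simp add: \<nu>_def)
        also have "\<dots> = (\<integral>\<^sup>+d. f d * indicator (U \<inter> ?Q) d \<partial>lborel)" by (rule \<nu>) simp
        also have "\<dots> \<le> (\<integral>\<^sup>+d. ennreal \<bar>vandermonde d\<bar> * indicator E d + (ennreal M * indicator (U - E) d + ennreal (2 * \<eta>) * indicator ?Q d) \<partial>lborel)"
        proof (rule nn_integral_mono)
          fix d :: "'k rvec"
          show "f d * indicator (U \<inter> ?Q) d \<le> ennreal \<bar>vandermonde d\<bar> * indicator E d + (ennreal M * indicator (U - E) d + ennreal (2 * \<eta>) * indicator ?Q d)"
          proof (cases "d \<in> U \<inter> ?Q")
            case True
            have fd: "f d = ennreal \<bar>vandermonde d\<bar> + ennreal (2 * \<eta>)"
              using \<eta> by (simp add: f_def)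
            show ?thesis
              using True ennreal_leI[OF M[of d]] by (cases "d \<in> E") (auto simp: fd intro!: add_right_mono)
          qed simp
        qed
        also have "\<dots> = emeasure vandermonde_measure E + (ennreal M * emeasure lborel (U - E) + ennreal (2 * \<eta>) * emeasure lborel ?Q)"
          by (subst nn_integral_add nn_integral_add; (simp add: emeasure_vandermonde_measure nn_integral_cmult_indicator)?)+
        also have "\<dots> \<le> emeasure vandermonde_measure E + (ennreal M * ennreal \<eta> + ennreal (2 * \<eta>) * emeasure lborel ?Q)"
          using U(3) by (intro add_mono mult_mono order_refl) auto
        also have "ennreal M * ennreal \<eta> + ennreal (2 * \<eta>) * emeasure lborel ?Q = ennreal (L * \<eta>)"
          unfolding volQ L_def using M0 \<eta> r by (simp add: algebra_simps flip: ennreal_mult ennreal_plus)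
        finally show ?thesis by (simp add: mult_left_mono)
      qed
      ultimately show "\<exists>B\<in>sets borel. spectral_set E \<subseteq> B \<and>
         emeasure sym_lborel B \<le> ennreal C * (emeasure vandermonde_measure E + ennreal (L * \<eta>))" by blast
    qed
  qed
qed

text \<open>Intersecting the supersets for \<eta> = 1 / (n + 1) removes the error term, since
  \<open>L\<close> stays fixed for a bounded set. Unbounded sets are cut into shells of integer
  width, over which the bounds add up because \<open>C\<close> is common to all of them.\<close>

theorem weyl_upper_bound:
  obtains C :: real where "C > 0"
    "\<And>E :: 'k::{finite,linorder} rvec set. E \<in> sets borel \<Longrightarrow>
      \<exists>B\<in>sets borel. spectral_set E \<subseteq> B \<and> emeasure sym_lborel B \<le> ennreal C * emeasure vandermonde_measure E"
proof -
  obtain C :: real where C: "C > 0"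
    "\<And>(E :: 'k::{finite,linorder} rvec set) r. E \<in> sets borel \<Longrightarrow> r > 0 \<Longrightarrow> E \<subseteq> cbox (vec (-r)) (vec r) \<Longrightarrow>
      \<exists>L\<ge>0. \<forall>\<eta>>0. \<exists>B\<in>sets borel. spectral_set E \<subseteq> B \<and>
         emeasure sym_lborel B \<le> ennreal C * (emeasure vandermonde_measure E + ennreal (L * \<eta>))"
    by (rule spectral_set_approx[where 'k = 'k], rule that) auto
  have bdd: "\<exists>B\<in>sets borel. spectral_set E \<subseteq> B \<and> emeasure sym_lborel B \<le> ennreal C * emeasure vandermonde_measure E"
    if E: "E \<in> sets borel" "r > 0" "E \<subseteq> cbox (vec (-r)) (vec r)" for E :: "'k rvec set" and r
  proof -
    obtain L where L: "L \<ge> 0" "\<And>\<eta>. \<eta> > 0 \<Longrightarrow> \<exists>B\<in>sets borel. spectral_set E \<subseteq> B \<and>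
         emeasure sym_lborel B \<le> ennreal C * (emeasure vandermonde_measure E + ennreal (L * \<eta>))"
      using C(2)[OF E] by blast
    have "\<forall>n::nat. \<exists>B\<in>sets borel. spectral_set E \<subseteq> B \<and>
         emeasure sym_lborel B \<le> ennreal C * (emeasure vandermonde_measure E + ennreal (L * (1 / Suc n)))"
      by (intro allI L(2)) simp
    then obtain B where B: "\<And>n::nat. B n \<in> sets borel" "\<And>n. spectral_set E \<subseteq> B n"
       "\<And>n. emeasure sym_lborel (B n) \<le> ennreal C * (emeasure vandermonde_measure E + ennreal (L * (1 / Suc n)))"
      by metis
    have "(\<Inter>n. B n) \<in> sets borel" using B(1) by auto
    moreover have "spectral_set E \<subseteq> (\<Inter>n. B n)" using B(2) by blast
    moreover have "emeasure sym_lborel (\<Inter>n. B n) \<le> ennreal C * emeasure vandermonde_measure E"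
    proof (rule ennreal_le_epsilon)
      fix e :: real assume e: "0 < e"
      obtain n :: nat where n: "C * L / e < real n" using reals_Archimedean2 by blast
      have "emeasure sym_lborel (\<Inter>n. B n) \<le> emeasure sym_lborel (B n)"
        using B(1) by (intro emeasure_mono) auto
      also have "\<dots> \<le> ennreal C * (emeasure vandermonde_measure E + ennreal (L * (1 / Suc n)))" by (rule B(3))
      also have "\<dots> = ennreal C * emeasure vandermonde_measure E + ennreal (C * (L * (1 / Suc n)))"
        using C(1) L(1) ennreal_mult[of C "L * (1 / Suc n)"] by (simp only: distrib_left) simp
      also have "C * (L * (1 / Suc n)) \<le> e"
      proof -
        have "C * L < real n * e" using n e by (simp add: field_simps)
        also have "\<dots> \<le> real (Suc n) * e" using e by (intro mult_right_mono) auto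
        finally show ?thesis by (simp add: field_simps)
      qed
      hence "ennreal C * emeasure vandermonde_measure E + ennreal (C * (L * (1 / Suc n))) \<le> ennreal C * emeasure vandermonde_measure E + ennreal e"
        by (intro add_left_mono ennreal_leI)
      finally show "emeasure sym_lborel (\<Inter>n. B n) \<le> ennreal C * emeasure vandermonde_measure E + ennreal e" .
    qed
    ultimately show ?thesis by blast
  qed
  show ?thesis
  proof (rule that[OF C(1)])
    fix E :: "'k rvec set" assume E [measurable]: "E \<in> sets borel"
    define F where "F n = E \<inter> {x. nat \<lfloor>norm x\<rfloor> = n}" for n
    have F: "F n \<in> sets borel" for n unfolding F_def by measurable
    have UF: "(\<Union>n. F n) = E" by (auto simp: F_def)
    have "\<forall>n. \<exists>B\<in>sets borel. spectral_set (F n) \<subseteq> B \<and> emeasure sym_lborel B \<le> ennreal C * emeasure vandermonde_measure (F n)"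
    proof (intro allI)
      fix n
      have "F n \<subseteq> cbox (vec (- (real n + 1))) (vec (real n + 1))"
      proof
        fix x assume "x \<in> F n"
        hence "norm x \<le> real n + 1" by (auto simp: F_def)
        hence "- (real n + 1) \<le> x $ i" "x $ i \<le> real n + 1" for i
          using component_le_norm_cart[of x i] by linarith+
        thus "x \<in> cbox (vec (- (real n + 1))) (vec (real n + 1))" by (simp add: mem_box_cart)
      qed
      thus "\<exists>B\<in>sets borel. spectral_set (F n) \<subseteq> B \<and> emeasure sym_lborel B \<le> ennreal C * emeasure vandermonde_measure (F n)"
        by (intro bdd[OF F, of "real n + 1"]) auto
    qed
    then obtain B where B: "\<And>n. B n \<in> sets borel" "\<And>n. spectral_set (F n) \<subseteq> B n"
       "\<And>n. emeasure sym_lborel (B n) \<le> ennreal C * emeasure vandermonde_measure (F n)" by metis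
    have "(\<Union>n. B n) \<in> sets borel" using B(1) by auto
    moreover have "spectral_set E \<subseteq> (\<Union>n. B n)"
      using B(2) unfolding UF[symmetric] by (fastforce simp: spectral_set_def)
    moreover have "emeasure sym_lborel (\<Union>n. B n) \<le> ennreal C * emeasure vandermonde_measure E"
    proof -
      have "emeasure sym_lborel (\<Union>n. B n) \<le> (\<Sum>n. emeasure sym_lborel (B n))"
        using B(1) by (intro emeasure_subadditive_countably) auto
      also have "\<dots> \<le> (\<Sum>n. ennreal C * emeasure vandermonde_measure (F n))"
        by (intro suminf_le B(3)) auto
      also have "\<dots> = ennreal C * (\<Sum>n. emeasure vandermonde_measure (F n))" by (rule ennreal_suminf_cmult)
      also have "(\<Sum>n. emeasure vandermonde_measure (F n)) = emeasure vandermonde_measure (\<Union>n. F n)"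
        using F by (intro suminf_emeasure) (auto simp: disjoint_family_on_def F_def)
      finally show ?thesis by (simp add: UF)
    qed
    ultimately show "\<exists>B\<in>sets borel. spectral_set E \<subseteq> B \<and> emeasure sym_lborel B \<le> ennreal C * emeasure vandermonde_measure E"
      by blast
  qed
qed

text \<open>The Vandermonde product vanishes exactly on the spectra with a repeated value, so these
  have measure zero for \<open>vandermonde_measure\<close>, and the upper bound carries this over to
  matrices.\<close>

lemma AE_simple_spectrum:
  "AE V in (sym_lborel :: 'k::{finite,linorder} sqmat measure).
     \<forall>H d. orthogonal_matrix H \<longrightarrow> V = conj_diag H d \<longrightarrow> inj (($) d)"
proof -
  obtain C :: real where C: "C > 0"
    "\<And>E :: 'k rvec set. E \<in> sets borel \<Longrightarrow>
      \<exists>B\<in>sets borel. spectral_set E \<subseteq> B \<and> emeasure sym_lborel B \<le> ennreal C * emeasure vandermonde_measure E"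
    by (rule weyl_upper_bound[where 'k = 'k], rule that) auto
  define E where "E = {d :: 'k rvec. \<not> inj (($) d)}"
  have "E = {d. vandermonde d = 0}"
  proof (intro set_eqI iffI)
    fix d assume "d \<in> E"
    then obtain i j where ij: "i \<noteq> j" "d $ i = d $ j" by (auto simp: E_def inj_def)
    hence "(min i j, max i j) \<in> {(i, j). i < j}" "d $ min i j - d $ max i j = 0" by (auto simp: min_def max_def)
    hence "vandermonde d = 0" unfolding vandermonde_def
      by (intro prod_zero bexI[of _ "(min i j, max i j)"]) auto
    thus "d \<in> {d. vandermonde d = 0}" by simp
  qed (auto simp: E_def vandermonde_def prod_zero_iff inj_def)
  hence E: "E \<in> sets borel" "\<And>d. d \<in> E \<Longrightarrow> vandermonde d = 0" by auto
  have "emeasure vandermonde_measure E = (\<integral>\<^sup>+(d :: 'k rvec). 0 \<partial>lborel)"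
    unfolding emeasure_vandermonde_measure[OF E(1)]
    by (intro nn_integral_cong) (auto simp: E(2) indicator_def)
  then obtain B where B: "B \<in> sets borel" "spectral_set E \<subseteq> B" "emeasure sym_lborel B = 0"
    using C(2)[OF E(1)] by auto
  hence "AE V in sym_lborel. V \<notin> B" by (intro AE_not_in) (simp add: null_sets_def)
  thus ?thesis
  proof eventually_elim
    case (elim V)
    show ?case
    proof (intro allI impI)
      fix H d assume "orthogonal_matrix H" "V = conj_diag H d"
      moreover have "V \<notin> spectral_set E" using elim B(2) by blast
      ultimately show "inj (($) d)" by (auto simp: spectral_set_def E_def)
    qed
  qed
qed

text \<open>The integrand \<open>g\<close> is dominated by a countable sum of multiples of
  indicators of Borel sets, one for each dyadic level of \<open>f\<close>. Hence neither
  measurability of \<open>g\<close> nor of the spectral sets enters.\<close>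

theorem weyl_upper_integral:
  obtains C :: real where "C > 0"
    "\<And>(E :: 'k::{finite,linorder} rvec set) f g. E \<in> sets borel \<Longrightarrow> f \<in> borel_measurable borel \<Longrightarrow> (\<And>d. d \<in> E \<Longrightarrow> 0 < f d) \<Longrightarrow>
      (\<And>H d. orthogonal_matrix H \<Longrightarrow> d \<in> E \<Longrightarrow> g (conj_diag H d) \<le> ennreal (f d)) \<Longrightarrow>
      (AE V in sym_lborel. V \<notin> spectral_set E \<longrightarrow> g V = 0) \<Longrightarrow>
      (\<integral>\<^sup>+V. g V \<partial>sym_lborel) \<le> ennreal C * (\<integral>\<^sup>+d. ennreal (f d * \<bar>vandermonde d\<bar>) * indicator E d \<partial>lborel)"
proof -
  obtain C :: real where C: "C > 0"
    "\<And>E :: 'k rvec set. E \<in> sets borel \<Longrightarrow>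
      \<exists>B\<in>sets borel. spectral_set E \<subseteq> B \<and> emeasure sym_lborel B \<le> ennreal C * emeasure vandermonde_measure E"
    by (rule weyl_upper_bound[where 'k = 'k], rule that) auto
  show ?thesis
  proof (rule that)
    show "2 * C > 0" using C(1) by simp
    fix E :: "'k rvec set" and f :: "'k rvec \<Rightarrow> real" and g :: "'k sqmat \<Rightarrow> ennreal"
    assume E [measurable]: "E \<in> sets borel" and f [measurable]: "f \<in> borel_measurable borel"
      and fpos: "\<And>d. d \<in> E \<Longrightarrow> 0 < f d"
      and g: "\<And>H d. orthogonal_matrix H \<Longrightarrow> d \<in> E \<Longrightarrow> g (conj_diag H d) \<le> ennreal (f d)"
      and g0: "AE V in sym_lborel. V \<notin> spectral_set E \<longrightarrow> g V = 0"
    \<comment> \<open>Layers on which \<open>f\<close> lies between consecutive powers of 2;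
      positivity of \<open>f\<close> makes the logarithm meaningful. Replacing \<open>f\<close> by
      the upper end \<open>c j\<close> of its layer costs the factor 2 in the constant.\<close>
    define F where "F j = E \<inter> {d. \<lfloor>log 2 (f d)\<rfloor> = j}" for j :: int
    have F [measurable]: "F j \<in> sets borel" for j unfolding F_def by measurable
    define c where "c j = 2 powr (real_of_int j + 1)" for j :: int
    have c0: "c j \<ge> 0" for j by (simp add: c_def)
    have Fb: "f d \<le> c j" "c j \<le> 2 * f d" if "d \<in> F j" for d j
    proof -
      have fd: "0 < f d" using that fpos by (auto simp: F_def)
      have j: "real_of_int j \<le> log 2 (f d)" "log 2 (f d) < real_of_int j + 1"
        using that unfolding F_def by (auto intro: of_int_floor_le) linarith?
      have "f d = 2 powr log 2 (f d)" using fd by simp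
      also have "\<dots> \<le> 2 powr (real_of_int j + 1)" using j(2) by (intro powr_mono) auto
      finally show "f d \<le> c j" by (simp add: c_def)
      have "c j = 2 * 2 powr real_of_int j" by (simp add: c_def powr_add)
      also have "2 powr real_of_int j \<le> 2 powr log 2 (f d)" using j(1) by (intro powr_mono) auto
      also have "2 powr log 2 (f d) = f d" using fd by simp
      finally show "c j \<le> 2 * f d" by simp
    qed
    have "\<forall>j. \<exists>B\<in>sets borel. spectral_set (F j) \<subseteq> B \<and> emeasure sym_lborel B \<le> ennreal C * emeasure vandermonde_measure (F j)"
      using C(2)[OF F] by blast
    then obtain B where B: "\<And>j. B j \<in> sets borel" "\<And>j. spectral_set (F j) \<subseteq> B j"
       "\<And>j. emeasure sym_lborel (B j) \<le> ennreal C * emeasure vandermonde_measure (F j)" by metis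
    note B(1) [measurable]
    have "(\<integral>\<^sup>+V. g V \<partial>sym_lborel) \<le> (\<integral>\<^sup>+V. (\<integral>\<^sup>+j. ennreal (c j) * indicator (B j) V \<partial>count_space UNIV) \<partial>sym_lborel)"
    proof (rule nn_integral_mono_AE)
      show "AE V in sym_lborel. g V \<le> (\<integral>\<^sup>+j. ennreal (c j) * indicator (B j) V \<partial>count_space UNIV)"
        using g0
      proof eventually_elim
        case (elim V)
        show ?case
        proof (cases "V \<in> spectral_set E")
          case True
          then obtain H d where H: "orthogonal_matrix H" "d \<in> E" "V = conj_diag H d" by (auto simp: spectral_set_def)
          define j where "j = \<lfloor>log 2 (f d)\<rfloor>"
          have dj: "d \<in> F j" using H(2) by (simp add: F_def j_def)
          hence "V \<in> spectral_set (F j)" using H by (auto simp: spectral_set_def)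
          hence VB: "V \<in> B j" using B(2) by blast
          have "g V \<le> ennreal (f d)" using g H by blast
          also have "\<dots> \<le> ennreal (c j) * indicator (B j) V"
            using VB Fb(1)[OF dj] by (simp add: ennreal_leI)
          also have "\<dots> \<le> (\<integral>\<^sup>+j. ennreal (c j) * indicator (B j) V \<partial>count_space UNIV)"
            using nn_integral_ge_point[of j UNIV "\<lambda>j. ennreal (c j) * indicator (B j) V"] by simp
          finally show ?thesis .
        qed (use elim in simp)
      qed
    qed
    also have "\<dots> = (\<integral>\<^sup>+j. (\<integral>\<^sup>+V. ennreal (c j) * indicator (B j) V \<partial>sym_lborel) \<partial>count_space UNIV)"
      by (rule nn_integral_count_space_nn_integral) auto
    also have "\<dots> = (\<integral>\<^sup>+j. ennreal (c j) * emeasure sym_lborel (B j) \<partial>count_space UNIV)"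
      by (intro nn_integral_cong) (simp add: nn_integral_cmult_indicator)
    also have "\<dots> \<le> (\<integral>\<^sup>+j. ennreal C * (ennreal (c j) * emeasure vandermonde_measure (F j)) \<partial>count_space UNIV)"
    proof (rule nn_integral_mono)
      fix j
      have "ennreal (c j) * emeasure sym_lborel (B j) \<le> ennreal (c j) * (ennreal C * emeasure vandermonde_measure (F j))"
        by (intro mult_left_mono B(3)) simp
      thus "ennreal (c j) * emeasure sym_lborel (B j) \<le> ennreal C * (ennreal (c j) * emeasure vandermonde_measure (F j))"
        by (simp add: mult_ac)
    qed
    also have "\<dots> = ennreal C * (\<integral>\<^sup>+j. ennreal (c j) * emeasure vandermonde_measure (F j) \<partial>count_space UNIV)"
      by (rule nn_integral_cmult) simp
    also have "(\<integral>\<^sup>+j. ennreal (c j) * emeasure vandermonde_measure (F j) \<partial>count_space UNIV) =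
       (\<integral>\<^sup>+j. (\<integral>\<^sup>+d. ennreal (c j) * (ennreal \<bar>vandermonde d\<bar> * indicator (F j) d) \<partial>lborel) \<partial>count_space UNIV)"
      by (intro nn_integral_cong) (simp add: emeasure_vandermonde_measure nn_integral_cmult)
    also have "\<dots> = (\<integral>\<^sup>+d. (\<integral>\<^sup>+j. ennreal (c j) * (ennreal \<bar>vandermonde d\<bar> * indicator (F j) d) \<partial>count_space UNIV) \<partial>lborel)"
      by (rule nn_integral_count_space_nn_integral[symmetric]) auto
    also have "\<dots> \<le> (\<integral>\<^sup>+d. ennreal 2 * (ennreal (f d * \<bar>vandermonde d\<bar>) * indicator E d) \<partial>lborel)"
    proof (rule nn_integral_mono)
      fix d
      define R where "R = ennreal 2 * (ennreal (f d * \<bar>vandermonde d\<bar>) * indicator E d)"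
      have "(\<integral>\<^sup>+j. ennreal (c j) * (ennreal \<bar>vandermonde d\<bar> * indicator (F j) d) \<partial>count_space UNIV) \<le>
            (\<integral>\<^sup>+j. R * indicator {\<lfloor>log 2 (f d)\<rfloor>} j \<partial>count_space UNIV)"
      proof (rule nn_integral_mono)
        fix j
        show "ennreal (c j) * (ennreal \<bar>vandermonde d\<bar> * indicator (F j) d) \<le> R * indicator {\<lfloor>log 2 (f d)\<rfloor>} j"
        proof (cases "d \<in> F j")
          case True
          hence dE: "d \<in> E" and j: "\<lfloor>log 2 (f d)\<rfloor> = j" by (auto simp: F_def)
          have "ennreal (c j) * ennreal \<bar>vandermonde d\<bar> = ennreal (c j * \<bar>vandermonde d\<bar>)"
            using c0 by (simp add: ennreal_mult)
          also have "\<dots> \<le> ennreal (2 * (f d * \<bar>vandermonde d\<bar>))"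
            using mult_right_mono[OF Fb(2)[OF True], of "\<bar>vandermonde d\<bar>"] by (intro ennreal_leI) (simp add: mult_ac)
          also have "\<dots> = ennreal 2 * ennreal (f d * \<bar>vandermonde d\<bar>)"
            using fpos[OF dE] by (intro ennreal_mult) auto
          finally show ?thesis using True dE j by (simp add: R_def)
        qed simp
      qed
      also have "\<dots> = R" by (simp add: nn_integral_cmult_indicator)
      finally show "(\<integral>\<^sup>+j. ennreal (c j) * (ennreal \<bar>vandermonde d\<bar> * indicator (F j) d) \<partial>count_space UNIV) \<le> R" .
    qed
    also have "\<dots> = ennreal 2 * (\<integral>\<^sup>+d. ennreal (f d * \<bar>vandermonde d\<bar>) * indicator E d \<partial>lborel)"
      by (rule nn_integral_cmult) measurable
    finally have "(\<integral>\<^sup>+V. g V \<partial>sym_lborel) \<le> ennreal C * (ennreal 2 * (\<integral>\<^sup>+d. ennreal (f d * \<bar>vandermonde d\<bar>) * indicator E d \<partial>lborel))"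
      by (simp add: mult_left_mono)
    also have "\<dots> = ennreal (2 * C) * (\<integral>\<^sup>+d. ennreal (f d * \<bar>vandermonde d\<bar>) * indicator E d \<partial>lborel)"
      using C(1) by (simp add: ennreal_mult mult_ac)
    finally show "(\<integral>\<^sup>+V. g V \<partial>sym_lborel) \<le> ennreal (2 * C) * (\<integral>\<^sup>+d. ennreal (f d * \<bar>vandermonde d\<bar>) * indicator E d \<partial>lborel)" .
  qed
qed

section \<open>Gaussian integrals\<close>

lemma nn_integral_gaussian:
  fixes q c :: real
  assumes q: "q > 0"
  shows "(\<integral>\<^sup>+y. ennreal (exp (- (q * (y - c)\<^sup>2) / 2)) \<partial>lborel) = ennreal (sqrt (2 * pi / q))"
proof -
  define \<sigma> where "\<sigma> = 1 / sqrt q"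
  have \<sigma>: "\<sigma> > 0" "\<sigma>\<^sup>2 = 1 / q" using q by (auto simp: \<sigma>_def power_divide)
  have dens: "normal_density c \<sigma> y = exp (- (q * (y - c)\<^sup>2) / 2) / sqrt (2 * pi / q)" for y
    unfolding normal_density_def \<sigma>(2) using q by (simp add: field_simps)
  have "(\<integral>\<^sup>+y. ennreal (normal_density c \<sigma> y) \<partial>lborel) = ennreal (\<integral>y. normal_density c \<sigma> y \<partial>lborel)"
    using \<sigma>(1) by (intro nn_integral_eq_integral integrable_normal_density) auto
  also have "\<dots> = 1" using \<sigma>(1) by (simp add: integral_normal_density)
  finally have 1: "(\<integral>\<^sup>+y. ennreal (normal_density c \<sigma> y) \<partial>lborel) = 1" .
  have s0: "sqrt (2 * pi / q) > 0" using q by simp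
  have "(\<integral>\<^sup>+y. ennreal (exp (- (q * (y - c)\<^sup>2) / 2)) \<partial>lborel) =
        (\<integral>\<^sup>+y. ennreal (sqrt (2 * pi / q)) * ennreal (normal_density c \<sigma> y) \<partial>lborel)"
    using s0 q by (intro nn_integral_cong) (simp add: dens flip: ennreal_mult)
  also have "\<dots> = ennreal (sqrt (2 * pi / q))" by (simp add: nn_integral_cmult 1)
  finally show ?thesis .
qed

lemma matrix_inv_unique_right:
  fixes A B :: "real ^ 'n ^ 'n"
  assumes "A ** B = mat 1"
  shows "matrix_inv A = B"
proof -
  have BA: "B ** A = mat 1" using assms matrix_left_right_inverse by blast
  have "A ** matrix_inv A = mat 1 \<and> matrix_inv A ** A = mat 1"
    unfolding matrix_inv_def by (rule someI[of _ B]) (simp add: assms BA)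
  hence "B = B ** (A ** matrix_inv A)" by simp
  also have "\<dots> = matrix_inv A" by (simp add: matrix_mul_assoc BA)
  finally show ?thesis by simp
qed

lemma conj_diag_ones: "orthogonal_matrix H \<Longrightarrow> conj_diag H (\<chi> i. 1) = mat 1"
proof -
  assume "orthogonal_matrix H"
  moreover have "diag_mat (\<chi> i. 1) = (mat 1 :: 'a sqmat)" by (simp add: diag_mat_def mat_def vec_eq_iff)
  ultimately show ?thesis by (simp add: conj_diag_def orthogonal_matrix_def)
qed

lemma matrix_inv_conj_diag:
  assumes H: "orthogonal_matrix H" and d: "\<And>i. 0 < d $ i"
  shows "matrix_inv (conj_diag H d) = conj_diag H (\<chi> i. 1 / d $ i)"
proof (rule matrix_inv_unique_right)
  have "d $ i \<noteq> 0" for i using d[of i] by simp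
  thus "conj_diag H d ** conj_diag H (\<chi> i. 1 / d $ i) = mat 1"
    by (simp add: conj_diag_mult[OF H] conj_diag_ones[OF H])
qed

lemma orthogonal_transformation_matrix_vec: "orthogonal_matrix (H :: 'k::finite sqmat) \<Longrightarrow> orthogonal_transformation (\<lambda>x. H *v x)"
  unfolding orthogonal_transformation_def
proof (intro conjI allI)
  assume H: "orthogonal_matrix H"
  show "linear (\<lambda>x. H *v x)" by (rule matrix_vector_mul_linear)
  show "(H *v v) \<bullet> (H *v w) = v \<bullet> w" for v w by (rule orthogonal_matrix_inner[OF H])
qed

text \<open>Rotation to an eigenbasis of the covariance leaves Lebesgue measure unchanged and makes
  the Gaussian integrands split into coordinates.\<close>

lemma nn_integral_orthogonal_coords:
  fixes H :: "'k::finite sqmat" and h :: "'k \<Rightarrow> real \<Rightarrow> ennreal"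
  assumes H: "orthogonal_matrix H" and [measurable]: "\<And>i. h i \<in> borel_measurable borel"
  shows "(\<integral>\<^sup>+x. (\<Prod>i\<in>UNIV. h i ((H *v x) $ i)) \<partial>lborel) = (\<Prod>i\<in>UNIV. \<integral>\<^sup>+y. h i y \<partial>lborel)"
proof -
  have "(\<integral>\<^sup>+x. (\<Prod>i\<in>UNIV. h i ((H *v x) $ i)) \<partial>lborel) = (\<integral>\<^sup>+y. (\<Prod>i\<in>UNIV. h i (y $ i)) \<partial>lborel)"
    by (rule nn_integral_lborel_orthogonal[OF orthogonal_transformation_matrix_vec[OF H]]) measurable
  also have "\<dots> = (\<Prod>i\<in>UNIV. \<integral>\<^sup>+y. h i y \<partial>lborel)" by (rule nn_integral_lborel_vec_prod) auto
  finally show ?thesis .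
qed

lemma pos_def_diagonalization:
  assumes "pos_def (V :: 'k::finite sqmat)"
  obtains H d where "orthogonal_matrix H" "V = conj_diag H d" "\<And>i. 0 < d $ i"
proof -
  obtain H d where H: "orthogonal_matrix H" "V = conj_diag H d"
    using symmetric_matrix_diagonalization assms unfolding pos_def_def by (metis conj_diag_def)
  thus ?thesis using that assms pos_def_conj_diag by metis
qed

lemma mvn_density_conj_diag:
  fixes x :: "'k::finite rvec"
  assumes H: "orthogonal_matrix H" and d: "\<And>i. 0 < d $ i"
  shows "mvn_density \<mu> (conj_diag H d) x =
    exp (- (\<Sum>i\<in>UNIV. ((H *v x) $ i - (H *v \<mu>) $ i)\<^sup>2 / d $ i) / 2) / sqrt ((2 * pi) ^ CARD('k) * (\<Prod>i\<in>UNIV. d $ i))"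
proof -
  have "(x - \<mu>) \<bullet> (matrix_inv (conj_diag H d) *v (x - \<mu>)) = (\<Sum>i\<in>UNIV. ((H *v x) $ i - (H *v \<mu>) $ i)\<^sup>2 / d $ i)"
    unfolding matrix_inv_conj_diag[OF assms] conj_diag_quadratic
    by (simp add: matrix_vector_mult_diff_distrib)
  thus ?thesis unfolding mvn_density_def by (simp add: det_conj_diag[OF H])
qed

lemma mvn_density_nonneg: "pos_def \<Sigma> \<Longrightarrow> 0 \<le> mvn_density \<mu> \<Sigma> x"
proof (erule pos_def_diagonalization)
  fix H d assume "orthogonal_matrix H" "\<Sigma> = conj_diag H d" "\<And>i. 0 < d $ i"
  moreover from this(3) have "0 < (\<Prod>i\<in>UNIV. d $ i)" by (intro prod_pos) auto
  ultimately show "0 \<le> mvn_density \<mu> \<Sigma> x" by (simp add: mvn_density_conj_diag)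
qed

lemma nn_integral_mvn_density_finite:
  assumes "pos_def (\<Sigma> :: 'k::finite sqmat)"
  shows "(\<integral>\<^sup>+x. ennreal (mvn_density \<mu> \<Sigma> x) \<partial>lborel) < \<infinity>"
proof -
  obtain H d where H: "orthogonal_matrix H" "\<Sigma> = conj_diag H d" and d: "\<And>i. 0 < d $ i"
    using pos_def_diagonalization[OF assms] by blast
  define K where "K = 1 / sqrt ((2 * pi) ^ CARD('k) * (\<Prod>i\<in>UNIV. d $ i))"
  have "0 < (\<Prod>i\<in>UNIV. d $ i)" using d by (intro prod_pos) auto
  hence K: "K \<ge> 0" by (simp add: K_def)
  have "(\<integral>\<^sup>+x. ennreal (mvn_density \<mu> \<Sigma> x) \<partial>lborel) =
     (\<integral>\<^sup>+x. ennreal K * (\<Prod>i\<in>UNIV. ennreal (exp (- (1 / d $ i * ((H *v x) $ i - (H *v \<mu>) $ i)\<^sup>2) / 2))) \<partial>lborel)"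
  proof (rule nn_integral_cong)
    fix x
    have "mvn_density \<mu> \<Sigma> x = K * exp (\<Sum>i\<in>UNIV. - (1 / d $ i * ((H *v x) $ i - (H *v \<mu>) $ i)\<^sup>2) / 2)"
      unfolding H(2) mvn_density_conj_diag[OF H(1) d] K_def
      by (simp add: sum_negf sum_divide_distrib)
    also have "exp (\<Sum>i\<in>UNIV. - (1 / d $ i * ((H *v x) $ i - (H *v \<mu>) $ i)\<^sup>2) / 2) =
       (\<Prod>i\<in>UNIV. exp (- (1 / d $ i * ((H *v x) $ i - (H *v \<mu>) $ i)\<^sup>2) / 2))"
      by (rule exp_sum) simp
    finally show "ennreal (mvn_density \<mu> \<Sigma> x) = ennreal K * (\<Prod>i\<in>UNIV. ennreal (exp (- (1 / d $ i * ((H *v x) $ i - (H *v \<mu>) $ i)\<^sup>2) / 2)))"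
      using K by (simp add: ennreal_mult prod_ennreal prod_nonneg)
  qed
  also have "\<dots> = ennreal K * (\<integral>\<^sup>+x. (\<Prod>i\<in>UNIV. ennreal (exp (- (1 / d $ i * ((H *v x) $ i - (H *v \<mu>) $ i)\<^sup>2) / 2))) \<partial>lborel)"
  proof (rule nn_integral_cmult)
    have [measurable]: "(\<lambda>x :: 'k rvec. (H *v x) $ i) \<in> borel_measurable borel" for i
      by (intro borel_measurable_continuous_onI continuous_intros linear_continuous_on matrix_vector_mul_bounded_linear)
    show "(\<lambda>x. \<Prod>i\<in>UNIV. ennreal (exp (- (1 / d $ i * ((H *v x) $ i - (H *v \<mu>) $ i)\<^sup>2) / 2))) \<in> borel_measurable lborel"
      by measurable
  qed
  also have "(\<integral>\<^sup>+x. (\<Prod>i\<in>UNIV. ennreal (exp (- (1 / d $ i * ((H *v x) $ i - (H *v \<mu>) $ i)\<^sup>2) / 2))) \<partial>lborel) =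
     (\<Prod>i\<in>UNIV. \<integral>\<^sup>+y. ennreal (exp (- (1 / d $ i * (y - (H *v \<mu>) $ i)\<^sup>2) / 2)) \<partial>lborel)"
    by (rule nn_integral_orthogonal_coords[OF H(1)]) measurable
  also have "\<dots> = (\<Prod>i\<in>UNIV. ennreal (sqrt (2 * pi / (1 / d $ i))))"
    using d by (intro prod.cong refl nn_integral_gaussian) auto
  also have "ennreal K * \<dots> < \<infinity>"
    using d by (subst prod_ennreal) (auto simp: less_imp_le ennreal_mult_less_top)
  finally show ?thesis .
qed

lemma nn_integral_gaussian_mixture:
  fixes u v d :: real
  assumes d: "d > 0"
  shows "(\<integral>\<^sup>+y. ennreal (exp (- ((u - y)\<^sup>2 + (y - v)\<^sup>2 / d) / 2)) \<partial>lborel) =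
     ennreal (exp (- ((u - v)\<^sup>2 / (1 + d)) / 2) * sqrt (2 * pi * d / (1 + d)))"
proof -
  \<comment> \<open>Completing the square: \<open>q\<close> is the sum of the precisions 1 and 1 /
    d, and \<open>c\<close> is the precision-weighted mean of u and v.\<close>
  define q where "q = 1 + 1 / d"
  define c where "c = (u + v / d) / q"
  have q: "q > 0" using d by (simp add: q_def add_pos_pos)
  have sq: "(u - y)\<^sup>2 + (y - v)\<^sup>2 / d = (u - v)\<^sup>2 / (1 + d) + q * (y - c)\<^sup>2" for y
  proof -
    define a b where "a = u - y" and "b = y - v"
    have ab: "u - v = a + b" by (simp add: a_def b_def)
    have qq: "q = (d + 1) / d" using d by (simp add: q_def field_simps)
    have "u + v / d = (d * u + v) / d" using d by (simp add: field_simps)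
    hence cc: "c = (d * u + v) / (d + 1)" using d by (simp add: c_def qq)
    have yc: "y - c = (b - d * a) / (d + 1)"
      using d by (simp add: cc a_def b_def field_simps)
    have "d * (a + b)\<^sup>2 + (b - d * a)\<^sup>2 = (d + 1) * (d * a\<^sup>2 + b\<^sup>2)"
      by (simp add: power2_eq_square algebra_simps)
    hence "(d * (a + b)\<^sup>2 + (b - d * a)\<^sup>2) / (d * (d + 1)) = (d * a\<^sup>2 + b\<^sup>2) / d"
      using d by simp
    moreover have "(d * a\<^sup>2 + b\<^sup>2) / d = a\<^sup>2 + b\<^sup>2 / d" using d by (simp add: add_divide_distrib)
    moreover have "(d * (a + b)\<^sup>2 + (b - d * a)\<^sup>2) / (d * (d + 1)) = (a + b)\<^sup>2 / (1 + d) + (b - d * a)\<^sup>2 / (d * (d + 1))"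
      using d by (simp add: add_divide_distrib add.commute)
    moreover have "q * (y - c)\<^sup>2 = (b - d * a)\<^sup>2 / (d * (d + 1))"
      using d by (simp add: yc qq power_divide power2_eq_square)
    ultimately show ?thesis unfolding ab a_def[symmetric] b_def[symmetric] by simp
  qed
  have "(\<integral>\<^sup>+y. ennreal (exp (- ((u - y)\<^sup>2 + (y - v)\<^sup>2 / d) / 2)) \<partial>lborel) =
     (\<integral>\<^sup>+y. ennreal (exp (- ((u - v)\<^sup>2 / (1 + d)) / 2)) * ennreal (exp (- (q * (y - c)\<^sup>2) / 2)) \<partial>lborel)"
  proof (rule nn_integral_cong)
    have ex: "exp (- (X + Y) / 2) = exp (- X / 2) * exp (- Y / 2)" for X Y :: real
      by (simp add: exp_add[symmetric] add_divide_distrib diff_divide_distrib)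
    fix y
    show "ennreal (exp (- ((u - y)\<^sup>2 + (y - v)\<^sup>2 / d) / 2)) =
       ennreal (exp (- ((u - v)\<^sup>2 / (1 + d)) / 2)) * ennreal (exp (- (q * (y - c)\<^sup>2) / 2))"
      unfolding sq ex by (rule ennreal_mult) auto
  qed
  also have "\<dots> = ennreal (exp (- ((u - v)\<^sup>2 / (1 + d)) / 2)) * ennreal (sqrt (2 * pi / q))"
    by (subst nn_integral_cmult) (simp_all only: nn_integral_gaussian[OF q], measurable)
  also have "2 * pi / q = 2 * pi * d / (1 + d)" using d by (simp add: q_def field_simps)
  finally show ?thesis using d by (simp add: ennreal_mult)
qed

lemma mvn_density_identity:
  fixes x :: "'k::finite rvec"
  assumes H: "orthogonal_matrix H"
  shows "mvn_density \<mu> (mat 1) x = exp (- (\<Sum>i\<in>UNIV. ((H *v x) $ i - (H *v \<mu>) $ i)\<^sup>2) / 2) / sqrt ((2 * pi) ^ CARD('k))"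
  using mvn_density_conj_diag[OF H, of "\<chi> i. 1" \<mu> x] by (simp add: conj_diag_ones[OF H])

lemma sqrt_prod: "sqrt (\<Prod>i\<in>A. f i) = (\<Prod>i\<in>A. sqrt (f i))"
  by (induction A rule: infinite_finite_induct) (auto simp: real_sqrt_mult)

text \<open>The convolution of two Gaussians: given \<beta> and V, a block of the data has the law
  N(\<beta>, I + V). The density appears in the coordinates of an eigenbasis of V.\<close>

lemma block_integral:
  fixes x \<beta> :: "'k::finite rvec"
  assumes H: "orthogonal_matrix H" and d: "\<And>i. 0 < d $ i"
  shows "(\<integral>\<^sup>+\<theta>. ennreal (mvn_density \<theta> (mat 1) x * mvn_density \<beta> (conj_diag H d) \<theta>) \<partial>lborel) =
    ennreal (exp (- (\<Sum>i\<in>UNIV. ((H *v x) $ i - (H *v \<beta>) $ i)\<^sup>2 / (1 + d $ i)) / 2) /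
      (sqrt ((2 * pi) ^ CARD('k)) * sqrt (\<Prod>i\<in>UNIV. 1 + d $ i)))"
proof -
  define u v where "u = H *v x" and "v = H *v \<beta>"
  define T where "T = sqrt ((2 * pi) ^ CARD('k))"
  define K where "K = 1 / (T * (T * sqrt (\<Prod>i\<in>UNIV. d $ i)))"
  have T: "T > 0" by (simp add: T_def)
  have pd: "(\<Prod>i\<in>UNIV. d $ i) > 0" "(\<Prod>i\<in>UNIV. 1 + d $ i) > 0" using d by (auto intro!: prod_pos add_pos_pos)
  have K: "K \<ge> 0" using T pd by (simp add: K_def)
  let ?e = "\<lambda>i y. exp (- ((u $ i - y)\<^sup>2 + (y - v $ i)\<^sup>2 / d $ i) / 2)"
  have "(\<integral>\<^sup>+\<theta>. ennreal (mvn_density \<theta> (mat 1) x * mvn_density \<beta> (conj_diag H d) \<theta>) \<partial>lborel) =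
     (\<integral>\<^sup>+\<theta>. ennreal K * (\<Prod>i\<in>UNIV. ennreal (?e i ((H *v \<theta>) $ i))) \<partial>lborel)"
  proof (rule nn_integral_cong)
    fix \<theta> :: "'k rvec"
    have "mvn_density \<theta> (mat 1) x * mvn_density \<beta> (conj_diag H d) \<theta> =
       K * (exp (- (\<Sum>i\<in>UNIV. (u $ i - (H *v \<theta>) $ i)\<^sup>2) / 2) * exp (- (\<Sum>i\<in>UNIV. ((H *v \<theta>) $ i - v $ i)\<^sup>2 / d $ i) / 2))"
      unfolding mvn_density_identity[OF H] mvn_density_conj_diag[OF H d] K_def u_def v_def T_def
      by (simp add: real_sqrt_mult)
    also have "exp (- (\<Sum>i\<in>UNIV. (u $ i - (H *v \<theta>) $ i)\<^sup>2) / 2) * exp (- (\<Sum>i\<in>UNIV. ((H *v \<theta>) $ i - v $ i)\<^sup>2 / d $ i) / 2)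
       = exp (\<Sum>i\<in>UNIV. - ((u $ i - (H *v \<theta>) $ i)\<^sup>2 + ((H *v \<theta>) $ i - v $ i)\<^sup>2 / d $ i) / 2)"
      by (simp add: exp_add[symmetric] sum_divide_distrib sum_negf sum.distrib add_divide_distrib diff_divide_distrib sum_subtractf)
    also have "\<dots> = (\<Prod>i\<in>UNIV. ?e i ((H *v \<theta>) $ i))" by (rule exp_sum) simp
    finally show "ennreal (mvn_density \<theta> (mat 1) x * mvn_density \<beta> (conj_diag H d) \<theta>) = 
       ennreal K * (\<Prod>i\<in>UNIV. ennreal (?e i ((H *v \<theta>) $ i)))"
      using K by (simp add: ennreal_mult prod_ennreal prod_nonneg)
  qed
  also have "\<dots> = ennreal K * (\<integral>\<^sup>+\<theta>. (\<Prod>i\<in>UNIV. ennreal (?e i ((H *v \<theta>) $ i))) \<partial>lborel)"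
  proof (rule nn_integral_cmult)
    have [measurable]: "(\<lambda>x :: 'k rvec. (H *v x) $ i) \<in> borel_measurable borel" for i
      by (intro borel_measurable_continuous_onI continuous_intros linear_continuous_on matrix_vector_mul_bounded_linear)
    show "(\<lambda>\<theta>. \<Prod>i\<in>UNIV. ennreal (?e i ((H *v \<theta>) $ i))) \<in> borel_measurable lborel" by measurable
  qed
  also have "(\<integral>\<^sup>+\<theta>. (\<Prod>i\<in>UNIV. ennreal (?e i ((H *v \<theta>) $ i))) \<partial>lborel) = (\<Prod>i\<in>UNIV. \<integral>\<^sup>+y. ennreal (?e i y) \<partial>lborel)"
    by (rule nn_integral_orthogonal_coords[OF H]) measurable
  also have "\<dots> = (\<Prod>i\<in>UNIV. ennreal (exp (- ((u $ i - v $ i)\<^sup>2 / (1 + d $ i)) / 2) * sqrt (2 * pi * d $ i / (1 + d $ i))))"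
    using d by (intro prod.cong refl nn_integral_gaussian_mixture)
  also have "\<dots> = ennreal (\<Prod>i\<in>UNIV. exp (- ((u $ i - v $ i)\<^sup>2 / (1 + d $ i)) / 2) * sqrt (2 * pi * d $ i / (1 + d $ i)))"
    using d by (intro prod_ennreal) (simp add: less_imp_le add_nonneg_nonneg)
  also have "(\<Prod>i\<in>UNIV. exp (- ((u $ i - v $ i)\<^sup>2 / (1 + d $ i)) / 2) * sqrt (2 * pi * d $ i / (1 + d $ i))) =
     exp (\<Sum>i\<in>UNIV. - ((u $ i - v $ i)\<^sup>2 / (1 + d $ i)) / 2) * (\<Prod>i\<in>UNIV. sqrt (2 * pi * d $ i / (1 + d $ i)))"
    by (simp add: prod.distrib exp_sum)
  also have "(\<Prod>i\<in>UNIV. sqrt (2 * pi * d $ i / (1 + d $ i))) = T * sqrt (\<Prod>i\<in>UNIV. d $ i) / sqrt (\<Prod>i\<in>UNIV. 1 + d $ i)"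
    unfolding T_def
    by (simp add: sqrt_prod real_sqrt_mult real_sqrt_divide prod.distrib prod_dividef real_sqrt_power power_mult_distrib)
  also have "(\<Sum>i\<in>UNIV. - ((u $ i - v $ i)\<^sup>2 / (1 + d $ i)) / 2) = - (\<Sum>i\<in>UNIV. (u $ i - v $ i)\<^sup>2 / (1 + d $ i)) / 2"
    by (simp add: sum_negf sum_divide_distrib)
  also have "ennreal K * ennreal (exp (- (\<Sum>i\<in>UNIV. (u $ i - v $ i)\<^sup>2 / (1 + d $ i)) / 2) * (T * sqrt (\<Prod>i\<in>UNIV. d $ i) / sqrt (\<Prod>i\<in>UNIV. 1 + d $ i)))
     = ennreal (exp (- (\<Sum>i\<in>UNIV. (u $ i - v $ i)\<^sup>2 / (1 + d $ i)) / 2) / (T * sqrt (\<Prod>i\<in>UNIV. 1 + d $ i)))"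
  proof -
    have "sqrt (\<Prod>i\<in>UNIV. d $ i) > 0" by (rule real_sqrt_gt_zero[OF pd(1)])
    hence "sqrt (\<Prod>i\<in>UNIV. d $ i) \<noteq> 0" "T \<noteq> 0" using T by linarith+
    thus ?thesis using K T pd by (simp add: K_def field_simps flip: ennreal_mult)
  qed
  finally show ?thesis by (simp add: u_def v_def T_def)
qed

text \<open>The eigenvalues of I + V are at least 1, so the quadratic form in the exponent lies
  between 0 and the squared distance. Both ends are free of V, which then survives only in the
  determinant.\<close>

lemma theta_integral_bounds:
  fixes x :: "'k::finite rvec ^ 'm::finite"
  assumes V: "pos_def V"
  defines "K \<equiv> (1 / sqrt ((2 * pi) ^ CARD('k))) ^ CARD('m)"
  shows "ennreal (K * exp (- (\<Sum>i\<in>UNIV. (norm (x $ i - \<beta>))\<^sup>2) / 2) * det (mat 1 + V) powr (- real CARD('m) / 2))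
      \<le> (\<integral>\<^sup>+\<theta>. ennreal (likelihood x \<theta> * theta_density \<theta> \<beta> V) \<partial>lborel)" (is ?lower)
    and "(\<integral>\<^sup>+\<theta>. ennreal (likelihood x \<theta> * theta_density \<theta> \<beta> V) \<partial>lborel)
      \<le> ennreal (K * det (mat 1 + V) powr (- real CARD('m) / 2))" (is ?upper)
proof -
  obtain H d where H: "orthogonal_matrix H" "V = conj_diag H d" and d: "\<And>i. 0 < d $ i"
    using pos_def_diagonalization[OF V] by blast
  define D where "D = det (mat 1 + V)"
  have D: "D = (\<Prod>i\<in>UNIV. 1 + d $ i)" unfolding D_def H(2) mat1_plus_conj_diag[OF H(1)] det_conj_diag[OF H(1)] by simp
  have D0: "D > 0" unfolding D using d by (intro prod_pos) (auto intro: add_pos_pos)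
  define T where "T = sqrt ((2 * pi) ^ CARD('k))"
  have T: "T > 0" by (simp add: T_def)
  define S where "S i = (\<Sum>j\<in>UNIV. ((H *v (x $ i)) $ j - (H *v \<beta>) $ j)\<^sup>2 / (1 + d $ j))" for i
  have S0: "S i \<ge> 0" for i unfolding S_def
    by (intro sum_nonneg divide_nonneg_nonneg zero_le_power2 less_imp_le[OF add_pos_pos[OF zero_less_one d]])
  have S1: "S i \<le> (norm (x $ i - \<beta>))\<^sup>2" for i
  proof -
    have "S i \<le> (\<Sum>j\<in>UNIV. ((H *v (x $ i)) $ j - (H *v \<beta>) $ j)\<^sup>2)"
      unfolding S_def
    proof (rule sum_mono)
      fix j show "((H *v (x $ i)) $ j - (H *v \<beta>) $ j)\<^sup>2 / (1 + d $ j) \<le> ((H *v (x $ i)) $ j - (H *v \<beta>) $ j)\<^sup>2"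
        using d[of j] by (simp add: divide_le_eq mult_le_cancel_left1 not_less add_pos_pos mult_right_mono distrib_left)
    qed
    also have "\<dots> = (\<Sum>j\<in>UNIV. ((H *v (x $ i - \<beta>)) $ j)\<^sup>2)" by (simp add: matrix_vector_mult_diff_distrib)
    also have "\<dots> = (norm (x $ i - \<beta>))\<^sup>2" by (simp add: orthogonal_matrix_sum_squares[OF H(1)] power2_norm_eq_inner)
    finally show ?thesis .
  qed
  have meas [measurable]: "(\<lambda>\<theta>. mvn_density \<theta> (mat 1) y * mvn_density \<beta> V \<theta>) \<in> borel_measurable borel" for y
    unfolding H(2) mvn_density_identity[OF H(1)] mvn_density_conj_diag[OF H(1) d]
    by (intro borel_measurable_continuous_onI continuous_intros linear_continuous_on matrix_vector_mul_bounded_linear)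
       (use d in \<open>auto simp: less_imp_neq[symmetric]\<close>)
  have nn: "0 \<le> mvn_density \<theta> (mat 1) y * mvn_density \<beta> V \<theta>" for y \<theta>
    using mvn_density_nonneg[OF V, of \<beta> \<theta>] by (intro mult_nonneg_nonneg) (simp_all add: mvn_density_identity[OF H(1)])
  have "(\<integral>\<^sup>+\<theta>. ennreal (likelihood x \<theta> * theta_density \<theta> \<beta> V) \<partial>lborel) =
     (\<integral>\<^sup>+\<theta>. (\<Prod>i\<in>UNIV. ennreal (mvn_density (\<theta> $ i) (mat 1) (x $ i) * mvn_density \<beta> V (\<theta> $ i))) \<partial>lborel)"
    unfolding likelihood_def theta_density_def prod.distrib[symmetric]
    by (intro nn_integral_cong prod_ennreal[symmetric] nn)
  also have "\<dots> = (\<Prod>i\<in>UNIV. \<integral>\<^sup>+\<theta>. ennreal (mvn_density \<theta> (mat 1) (x $ i) * mvn_density \<beta> V \<theta>) \<partial>lborel)"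
    by (rule nn_integral_lborel_vec_prod) measurable
  also have "\<dots> = (\<Prod>i\<in>UNIV. ennreal (exp (- S i / 2) / (T * sqrt D)))"
    unfolding H(2) block_integral[OF H(1) d] S_def T_def D ..
  also have "\<dots> = ennreal (\<Prod>i\<in>UNIV. exp (- S i / 2) / (T * sqrt D))"
    using T D0 by (intro prod_ennreal) auto
  also have "(\<Prod>i\<in>UNIV. exp (- S i / 2) / (T * sqrt D)) = exp (- (\<Sum>i\<in>UNIV. S i) / 2) * (1 / (T * sqrt D)) ^ CARD('m)"
  proof -
    have "(\<Prod>i\<in>UNIV. exp (- S i / 2) / (T * sqrt D)) = (\<Prod>i\<in>UNIV. exp (- S i / 2)) / (T * sqrt D) ^ CARD('m)"
      by (simp add: prod_dividef)
    also have "(\<Prod>i\<in>UNIV. exp (- S i / 2)) = exp (\<Sum>i\<in>UNIV. - S i / 2)" by (rule exp_sum[symmetric]) simp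
    also have "(\<Sum>i\<in>UNIV. - S i / 2) = - (\<Sum>i\<in>UNIV. S i) / 2" by (simp add: sum_negf sum_divide_distrib)
    finally show ?thesis by (simp add: power_divide)
  qed
  also have "(1 / (T * sqrt D)) ^ CARD('m) = K * D powr (- real CARD('m) / 2)"
  proof -
    have "(sqrt D) ^ CARD('m) = (D powr (1 / 2)) powr real CARD('m)"
      using D0 by (simp add: powr_half_sqrt powr_realpow)
    also have "\<dots> = D powr (real CARD('m) / 2)" by (simp add: powr_powr)
    finally have "1 / (sqrt D) ^ CARD('m) = D powr (- real CARD('m) / 2)"
      by (simp add: powr_minus_divide)
    moreover have "(1 / (T * sqrt D)) ^ CARD('m) = (1 / T) ^ CARD('m) * (1 / (sqrt D) ^ CARD('m))"
      by (simp add: power_divide power_mult_distrib)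
    ultimately show ?thesis by (simp only: K_def T_def)
  qed
  finally have eq: "(\<integral>\<^sup>+\<theta>. ennreal (likelihood x \<theta> * theta_density \<theta> \<beta> V) \<partial>lborel) =
     ennreal (exp (- (\<Sum>i\<in>UNIV. S i) / 2) * (K * D powr (- real CARD('m) / 2)))" .
  have K0: "K \<ge> 0" by (simp add: K_def)
  have KD: "K * D powr (- real CARD('m) / 2) \<ge> 0" using K0 by simp
  show ?lower unfolding eq D_def[symmetric]
  proof (rule ennreal_leI)
    have "exp (- (\<Sum>i\<in>UNIV. (norm (x $ i - \<beta>))\<^sup>2) / 2) \<le> exp (- (\<Sum>i\<in>UNIV. S i) / 2)"
      using sum_mono[of UNIV S, OF S1] by simp
    from mult_right_mono[OF this KD]
    show "K * exp (- (\<Sum>i\<in>UNIV. (norm (x $ i - \<beta>))\<^sup>2) / 2) * D powr (- real CARD('m) / 2)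
       \<le> exp (- (\<Sum>i\<in>UNIV. S i) / 2) * (K * D powr (- real CARD('m) / 2))"
      by (simp add: mult_ac)
  qed
  show ?upper unfolding eq D_def[symmetric]
  proof (rule ennreal_leI)
    have "exp (- (\<Sum>i\<in>UNIV. S i) / 2) \<le> 1" using sum_nonneg[of UNIV S] S0 by simp
    from mult_right_mono[OF this KD]
    show "exp (- (\<Sum>i\<in>UNIV. S i) / 2) * (K * D powr (- real CARD('m) / 2)) \<le> K * D powr (- real CARD('m) / 2)" by simp
  qed
qed

section \<open>The marginal density\<close>

lemma borel_measurable_det [measurable (raw)]:
  fixes F :: "'a \<Rightarrow> real ^ 'n ^ 'n"
  assumes [measurable]: "\<And>i j. (\<lambda>w. F w $ i $ j) \<in> borel_measurable N"
  shows "(\<lambda>w. det (F w)) \<in> borel_measurable N"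
  unfolding det_def by measurable

lemma closed_quadratic_bound: "closed {V :: 'k::finite sqmat. \<forall>x. c * (x \<bullet> x) \<le> x \<bullet> (V *v x)}"
proof -
  have "{V :: 'k sqmat. \<forall>x. c * (x \<bullet> x) \<le> x \<bullet> (V *v x)} = (\<Inter>x. {V. c * (x \<bullet> x) \<le> x \<bullet> (V *v x)})" by auto
  also have "closed \<dots>"
    unfolding inner_vec_def matrix_vector_mult_def
    by (intro closed_INT ballI closed_Collect_le continuous_intros)
  finally show ?thesis .
qed

text \<open>The condition ranges over uncountably many vectors. Strengthening positivity to a lower
  bound by a multiple 1 / (n + 1) of the square norm makes each stage closed, and the smallest
  eigenvalue supplies n.\<close>

lemma pos_def_measurable [measurable]: "{V :: 'k::{finite,linorder} sqmat. pos_def V} \<in> sets borel"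
proof -
  have "{V :: 'k sqmat. pos_def V} =
    {V. transpose V = V} \<inter> (\<Union>n. {V. \<forall>x. 1 / real (Suc n) * (x \<bullet> x) \<le> x \<bullet> (V *v x)})" (is "?L = ?R")
  proof (intro equalityI subsetI)
    fix V :: "'k sqmat" assume "V \<in> ?L"
    hence pd: "pos_def V" by simp
    obtain H d where H: "orthogonal_matrix H" "V = conj_diag H d" and d: "\<And>i. 0 < d $ i"
      using pos_def_diagonalization[OF pd] by blast
    define e where "e = Min (range (($) d))"
    have "e \<in> range (($) d)" unfolding e_def by (rule Min_in) auto
    hence e0: "e > 0" using d by auto
    have ed: "e \<le> d $ i" for i unfolding e_def by (rule Min_le) auto
    obtain n where n: "1 / real (Suc n) < e" using nat_approx_posE[OF e0] by blast
    have "1 / real (Suc n) * (x \<bullet> x) \<le> x \<bullet> (V *v x)" for x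
    proof -
      have "1 / real (Suc n) * (x \<bullet> x) = (\<Sum>i\<in>UNIV. 1 / real (Suc n) * ((H *v x) $ i)\<^sup>2)"
        by (simp only: sum_distrib_left[symmetric] orthogonal_matrix_sum_squares[OF H(1)])
      also have "\<dots> \<le> (\<Sum>i\<in>UNIV. d $ i * ((H *v x) $ i)\<^sup>2)"
        using n ed by (intro sum_mono mult_right_mono) (auto intro: order_trans[OF less_imp_le])
      finally show ?thesis by (simp add: H(2) conj_diag_quadratic)
    qed
    thus "V \<in> ?R" using pd unfolding pos_def_def by blast
  next
    fix V :: "'k sqmat" assume "V \<in> ?R"
    then obtain n where V: "transpose V = V" "\<And>x. 1 / real (Suc n) * (x \<bullet> x) \<le> x \<bullet> (V *v x)" by blast
    have "0 < x \<bullet> (V *v x)" if "x \<noteq> 0" for x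
    proof -
      have "0 < 1 / real (Suc n) * (x \<bullet> x)" using that by simp
      also have "\<dots> \<le> x \<bullet> (V *v x)" by (rule V(2))
      finally show ?thesis .
    qed
    thus "V \<in> ?L" using V(1) by (simp add: pos_def_def)
  qed
  also have "?R \<in> sets borel"
    by (intro sets.Int sets_symmetric sets.countable_UN image_subsetI borel_closed closed_quadratic_bound)
  finally show ?thesis .
qed

text \<open>Cramer's rule makes the inverse covariance matrix visibly measurable.\<close>

definition cramer_solve :: "real ^ 'k ^ 'k \<Rightarrow> real ^ 'k \<Rightarrow> real ^ 'k" where
  "cramer_solve V y = (\<chi> k. det (\<chi> i j. if j = k then y $ i else V $ i $ j) / det V)"

lemma matrix_inv_cramer:
  assumes "det V \<noteq> 0"
  shows "matrix_inv V *v y = cramer_solve V y"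
proof -
  obtain B where "V ** B = mat 1" using assms invertible_det_nz unfolding invertible_def by blast
  hence inv: "V ** matrix_inv V = mat 1" using matrix_inv_unique_right by metis
  have "V *v (matrix_inv V *v y) = y" by (simp add: matrix_vector_mul_assoc inv)
  thus ?thesis using cramer[OF assms, of "matrix_inv V *v y" y] by (simp add: cramer_solve_def)
qed

lemma pos_def_det_pos: "pos_def (V :: 'k::finite sqmat) \<Longrightarrow> 0 < det V"
  by (erule pos_def_diagonalization) (auto simp: det_conj_diag intro!: prod_pos)

lemma mvn_density_cramer:
  assumes "pos_def (V :: 'k::finite sqmat)"
  shows "mvn_density \<beta> V t =
    exp (- (\<Sum>i\<in>UNIV. (t $ i - \<beta> $ i) * (cramer_solve V (t - \<beta>)) $ i) / 2) / sqrt ((2 * pi) ^ CARD('k) * det V)"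
  using pos_def_det_pos[OF assms] unfolding mvn_density_def by (subst matrix_inv_cramer) (auto simp: inner_vec_def)

lemma continuous_mvn_density:
  assumes "pos_def (\<Sigma> :: 'k::finite sqmat)"
  shows "continuous_on UNIV (mvn_density \<mu> \<Sigma>)"
proof -
  obtain H d where H: "orthogonal_matrix H" "\<Sigma> = conj_diag H d" and d: "\<And>i. 0 < d $ i"
    using pos_def_diagonalization[OF assms] by blast
  have pd: "0 < (\<Prod>i\<in>UNIV. d $ i)" using d by (intro prod_pos) auto
  have "sqrt ((2 * pi) ^ CARD('k) * (\<Prod>i\<in>UNIV. d $ i)) > 0"
    by (intro real_sqrt_gt_zero mult_pos_pos pd) simp
  moreover have "d $ i \<noteq> 0" for i using d[of i] by simp
  ultimately show ?thesis
    unfolding H(2) mvn_density_conj_diag[OF H(1) d, abs_def]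
    by (intro continuous_intros linear_continuous_on matrix_vector_mul_bounded_linear) auto
qed

lemma pos_def_mat1: "pos_def (mat 1 :: 'k::finite sqmat)"
  by (auto simp: pos_def_def transpose_mat)

lemma likelihood_nonneg: "0 \<le> likelihood x \<theta>"
  unfolding likelihood_def by (intro prod_nonneg mvn_density_nonneg pos_def_mat1)

lemma theta_density_nonneg: "pos_def V \<Longrightarrow> 0 \<le> theta_density \<theta> \<beta> V"
  unfolding theta_density_def by (intro prod_nonneg mvn_density_nonneg)

text \<open>The constants depend on the data and on \<open>A\<close> but not on V, so positivity and
  finiteness of the marginal density become those of \<open>J\<close>, in which the data no longer
  occur.\<close>

theorem marginal_bounds:
  fixes A :: "'k::{finite,linorder} sqmat" and x :: "'k rvec ^ 'm::finite"
  assumes A: "pos_def A" and prior: "prior_V \<pi>V"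
  defines "J \<equiv> (\<integral>\<^sup>+V. ennreal (det (mat 1 + V) powr (- real CARD('m) / 2)) * (ennreal (\<pi>V V) * indicator {V. pos_def V} V) \<partial>sym_lborel)"
  obtains c1 c2 :: ennreal where "0 < c1" "c2 < \<infinity>" "c1 * J \<le> marginal (mvn_density 0 A) \<pi>V x"
    "marginal (mvn_density 0 A) \<pi>V x \<le> c2 * J"
proof -
  interpret sym: sigma_finite_measure "sym_lborel :: 'k sqmat measure" by (rule sigma_finite_sym_lborel)
  interpret bV: pair_sigma_finite "lborel :: 'k rvec measure" "sym_lborel :: 'k sqmat measure" ..
  interpret tV: pair_sigma_finite "lborel :: ('k rvec ^ 'm) measure" "sym_lborel :: 'k sqmat measure" ..
  define \<pi>b where "\<pi>b = mvn_density 0 A"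
  have [measurable]: "\<pi>b \<in> borel_measurable borel"
    unfolding \<pi>b_def by (intro borel_measurable_continuous_onI continuous_mvn_density A)
  have \<pi>b0: "0 \<le> \<pi>b \<beta>" for \<beta> unfolding \<pi>b_def by (rule mvn_density_nonneg[OF A])
  \<comment> \<open>The prior is measurable only on the positive-definite cone; multiplication by
    the indicator extends it by 0 to a measurable function on all matrices.\<close>
  define p where "p V = ennreal (\<pi>V V) * indicator {V. pos_def V} V" for V
  have [measurable]: "p \<in> borel_measurable borel"
  proof -
    have [measurable]: "\<pi>V \<in> borel_measurable (restrict_space borel {V. pos_def V})" using prior by (simp add: prior_V_def)
    have "(\<lambda>V. ennreal (\<pi>V V)) \<in> borel_measurable (restrict_space borel {V. pos_def V})" by measurable
    thus ?thesis unfolding p_def[abs_def] by (subst (asm) borel_measurable_restrict_space_iff_ennreal) auto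
  qed
  define l where "l \<theta> = ennreal (likelihood x \<theta>)" for \<theta>
  have [measurable]: "l \<in> borel_measurable borel"
  proof -
    have "(\<lambda>t. mvn_density t (mat 1) y) = (\<lambda>t. mvn_density y (mat 1) t)" for y :: "'k rvec"
      unfolding mvn_density_identity[OF orthogonal_matrix_id] by (simp add: power2_commute)
    hence "continuous_on UNIV (\<lambda>t. mvn_density t (mat 1) y)" for y :: "'k rvec"
      using continuous_mvn_density[OF pos_def_mat1] by metis
    hence [measurable]: "(\<lambda>t. mvn_density t (mat 1) y) \<in> borel_measurable borel" for y :: "'k rvec"
      by (rule borel_measurable_continuous_onI)
    show ?thesis unfolding l_def[abs_def] likelihood_def by measurable
  qed
  \<comment> \<open>Fubini needs joint measurability in \<theta>, \<beta> and V. \<open>t\<close> is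
    built from determinants, hence measurable everywhere, and agrees with
    \<open>theta_density\<close> on the positive-definite matrices.\<close>
  define t where "t \<theta> \<beta> V = (\<Prod>i\<in>UNIV. exp (- (\<Sum>j\<in>UNIV. (\<theta> $ i $ j - \<beta> $ j) * (cramer_solve V (\<theta> $ i - \<beta>)) $ j) / 2) / sqrt ((2 * pi) ^ CARD('k) * det V))"
    for \<theta> :: "'k rvec ^ 'm" and \<beta> :: "'k rvec" and V :: "'k sqmat"
  have t: "t \<theta> \<beta> V = theta_density \<theta> \<beta> V" if "pos_def V" for \<theta> \<beta> V
    unfolding t_def theta_density_def using that by (simp add: mvn_density_cramer)
  have t_meas [measurable (raw)]: "(\<lambda>w. t (f w) (g w) (h w)) \<in> borel_measurable N"
    if [measurable]: "f \<in> borel_measurable N" "g \<in> borel_measurable N" "h \<in> borel_measurable N" for f g h and N :: "'z measure"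
  proof -
    have [measurable]: "(\<lambda>w. (if j = k then (f w $ i - g w) $ i' else h w $ i' $ j)) \<in> borel_measurable N" for i i' j k
      by (cases "j = k") (simp_all, measurable)
    have [measurable]: "(\<lambda>w. det (\<chi> i' j. if j = k then (f w $ i - g w) $ i' else h w $ i' $ j)) \<in> borel_measurable N" for i k
      by (rule borel_measurable_det) simp
    show ?thesis unfolding t_def cramer_solve_def vec_lambda_beta by measurable
  qed
  define F where "F \<theta> \<beta> V = l \<theta> * ennreal (t \<theta> \<beta> V) * ennreal (\<pi>b \<beta>) * p V" for \<theta> \<beta> V
  have F_meas [measurable (raw)]: "(\<lambda>w. F (f w) (g w) (h w)) \<in> borel_measurable N"
    if [measurable]: "f \<in> borel_measurable N" "g \<in> borel_measurable N" "h \<in> borel_measurable N" for f g h and N :: "'z measure"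
    unfolding F_def by measurable
  have eqF: "ennreal (likelihood x \<theta> * theta_density \<theta> \<beta> V * \<pi>b \<beta> * \<pi>V V) * indicator {V. pos_def V} V = F \<theta> \<beta> V" for \<theta> \<beta> V
  proof (cases "pos_def V")
    case True
    have "0 \<le> \<pi>V V" using True prior by (simp add: prior_V_def)
    thus ?thesis using True theta_density_nonneg[OF True, of \<theta> \<beta>] likelihood_nonneg[of x \<theta>] \<pi>b0[of \<beta>]
      by (simp add: F_def p_def l_def t ennreal_mult)
  qed (simp add: F_def p_def)
  have marg: "marginal \<pi>b \<pi>V x = (\<integral>\<^sup>+\<theta>. (\<integral>\<^sup>+\<beta>. (\<integral>\<^sup>+V. F \<theta> \<beta> V \<partial>sym_lborel) \<partial>lborel) \<partial>lborel)"
    unfolding marginal_def eqF ..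
  \<comment> \<open>Three exchanges move V outermost and \<theta> innermost, so that the Gaussian
    integral can be carried out at fixed \<beta> and V.\<close>
  also have "\<dots> = (\<integral>\<^sup>+\<theta>. (\<integral>\<^sup>+V. (\<integral>\<^sup>+\<beta>. F \<theta> \<beta> V \<partial>lborel) \<partial>sym_lborel) \<partial>lborel)"
    by (intro nn_integral_cong bV.Fubini'[symmetric]) measurable
  also have "\<dots> = (\<integral>\<^sup>+V. (\<integral>\<^sup>+\<theta>. (\<integral>\<^sup>+\<beta>. F \<theta> \<beta> V \<partial>lborel) \<partial>lborel) \<partial>sym_lborel)"
    by (intro tV.Fubini'[symmetric]) measurable
  also have "\<dots> = (\<integral>\<^sup>+V. (\<integral>\<^sup>+\<beta>. (\<integral>\<^sup>+\<theta>. F \<theta> \<beta> V \<partial>lborel) \<partial>lborel) \<partial>sym_lborel)"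
    by (intro nn_integral_cong lborel_pair.Fubini'[symmetric]) measurable
  also have "\<dots> = (\<integral>\<^sup>+V. (\<integral>\<^sup>+\<beta>. (\<integral>\<^sup>+\<theta>. ennreal (likelihood x \<theta> * theta_density \<theta> \<beta> V) \<partial>lborel) * ennreal (\<pi>b \<beta>) \<partial>lborel) * p V \<partial>sym_lborel)"
  proof (rule nn_integral_cong)
    fix V :: "'k sqmat"
    show "(\<integral>\<^sup>+\<beta>. (\<integral>\<^sup>+\<theta>. F \<theta> \<beta> V \<partial>lborel) \<partial>lborel) =
       (\<integral>\<^sup>+\<beta>. (\<integral>\<^sup>+\<theta>. ennreal (likelihood x \<theta> * theta_density \<theta> \<beta> V) \<partial>lborel) * ennreal (\<pi>b \<beta>) \<partial>lborel) * p V"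
    proof (cases "pos_def V")
      case True
      have e: "ennreal (likelihood x \<theta> * theta_density \<theta> \<beta> V) = l \<theta> * ennreal (t \<theta> \<beta> V)" for \<theta> \<beta>
        using likelihood_nonneg[of x \<theta>] theta_density_nonneg[OF True, of \<theta> \<beta>] by (simp add: l_def t[OF True] ennreal_mult)
      have "(\<integral>\<^sup>+\<theta>. F \<theta> \<beta> V \<partial>lborel) = (\<integral>\<^sup>+\<theta>. l \<theta> * ennreal (t \<theta> \<beta> V) \<partial>lborel) * ennreal (\<pi>b \<beta>) * p V" for \<beta>
        unfolding F_def by (subst nn_integral_multc, measurable)+
      thus ?thesis unfolding e by (simp add: nn_integral_multc)
    qed (simp add: F_def p_def)
  qed
  finally have marg2: "marginal \<pi>b \<pi>V x = \<dots>" .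
  define K where "K = (1 / sqrt ((2 * pi) ^ CARD('k))) ^ CARD('m)"
  have K: "K > 0" by (simp add: K_def)
  define G where "G \<beta> = ennreal (K * exp (- (\<Sum>i\<in>UNIV. (norm (x $ i - \<beta>))\<^sup>2) / 2)) * ennreal (\<pi>b \<beta>)" for \<beta>
  \<comment> \<open>\<open>c1\<close> is positive because the normal density of \<beta> vanishes
    nowhere; \<open>c2\<close> is finite because that density has finite mass.\<close>
  define c1 where "c1 = (\<integral>\<^sup>+\<beta>. G \<beta> \<partial>lborel)"
  define c2 where "c2 = ennreal K * (\<integral>\<^sup>+\<beta>. ennreal (\<pi>b \<beta>) \<partial>lborel)"
  let ?D = "\<lambda>V :: 'k sqmat. det (mat 1 + V) powr (- real CARD('m) / 2)"
  have [measurable]: "(\<lambda>V :: 'k sqmat. ?D V) \<in> borel_measurable borel"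
  proof -
    have "(\<lambda>V :: 'k sqmat. det (mat 1 + V)) \<in> borel_measurable borel" by (rule borel_measurable_det) simp
    thus ?thesis by measurable
  qed
  have [measurable]: "G \<in> borel_measurable borel" unfolding G_def[abs_def] by measurable
  have J: "J = (\<integral>\<^sup>+V. ennreal (?D V) * p V \<partial>sym_lborel)" unfolding J_def p_def ..
  show ?thesis
  proof (rule that)
    show "0 < c1"
    proof (rule ccontr)
      assume "\<not> 0 < c1"
      hence "(\<integral>\<^sup>+\<beta>. G \<beta> \<partial>lborel) = 0" by (simp add: c1_def)
      hence "AE \<beta> in lborel. G \<beta> = 0" by (subst (asm) nn_integral_0_iff_AE) auto
      moreover have "G \<beta> \<noteq> 0" for \<beta>
      proof -
        obtain H d where H: "orthogonal_matrix H" "A = conj_diag H d" and d: "\<And>i. 0 < d $ i"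
          using pos_def_diagonalization[OF A] by blast
        have "0 < (\<Prod>i\<in>UNIV. d $ i)" using d by (intro prod_pos) auto
        hence "0 < \<pi>b \<beta>" unfolding \<pi>b_def H(2) mvn_density_conj_diag[OF H(1) d]
          by (intro divide_pos_pos real_sqrt_gt_zero mult_pos_pos) auto
        thus ?thesis using K by (simp add: G_def)
      qed
      ultimately have "AE \<beta> in (lborel :: 'k rvec measure). False" by simp
      hence "UNIV \<in> null_sets (lborel :: 'k rvec measure)" by (simp add: AE_iff_null)
      hence "emeasure (lborel :: 'k rvec measure) UNIV = 0" by (rule null_setsD1)
      thus False unfolding emeasure_lborel_UNIV by simp
    qed
    show "c2 < \<infinity>"
      unfolding c2_def \<pi>b_def using nn_integral_mvn_density_finite[OF A] by (simp add: ennreal_mult_less_top)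
    have "c1 * J = (\<integral>\<^sup>+V. (\<integral>\<^sup>+\<beta>. G \<beta> * ennreal (?D V) \<partial>lborel) * p V \<partial>sym_lborel)"
      unfolding J c1_def by (subst nn_integral_cmult[symmetric]) (auto simp: nn_integral_multc mult_ac)
    also have "\<dots> \<le> marginal \<pi>b \<pi>V x"
      unfolding marg2
    proof (rule nn_integral_mono)
      fix V :: "'k sqmat"
      show "(\<integral>\<^sup>+\<beta>. G \<beta> * ennreal (?D V) \<partial>lborel) * p V \<le>
        (\<integral>\<^sup>+\<beta>. (\<integral>\<^sup>+\<theta>. ennreal (likelihood x \<theta> * theta_density \<theta> \<beta> V) \<partial>lborel) * ennreal (\<pi>b \<beta>) \<partial>lborel) * p V"
      proof (cases "pos_def V")
        case True
        show ?thesis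
        proof (intro mult_right_mono nn_integral_mono)
          fix \<beta>
          have "G \<beta> * ennreal (?D V) = ennreal (K * exp (- (\<Sum>i\<in>UNIV. (norm (x $ i - \<beta>))\<^sup>2) / 2) * ?D V) * ennreal (\<pi>b \<beta>)"
            using K by (simp add: G_def ennreal_mult mult_ac)
          also have "\<dots> \<le> (\<integral>\<^sup>+\<theta>. ennreal (likelihood x \<theta> * theta_density \<theta> \<beta> V) \<partial>lborel) * ennreal (\<pi>b \<beta>)"
            unfolding K_def by (intro mult_right_mono theta_integral_bounds(1) True) simp
          finally show "G \<beta> * ennreal (?D V) \<le> (\<integral>\<^sup>+\<theta>. ennreal (likelihood x \<theta> * theta_density \<theta> \<beta> V) \<partial>lborel) * ennreal (\<pi>b \<beta>)" .
        qed simp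
      qed (simp add: p_def)
    qed
    finally show "c1 * J \<le> marginal (mvn_density 0 A) \<pi>V x" by (simp add: \<pi>b_def)
    have "marginal \<pi>b \<pi>V x \<le> (\<integral>\<^sup>+V. (\<integral>\<^sup>+\<beta>. ennreal (K * ?D V) * ennreal (\<pi>b \<beta>) \<partial>lborel) * p V \<partial>sym_lborel)"
      unfolding marg2
    proof (rule nn_integral_mono)
      fix V :: "'k sqmat"
      show "(\<integral>\<^sup>+\<beta>. (\<integral>\<^sup>+\<theta>. ennreal (likelihood x \<theta> * theta_density \<theta> \<beta> V) \<partial>lborel) * ennreal (\<pi>b \<beta>) \<partial>lborel) * p V
         \<le> (\<integral>\<^sup>+\<beta>. ennreal (K * ?D V) * ennreal (\<pi>b \<beta>) \<partial>lborel) * p V"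
      proof (cases "pos_def V")
        case True
        show ?thesis unfolding K_def
          by (intro mult_right_mono nn_integral_mono theta_integral_bounds(2) True) simp_all
      qed (simp add: p_def)
    qed
    also have "\<dots> = (\<integral>\<^sup>+V. c2 * (ennreal (?D V) * p V) \<partial>sym_lborel)"
    proof (rule nn_integral_cong)
      fix V :: "'k sqmat"
      have "(\<integral>\<^sup>+\<beta>. ennreal (K * ?D V) * ennreal (\<pi>b \<beta>) \<partial>lborel) = ennreal (K * ?D V) * (\<integral>\<^sup>+\<beta>. ennreal (\<pi>b \<beta>) \<partial>lborel)"
        by (rule nn_integral_cmult) measurable
      also have "\<dots> = c2 * ennreal (?D V)" using K by (simp add: c2_def ennreal_mult mult_ac)
      finally show "(\<integral>\<^sup>+\<beta>. ennreal (K * ?D V) * ennreal (\<pi>b \<beta>) \<partial>lborel) * p V = c2 * (ennreal (?D V) * p V)"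
        by (simp add: mult_ac)
    qed
    also have "\<dots> = c2 * J" unfolding J by (rule nn_integral_cmult) measurable
    finally show "marginal (mvn_density 0 A) \<pi>V x \<le> c2 * J" by (simp add: \<pi>b_def)
  qed
qed

section \<open>Sufficiency\<close>

text \<open>The part of the open Weyl chamber in the positive orthant: one ordered spectrum for each
  positive-definite matrix with distinct eigenvalues.\<close>

definition spectral_cone :: "'k::{finite,linorder} rvec set" where
  "spectral_cone = {d. (\<forall>i j. i < j \<longrightarrow> d $ j < d $ i) \<and> (\<forall>i. 0 < d $ i)}"

lemma spectral_cone_measurable [measurable]: "(spectral_cone :: 'k::{finite,linorder} rvec set) \<in> sets borel"
proof -
  have "(spectral_cone :: 'k rvec set) = (\<Inter>i. \<Inter>j. {d. i < j \<longrightarrow> d $ j < d $ i}) \<inter> (\<Inter>i. {d. 0 < d $ i})"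
    by (auto simp: spectral_cone_def)
  also have "\<dots> \<in> sets borel" by measurable
  finally show ?thesis .
qed

lemma spectral_cone_vandermonde_pos: "d \<in> spectral_cone \<Longrightarrow> 0 < vandermonde d"
  unfolding vandermonde_def spectral_cone_def by (intro prod_pos) auto

lemma AE_pos_def_in_spectral_cone:
  "AE V in (sym_lborel :: 'k::{finite,linorder} sqmat measure).
     pos_def V \<longrightarrow> V \<in> spectral_set spectral_cone"
  using AE_simple_spectrum
proof eventually_elim
  case (elim V)
  show ?case
  proof
    assume pd: "pos_def V"
    hence "transpose V = V" by (simp add: pos_def_def)
    then obtain H d where H: "orthogonal_matrix H" "V = conj_diag H d" "\<And>i j. i < j \<Longrightarrow> d $ j < d $ i"
      using symmetric_ordered_diagonalization[of V] elim by metis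
    moreover have "\<And>i. 0 < d $ i" using pd pos_def_conj_diag[OF H(1)] H(2) by simp
    ultimately show "V \<in> spectral_set spectral_cone" by (auto simp: spectral_set_def spectral_cone_def)
  qed
qed

text \<open>Each difference is charged to its larger eigenvalue, and an index is the larger one in
  at most k - 1 pairs. The first index attains this count, so nothing is lost in the exponent that
  decides convergence.\<close>

lemma vandermonde_le_prod:
  fixes d :: "'k::{finite,linorder} rvec"
  assumes d: "d \<in> spectral_cone"
  shows "vandermonde d \<le> (\<Prod>i\<in>UNIV. (1 + d $ i) ^ (CARD('k) - 1))"
proof -
  have pos: "0 < d $ i" for i using d by (simp add: spectral_cone_def)
  have "vandermonde d = (\<Prod>p\<in>{(i, j). i < j}. d $ fst p - d $ snd p)"
    by (simp add: vandermonde_def case_prod_unfold)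
  also have "\<dots> \<le> (\<Prod>p\<in>{(i, j). i < j}. 1 + d $ fst p)"
  proof (rule prod_mono)
    fix p :: "'k \<times> 'k" assume "p \<in> {(i, j). i < j}"
    hence "d $ snd p < d $ fst p" using d by (auto simp: spectral_cone_def)
    thus "0 \<le> d $ fst p - d $ snd p \<and> d $ fst p - d $ snd p \<le> 1 + d $ fst p" using pos[of "snd p"] by auto
  qed
  also have "{(i :: 'k, j). i < j} = Sigma UNIV (\<lambda>i. {j. i < j})" by auto
  also have "(\<Prod>p\<in>Sigma UNIV (\<lambda>i. {j. i < j}). 1 + d $ fst p) = (\<Prod>i\<in>UNIV. (1 + d $ i) ^ card {j. i < j})"
    by (subst prod.Sigma[of UNIV "\<lambda>i. {j. i < j}" "\<lambda>i j. 1 + d $ i", symmetric, unfolded case_prod_unfold]) auto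
  also have "\<dots> \<le> (\<Prod>i\<in>UNIV. (1 + d $ i) ^ (CARD('k) - 1))"
  proof (rule prod_mono)
    fix i :: 'k
    have "card {j. i < j} \<le> card (UNIV - {i})" by (intro card_mono) auto
    hence "card {j. i < j} \<le> CARD('k) - 1" by (simp add: card_Diff_singleton)
    thus "0 \<le> (1 + d $ i) ^ card {j. i < j} \<and> (1 + d $ i) ^ card {j. i < j} \<le> (1 + d $ i) ^ (CARD('k) - 1)"
      using pos[of i] by (auto intro!: power_increasing zero_le_power add_nonneg_nonneg less_imp_le)
  qed
  finally show ?thesis .
qed

text \<open>The integrand behaves like y^(-a) at 0 and like y^(s - a) at infinity; the two
  hypotheses are integrability at these ends.\<close>

lemma nn_integral_powr_product_finite:
  fixes s a :: real
  assumes a: "a < 1" and s: "s - a < - 1"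
  shows "(\<integral>\<^sup>+y. ennreal ((1 + y) powr s * y powr (- a)) * indicator {0<..} y \<partial>lborel) < \<infinity>"
proof -
  \<comment> \<open>A bound for (1 + y)^s on (0, 1] and for the ratio of (1 + y)^s to y^s beyond 1,
    for either sign of s.\<close>
  define M where "M = max 1 (2 powr s)"
  have M: "M \<ge> 1" by (simp add: M_def)
  have I1: "(\<integral>\<^sup>+y. ennreal (indicator {0..1} y * y powr (- a)) \<partial>lborel) < \<infinity>"
    using nn_integral_has_integral_lebesgue[OF _ has_integral_powr_from_0[of "- a" 1]] a by simp
  have I2: "(\<integral>\<^sup>+y. ennreal (indicator {1..} y * y powr (s - a)) \<partial>lborel) < \<infinity>"
    using nn_integral_has_integral_lebesgue[OF _ has_integral_powr_to_inf[of "s - a" 1]] s by simp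
  have "(\<integral>\<^sup>+y. ennreal ((1 + y) powr s * y powr (- a)) * indicator {0<..} y \<partial>lborel) \<le>
     (\<integral>\<^sup>+y. ennreal M * ennreal (indicator {0..1} y * y powr (- a)) + ennreal M * ennreal (indicator {1..} y * y powr (s - a)) \<partial>lborel)"
  proof (rule nn_integral_mono)
    fix y :: real
    show "ennreal ((1 + y) powr s * y powr (- a)) * indicator {0<..} y \<le>
      ennreal M * ennreal (indicator {0..1} y * y powr (- a)) + ennreal M * ennreal (indicator {1..} y * y powr (s - a))"
    proof (cases "y > 0")
      case True
      have base: "(1 + y) powr s * y powr (- a) \<le> M * (indicator {0..1} y * y powr (- a)) + M * (indicator {1..} y * y powr (s - a))"
      proof (cases "y \<le> 1")
        case le: True
        have "(1 + y) powr s \<le> M"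
        proof (cases "s \<ge> 0")
          case True
          have "(1 + y) powr s \<le> 2 powr s" using True le \<open>y > 0\<close> by (intro powr_mono2) auto
          thus ?thesis by (simp add: M_def)
        next
          case False
          have "(1 + y) powr s \<le> 1 powr s" using False \<open>y > 0\<close> by (intro powr_mono2') auto
          thus ?thesis by (simp add: M_def)
        qed
        hence "(1 + y) powr s * y powr (- a) \<le> M * y powr (- a)" by (intro mult_right_mono) auto
        also have "\<dots> \<le> M * (indicator {0..1} y * y powr (- a)) + M * (indicator {1..} y * y powr (s - a))"
          using le True M by (auto simp: indicator_def)
        finally show ?thesis .
      next
        case False
        have "(1 + y) powr s \<le> M * y powr s"
        proof (cases "s \<ge> 0")
          case True
          have "(1 + y) powr s \<le> (2 * y) powr s" using True False by (intro powr_mono2) auto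
          also have "\<dots> = 2 powr s * y powr s" using False by (simp add: powr_mult)
          also have "\<dots> \<le> M * y powr s" by (intro mult_right_mono) (auto simp: M_def)
          finally show ?thesis .
        next
          case s0: False
          have "(1 + y) powr s \<le> y powr s" using s0 False by (intro powr_mono2') auto
          also have "\<dots> \<le> M * y powr s" using M mult_right_mono[of 1 M "y powr s"] by simp
          finally show ?thesis .
        qed
        hence "(1 + y) powr s * y powr (- a) \<le> M * y powr s * y powr (- a)" by (intro mult_right_mono) auto
        also have "\<dots> = M * y powr (s - a)" by (simp add: powr_add[symmetric])
        finally show ?thesis using False by simp
      qed
      have "ennreal ((1 + y) powr s * y powr (- a)) \<le> ennreal (M * (indicator {0..1} y * y powr (- a)) + M * (indicator {1..} y * y powr (s - a)))"
        using base by (rule ennreal_leI)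
      also have "\<dots> = ennreal M * ennreal (indicator {0..1} y * y powr (- a)) + ennreal M * ennreal (indicator {1..} y * y powr (s - a))"
        using M by (simp add: ennreal_mult ennreal_plus)
      finally show ?thesis using True by simp
    qed simp
  qed
  also have "\<dots> = ennreal M * (\<integral>\<^sup>+y. ennreal (indicator {0..1} y * y powr (- a)) \<partial>lborel) + ennreal M * (\<integral>\<^sup>+y. ennreal (indicator {1..} y * y powr (s - a)) \<partial>lborel)"
    by (subst nn_integral_add) (auto simp: nn_integral_cmult)
  also have "\<dots> < \<infinity>" using I1 I2 by (simp add: ennreal_mult_less_top)
  finally show ?thesis .
qed

section \<open>Priors comparable to a product of powers of the eigenvalues\<close>

locale comparable_prior =
  fixes \<pi>V :: "'k::{finite,linorder} sqmat \<Rightarrow> real" and a1 a2 l C1 C2 :: real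
  assumes l: "0 \<le> l" "l \<le> 1"
    and C1: "C1 > 0" and C2: "C2 > 0"
    and comparable: "\<And>H d. orthogonal_matrix H \<Longrightarrow> d \<in> spectral_cone \<Longrightarrow>
           C1 * vandermonde d powr l
               / (det (mat 1 + diag_mat d) powr (a2 - a1) * det (diag_mat d) powr a1)
               \<le> prior_HD \<pi>V H d
           \<and> prior_HD \<pi>V H d
               \<le> C2 * vandermonde d powr l
                   / (det (mat 1 + diag_mat d) powr (a2 - a1) * det (diag_mat d) powr a1)"
begin

text \<open>The parameter \<open>r\<close> stands for \<open>m / 2\<close>.\<close>

definition weight :: "real \<Rightarrow> 'k rvec \<Rightarrow> real" where
  "weight r d = vandermonde d powr (l - 1) * ((\<Prod>i\<in>UNIV. 1 + d $ i) powr (a1 - a2 - r) * (\<Prod>i\<in>UNIV. d $ i) powr (- a1))"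

text \<open>The integrand of \<open>J\<close> in \<open>marginal_bounds\<close>, with the indicator
  turning the prior into a function on all matrices.\<close>

definition reduced_density :: "real \<Rightarrow> 'k sqmat \<Rightarrow> ennreal" where
  "reduced_density r V = ennreal (det (mat 1 + V) powr (- r)) * (ennreal (\<pi>V V) * indicator {V. pos_def V} V)"

lemma cone_prods:
  assumes "d \<in> spectral_cone"
  shows "0 < (\<Prod>i\<in>UNIV. d $ i)" "0 < (\<Prod>i\<in>UNIV. 1 + d $ i)"
  using assms by (auto simp: spectral_cone_def intro!: prod_pos add_pos_pos)

lemma weight_pos: "d \<in> spectral_cone \<Longrightarrow> 0 < weight r d"
proof -
  assume d: "d \<in> spectral_cone"
  have p: "0 < x powr a" if "0 < x" for x a :: real using that by simp
  show ?thesis unfolding weight_def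
    by (intro mult_pos_pos p cone_prods[OF d] spectral_cone_vandermonde_pos[OF d])
qed

lemma weight_measurable [measurable]: "weight r \<in> borel_measurable borel"
proof -
  show ?thesis unfolding weight_def by measurable
qed

text \<open>The prior in the coordinates H, D contains the Jacobian. Dividing by it lowers the
  Vandermonde exponent from l to l - 1, and \<open>weight\<close> is what remains as a density for
  dV.\<close>

lemma reduced_density_bounds:
  assumes H: "orthogonal_matrix H" and d: "d \<in> spectral_cone"
  shows "ennreal (C1 * weight r d) \<le> reduced_density r (conj_diag H d)"
    and "reduced_density r (conj_diag H d) \<le> ennreal (C2 * weight r d)"
proof -
  define v where "v = vandermonde d"
  define P where "P = (\<Prod>i\<in>UNIV. 1 + d $ i)"
  define Q where "Q = (\<Prod>i\<in>UNIV. d $ i)"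
  have pos: "v > 0" "P > 0" "Q > 0"
    using cone_prods[OF d] spectral_cone_vandermonde_pos[OF d] by (auto simp: v_def P_def Q_def)
  have detP: "det (mat 1 + diag_mat d) = P" by (simp add: mat1_plus_diag_mat det_diag_mat P_def)
  have detQ: "det (diag_mat d) = Q" by (simp add: det_diag_mat Q_def)
  have w: "weight r d = P powr (- r) * (v powr l / (P powr (a2 - a1) * Q powr a1) / v)"
  proof -
    have "v powr (l - 1) = v powr l / v" using pos by (simp add: powr_diff)
    moreover have "P powr (a1 - a2 - r) = P powr (- r) / P powr (a2 - a1)"
      by (simp add: powr_diff[symmetric]) (simp add: algebra_simps)
    moreover have "Q powr (- a1) = 1 / Q powr a1" by (simp add: powr_minus_divide)
    ultimately show ?thesis by (simp add: weight_def v_def[symmetric] P_def[symmetric] Q_def[symmetric] mult_ac)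
  qed
  have pd: "pos_def (conj_diag H d)" using d pos_def_conj_diag[OF H] by (simp add: spectral_cone_def)
  have D: "det (mat 1 + conj_diag H d) = P"
    by (simp add: mat1_plus_conj_diag[OF H] det_conj_diag[OF H] P_def)
  have "prior_HD \<pi>V H d = \<pi>V (conj_diag H d) * v" by (simp add: prior_HD_def conj_diag_def v_def)
  hence b: "C1 * (v powr l / (P powr (a2 - a1) * Q powr a1)) \<le> \<pi>V (conj_diag H d) * v"
      "\<pi>V (conj_diag H d) * v \<le> C2 * (v powr l / (P powr (a2 - a1) * Q powr a1))"
    using comparable[OF H d] by (simp_all add: detP detQ v_def)
  have b': "C1 * (v powr l / (P powr (a2 - a1) * Q powr a1) / v) \<le> \<pi>V (conj_diag H d)"
      "\<pi>V (conj_diag H d) \<le> C2 * (v powr l / (P powr (a2 - a1) * Q powr a1) / v)"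
    using divide_right_mono[OF b(1), of v] divide_right_mono[OF b(2), of v] pos(1) by simp_all
  have eq: "reduced_density r (conj_diag H d) = ennreal (P powr (- r) * \<pi>V (conj_diag H d))"
    using pd by (simp add: reduced_density_def D ennreal_mult')
  show "ennreal (C1 * weight r d) \<le> reduced_density r (conj_diag H d)"
    unfolding eq w using mult_left_mono[OF b'(1), of "P powr (- r)"] by (intro ennreal_leI) (simp add: mult_ac)
  show "reduced_density r (conj_diag H d) \<le> ennreal (C2 * weight r d)"
    unfolding eq w using mult_left_mono[OF b'(2), of "P powr (- r)"] by (intro ennreal_leI) (simp add: mult_ac)
qed

text \<open>The Jacobian restores the exponent l, which is nonnegative, so
  \<open>vandermonde_le_prod\<close> can be raised to it. The result factors over the eigenvalues,
  after which their order can be forgotten.\<close>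

lemma weight_vandermonde_le:
  fixes r :: real
  assumes d: "d \<in> spectral_cone"
  defines "s \<equiv> l * (real CARD('k) - 1) + (a1 - a2 - r)"
  shows "weight r d * \<bar>vandermonde d\<bar> \<le> (\<Prod>i\<in>UNIV. (1 + d $ i) powr s * (d $ i) powr (- a1))"
proof -
  have pos: "0 < d $ i" for i using d by (simp add: spectral_cone_def)
  have v: "vandermonde d > 0" by (rule spectral_cone_vandermonde_pos[OF d])
  define P where "P = (\<Prod>i\<in>UNIV. 1 + d $ i)"
  have P: "P > 0" using cone_prods(2)[OF d] by (simp add: P_def)
  have prod_powr: "(\<Prod>i\<in>UNIV. f i) powr c = (\<Prod>i\<in>UNIV. f i powr c)" for f :: "'k \<Rightarrow> real" and c
    by (rule prod_powr_distrib)
  have k1: "real (CARD('k) - 1) = real CARD('k) - 1" by (simp add: of_nat_diff Suc_leI)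
  have "vandermonde d powr (l - 1) * vandermonde d = vandermonde d powr l"
    using v by (simp add: powr_diff)
  also have "\<dots> \<le> (P ^ (CARD('k) - 1)) powr l"
    using vandermonde_le_prod[OF d] v l by (intro powr_mono2) (auto simp: P_def prod_power_distrib)
  also have "\<dots> = P powr (l * (real CARD('k) - 1))"
    using P by (simp add: powr_realpow[symmetric] powr_powr k1 mult.commute)
  finally have 1: "vandermonde d powr (l - 1) * vandermonde d \<le> P powr (l * (real CARD('k) - 1))" .
  have "weight r d * \<bar>vandermonde d\<bar> = (vandermonde d powr (l - 1) * vandermonde d) * (P powr (a1 - a2 - r) * (\<Prod>i\<in>UNIV. d $ i) powr (- a1))"
    using v by (simp add: weight_def P_def)
  also have "\<dots> \<le> P powr (l * (real CARD('k) - 1)) * (P powr (a1 - a2 - r) * (\<Prod>i\<in>UNIV. d $ i) powr (- a1))"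
    using 1 by (rule mult_right_mono) simp
  also have "\<dots> = P powr s * (\<Prod>i\<in>UNIV. d $ i) powr (- a1)" by (simp add: s_def powr_add)
  also have "P powr s = (\<Prod>i\<in>UNIV. (1 + d $ i) powr s)" unfolding P_def by (rule prod_powr)
  also have "(\<Prod>i\<in>UNIV. d $ i) powr (- a1) = (\<Prod>i\<in>UNIV. (d $ i) powr (- a1))" by (rule prod_powr)
  finally show ?thesis by (simp add: prod.distrib)
qed

theorem reduced_integral_finite:
  assumes a1: "a1 < 1" and a2: "a2 > 1 - r + (real CARD('k) - 1) * l"
  shows "(\<integral>\<^sup>+V. reduced_density r V \<partial>sym_lborel) < \<infinity>"
proof -
  obtain C :: real where C: "C > 0"
    "\<And>(E :: 'k rvec set) f g. E \<in> sets borel \<Longrightarrow> f \<in> borel_measurable borel \<Longrightarrow> (\<And>d. d \<in> E \<Longrightarrow> 0 < f d) \<Longrightarrow>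
      (\<And>H d. orthogonal_matrix H \<Longrightarrow> d \<in> E \<Longrightarrow> g (conj_diag H d) \<le> ennreal (f d)) \<Longrightarrow>
      (AE V in sym_lborel. V \<notin> spectral_set E \<longrightarrow> g V = 0) \<Longrightarrow>
      (\<integral>\<^sup>+V. g V \<partial>sym_lborel) \<le> ennreal C * (\<integral>\<^sup>+d. ennreal (f d * \<bar>vandermonde d\<bar>) * indicator E d \<partial>lborel)"
    by (rule weyl_upper_integral[where 'k = 'k], rule that) auto
  define s where "s = l * (real CARD('k) - 1) + (a1 - a2 - r)"
  let ?h = "\<lambda>y. ennreal ((1 + y) powr s * y powr (- a1)) * indicator {0<..} y"
  have "(\<integral>\<^sup>+V. reduced_density r V \<partial>sym_lborel) \<le>
     ennreal C * (\<integral>\<^sup>+d. ennreal (C2 * weight r d * \<bar>vandermonde d\<bar>) * indicator spectral_cone d \<partial>lborel)"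
  proof (rule C(2))
    show "AE V in sym_lborel. V \<notin> spectral_set spectral_cone \<longrightarrow> reduced_density r V = 0"
      using AE_pos_def_in_spectral_cone by eventually_elim (auto simp: reduced_density_def)
  qed (use C2 weight_pos reduced_density_bounds(2) in auto)
  also have "(\<integral>\<^sup>+d. ennreal (C2 * weight r d * \<bar>vandermonde d\<bar>) * indicator spectral_cone d \<partial>lborel) \<le>
     (\<integral>\<^sup>+d. ennreal C2 * (\<Prod>i\<in>UNIV. ?h (d $ i)) \<partial>(lborel :: 'k rvec measure))"
  proof (rule nn_integral_mono)
    fix d :: "'k rvec"
    show "ennreal (C2 * weight r d * \<bar>vandermonde d\<bar>) * indicator spectral_cone d \<le> ennreal C2 * (\<Prod>i\<in>UNIV. ?h (d $ i))"
    proof (cases "d \<in> spectral_cone")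
      case True
      hence pos: "0 < d $ i" for i by (simp add: spectral_cone_def)
      have "ennreal (C2 * weight r d * \<bar>vandermonde d\<bar>) \<le> ennreal (C2 * (\<Prod>i\<in>UNIV. (1 + d $ i) powr s * (d $ i) powr (- a1)))"
        using mult_left_mono[OF weight_vandermonde_le[OF True, of r], of C2] C2 by (intro ennreal_leI) (simp add: s_def mult.assoc)
      also have "\<dots> = ennreal C2 * (\<Prod>i\<in>UNIV. ennreal ((1 + d $ i) powr s * (d $ i) powr (- a1)))"
        using C2 by (subst ennreal_mult) (auto simp: prod_ennreal intro!: prod_nonneg)
      also have "(\<Prod>i\<in>UNIV. ennreal ((1 + d $ i) powr s * (d $ i) powr (- a1))) = (\<Prod>i\<in>UNIV. ?h (d $ i))"
        using pos by (intro prod.cong) auto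
      finally show ?thesis using True by simp
    qed simp
  qed
  also have "\<dots> = ennreal C2 * (\<integral>\<^sup>+d. (\<Prod>i\<in>UNIV. ?h (d $ i)) \<partial>(lborel :: 'k rvec measure))"
  proof (rule nn_integral_cmult)
    show "(\<lambda>d :: 'k rvec. \<Prod>i\<in>UNIV. ?h (d $ i)) \<in> borel_measurable lborel" by measurable
  qed
  also have "(\<integral>\<^sup>+d. (\<Prod>i\<in>UNIV. ?h (d $ i)) \<partial>(lborel :: 'k rvec measure)) = (\<Prod>i\<in>(UNIV :: 'k set). \<integral>\<^sup>+y. ?h y \<partial>lborel)"
    by (rule nn_integral_lborel_vec_prod) measurable
  also have "ennreal C * (ennreal C2 * (\<Prod>i\<in>(UNIV :: 'k set). \<integral>\<^sup>+y. ?h y \<partial>lborel)) < \<infinity>"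
  proof -
    \<comment> \<open>In s - a1 the parameter a1 cancels: it equals (k - 1) l - a2 - r, so this is
      the hypothesis on a2.\<close>
    have "s - a1 < - 1" using a2 by (simp add: s_def algebra_simps)
    from nn_integral_powr_product_finite[OF a1 this]
    have "(\<integral>\<^sup>+y. ?h y \<partial>lborel) < top" by simp
    hence "(\<integral>\<^sup>+y. ?h y \<partial>lborel) ^ CARD('k) < top" by (simp add: power_less_top_ennreal)
    thus ?thesis by (simp add: ennreal_mult_less_top)
  qed
  finally show ?thesis by (simp add: mult_left_mono)
qed

end

section \<open>Necessity of the condition on the first exponent\<close>

lemma quadratic_form_bound:
  fixes E :: "'k::finite sqmat"
  assumes "\<And>i j. \<bar>E $ i $ j\<bar> \<le> \<delta>"
  shows "\<bar>z \<bullet> (E *v z)\<bar> \<le> \<delta> * real CARD('k) * (z \<bullet> z)"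
proof -
  have \<delta>0: "\<delta> \<ge> 0" using order_trans[OF abs_ge_zero assms] .
  have am: "\<bar>z $ i\<bar> * \<bar>z $ j\<bar> \<le> ((z $ i)\<^sup>2 + (z $ j)\<^sup>2) / 2" for i j
    using sum_squares_bound[of "\<bar>z $ i\<bar>" "\<bar>z $ j\<bar>"] by simp
  have "z \<bullet> (E *v z) = (\<Sum>i\<in>UNIV. \<Sum>j\<in>UNIV. z $ i * (E $ i $ j * z $ j))"
    by (simp add: inner_vec_def matrix_vector_mult_def sum_distrib_left)
  also have "\<bar>\<dots>\<bar> \<le> (\<Sum>i\<in>UNIV. \<Sum>j\<in>UNIV. \<bar>z $ i * (E $ i $ j * z $ j)\<bar>)"
    by (rule order_trans[OF sum_abs]) (intro sum_mono sum_abs)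
  also have "\<dots> \<le> (\<Sum>i\<in>(UNIV :: 'k set). \<Sum>j\<in>(UNIV :: 'k set). \<delta> * (((z $ i)\<^sup>2 + (z $ j)\<^sup>2) / 2))"
  proof (intro sum_mono)
    fix i j
    have "\<bar>z $ i * (E $ i $ j * z $ j)\<bar> = \<bar>E $ i $ j\<bar> * (\<bar>z $ i\<bar> * \<bar>z $ j\<bar>)" by (simp add: abs_mult)
    also have "\<dots> \<le> \<delta> * (((z $ i)\<^sup>2 + (z $ j)\<^sup>2) / 2)"
      using assms am \<delta>0 by (intro mult_mono) auto
    finally show "\<bar>z $ i * (E $ i $ j * z $ j)\<bar> \<le> \<delta> * (((z $ i)\<^sup>2 + (z $ j)\<^sup>2) / 2)" .
  qed
  also have "\<dots> = \<delta> * (\<Sum>i\<in>(UNIV :: 'k set). \<Sum>j\<in>(UNIV :: 'k set). (z $ i)\<^sup>2 / 2 + (z $ j)\<^sup>2 / 2)"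
    by (simp add: sum_distrib_left add_divide_distrib)
  also have "(\<Sum>i\<in>(UNIV :: 'k set). \<Sum>j\<in>(UNIV :: 'k set). (z $ i)\<^sup>2 / 2 + (z $ j)\<^sup>2 / 2) = real CARD('k) * (z \<bullet> z)"
    by (simp add: sum.distrib sum_distrib_left[symmetric] sum_divide_distrib[symmetric] inner_vec_def power2_eq_square)
  finally show ?thesis by (simp add: mult_ac)
qed

lemma component_square_le_inner: "(z $ q)\<^sup>2 \<le> z \<bullet> (z :: real ^ 'n)"
proof -
  have "\<bar>z $ q\<bar>\<^sup>2 \<le> (norm z)\<^sup>2" by (intro power_mono component_le_norm_cart) simp
  thus ?thesis by (simp add: power2_norm_eq_inner)
qed

lemma conj_diag_eigenvalue_ge:
  assumes H: "orthogonal_matrix H" and "\<And>z. c * (z \<bullet> z) \<le> z \<bullet> (conj_diag H d *v z)"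
  shows "c \<le> d $ i"
proof -
  define x where "x = transpose H *v axis i 1"
  have Hx: "H *v x = axis i 1"
    unfolding x_def using H by (simp add: matrix_vector_mul_assoc orthogonal_matrix_def del: transpose_matrix_vector)
  have "x \<bullet> x = 1" using orthogonal_matrix_inner[OF H, of x x] by (simp add: Hx inner_axis_axis)
  moreover have "x \<bullet> (conj_diag H d *v x) = d $ i"
    by (simp add: conj_diag_quadratic Hx axis_def if_distrib[of "\<lambda>a. a\<^sup>2"] if_distrib[of "\<lambda>a. _ * a"] cong: if_cong)
  ultimately show ?thesis using assms(2)[of x] by simp
qed

text \<open>If all eigenvalues exceeded c, subtracting c I would leave a positive-definite matrix,
  against the given test vector.\<close>

lemma conj_diag_eigenvalue_le:
  assumes H: "orthogonal_matrix H" and z: "z \<noteq> 0" "z \<bullet> (conj_diag H d *v z) \<le> c * (z \<bullet> z)"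
  shows "\<exists>i. d $ i \<le> c"
proof (rule ccontr)
  assume "\<not> (\<exists>i. d $ i \<le> c)"
  hence "(\<chi> i. d $ i - c) $ i > 0" for i by (simp add: not_le)
  hence "pos_def (conj_diag H (\<chi> i. d $ i - c))" using pos_def_conj_diag[OF H] by blast
  hence "0 < z \<bullet> (conj_diag H (\<chi> i. d $ i - c) *v z)" using z by (simp add: pos_def_def)
  also have "\<dots> = z \<bullet> (conj_diag H d *v z) - c * (z \<bullet> z)"
    by (simp add: conj_diag_quadratic orthogonal_matrix_sum_squares[OF H, symmetric] left_diff_distrib sum_subtractf sum_distrib_left)
  finally show False using z by simp
qed

lemma nn_integral_inverse_infinite:
  fixes t :: real
  shows "(\<integral>\<^sup>+y. ennreal (1 / (y - t)) * indicator {t<..t + 1/2} y \<partial>lborel) = \<infinity>" (is "?I = _")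
proof -
  have "of_nat n \<le> ?I" for n :: nat
  proof -
    \<comment> \<open>Chosen so that the logarithmic integral over the truncated interval is exactly
      n.\<close>
    define e where "e = exp (- real n) / 2"
    have e: "0 < e" "e \<le> 1 / 2" by (auto simp: e_def)
    have "((\<lambda>y. 1 / (y - t)) has_integral (ln (t + 1/2 - t) - ln (t + e - t))) {t + e..t + 1/2}"
      using e by (intro fundamental_theorem_of_calculus)
         (auto intro!: derivative_eq_intros simp: has_real_derivative_iff_has_vector_derivative[symmetric])
    moreover have "ln (t + 1/2 - t) - ln (t + e - t) = real n"
      by (simp add: e_def ln_div)
    ultimately have h: "((\<lambda>y. 1 / (y - t)) has_integral real n) {t + e..t + 1/2}" by simp
    have "(\<integral>\<^sup>+y. ennreal (1 / (y - t)) * indicator {t + e..t + 1/2} y \<partial>lborel) = ennreal (real n)"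
      using e h by (intro nn_integral_has_integral_lebesgue') auto
    moreover have "(\<integral>\<^sup>+y. ennreal (1 / (y - t)) * indicator {t + e..t + 1/2} y \<partial>lborel) \<le> ?I"
      using e by (intro nn_integral_mono) (auto simp: indicator_def)
    ultimately show ?thesis by (simp add: ennreal_of_nat_eq_real_of_nat)
  qed
  thus ?thesis
    by (metis ennreal_Ex_less_of_nat infinity_ennreal_def leD less_top)
qed

text \<open>The exponents in question have unknown sign; the minimum over both end points covers
  increasing and decreasing powers at once.\<close>

lemma powr_ge_min:
  fixes q :: real
  assumes "0 < lo" "lo \<le> q" "q \<le> hi"
  shows "min (lo powr y) (hi powr y) \<le> q powr y"
proof (cases "y \<ge> 0")
  case True thus ?thesis using assms powr_mono2[of y lo q] by (simp add: min.coboundedI1)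
next
  case False thus ?thesis using assms powr_mono2'[of y q hi] by (simp add: min.coboundedI2)
qed

context comparable_prior
begin

lemma AE_reduced_density_ge:
  "AE V in sym_lborel. pos_def V \<longrightarrow> (\<exists>H d. orthogonal_matrix H \<and> d \<in> spectral_cone \<and> V = conj_diag H d \<and>
     ennreal (C1 * weight r d) \<le> reduced_density r V)"
  using AE_pos_def_in_spectral_cone
  by eventually_elim (use reduced_density_bounds(1) in \<open>fastforce simp: spectral_set_def\<close>)

text \<open>For bounded spectra the determinant is the only factor left. The Vandermonde product is
  bounded above, so its power l - 1 \<le> 0 is bounded below, even where eigenvalues come close to
  each other.\<close>

lemma weight_ge_of_bounded:
  assumes T: "T > 0"
  obtains c where "c > 0" "\<And>d. d \<in> spectral_cone \<Longrightarrow> (\<And>i. d $ i \<le> T) \<Longrightarrow> c * (\<Prod>i\<in>UNIV. d $ i) powr (- a1) \<le> weight r d"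
proof -
  define M where "M = (\<Prod>i\<in>(UNIV :: 'k set). (1 + T) ^ (CARD('k) - 1))"
  define N where "N = (1 + T) ^ CARD('k)"
  define c where "c = M powr (l - 1) * min (1 powr (a1 - a2 - r)) (N powr (a1 - a2 - r))"
  have M: "M > 0" "N > 0" using T by (auto simp: M_def N_def)
  show ?thesis
  proof (rule that)
    show "c > 0" using M by (simp add: c_def)
    fix d :: "'k rvec" assume d: "d \<in> spectral_cone" and dT: "\<And>i. d $ i \<le> T"
    have pos: "0 < d $ i" for i using d by (simp add: spectral_cone_def)
    have "vandermonde d \<le> (\<Prod>i\<in>UNIV. (1 + d $ i) ^ (CARD('k) - 1))" by (rule vandermonde_le_prod[OF d])
    also have "\<dots> \<le> M" unfolding M_def
    proof (rule prod_mono)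
      fix i :: 'k
      have "0 \<le> 1 + d $ i" "1 + d $ i \<le> 1 + T" using pos[of i] dT[of i] by auto
      thus "0 \<le> (1 + d $ i) ^ (CARD('k) - 1) \<and> (1 + d $ i) ^ (CARD('k) - 1) \<le> (1 + T) ^ (CARD('k) - 1)"
        by (intro conjI power_mono zero_le_power)
    qed
    finally have "vandermonde d \<le> M" .
    hence 1: "M powr (l - 1) \<le> vandermonde d powr (l - 1)"
      using l spectral_cone_vandermonde_pos[OF d] by (intro powr_mono2') auto
    have "1 \<le> (\<Prod>i\<in>UNIV. 1 + d $ i)" using pos by (intro prod_ge_1) (auto intro: less_imp_le)
    moreover have "(\<Prod>i\<in>UNIV. 1 + d $ i) \<le> (\<Prod>i\<in>(UNIV :: 'k set). 1 + T)"
    proof (rule prod_mono)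
      fix i :: 'k
      show "0 \<le> 1 + d $ i \<and> 1 + d $ i \<le> 1 + T" using pos[of i] dT[of i] by auto
    qed
    ultimately have 2: "min (1 powr (a1 - a2 - r)) (N powr (a1 - a2 - r)) \<le> (\<Prod>i\<in>UNIV. 1 + d $ i) powr (a1 - a2 - r)"
      by (intro powr_ge_min) (auto simp: N_def)
    have "c * (\<Prod>i\<in>UNIV. d $ i) powr (- a1) = M powr (l - 1) * (min (1 powr (a1 - a2 - r)) (N powr (a1 - a2 - r)) * (\<Prod>i\<in>UNIV. d $ i) powr (- a1))"
      by (simp add: c_def)
    also have "\<dots> \<le> weight r d"
      unfolding weight_def using 1 2 by (intro mult_mono) auto
    finally show "c * (\<Prod>i\<in>UNIV. d $ i) powr (- a1) \<le> weight r d" .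
  qed
qed

text \<open>With all entries but one diagonal entry fixed near the identity, the smallest eigenvalue is at
  most twice the distance of that entry from the boundary of the positive-definite cone, so that
  integrating over this entry alone already diverges.\<close>

theorem reduced_integral_infinite:
  assumes a1: "a1 \<ge> 1"
  shows "(\<integral>\<^sup>+V. reduced_density r V \<partial>sym_lborel) = \<infinity>"
proof -
  define k where "k = real CARD('k)"
  have k1: "k \<ge> 1" by (simp add: k_def Suc_leI)
  \<comment> \<open>Entries within 1 / (4 k) of the identity change the quadratic form by at most a
    quarter of the square norm.\<close>
  define \<delta> where "\<delta> = 1 / (4 * k)"
  have \<delta>: "\<delta> > 0" "\<delta> * k = 1 / 4" "\<delta> \<le> 1 / 4" using k1 by (auto simp: \<delta>_def field_simps)
  obtain q :: 'k where "True" by simp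
  let ?P = "{(i :: 'k, j). i \<le> j}"
  define P' where "P' = ?P - {(q, q)}"
  have P: "?P = insert (q, q) P'" "(q, q) \<notin> P'" "finite P'" by (auto simp: P'_def)
  \<comment> \<open>The trace of a matrix in \<open>S\<close> is at most k (1 + \<delta>) \<le> 2 k,
    and it bounds every eigenvalue of a positive-definite one.\<close>
  define T where "T = 2 * k"
  have T: "T \<ge> 1" using k1 by (simp add: T_def)
  obtain c where c: "c > 0" "\<And>d. d \<in> spectral_cone \<Longrightarrow> (\<And>i. d $ i \<le> T) \<Longrightarrow> c * (\<Prod>i\<in>UNIV. d $ i) powr (- a1) \<le> weight r d"
    using weight_ge_of_bounded[of T] T by auto
  define S where "S = {V :: 'k sqmat. \<forall>i. V $ i $ i \<le> 1 + \<delta>}"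
  have S: "S \<in> sets borel"
  proof -
    have "S = (\<Inter>i. {V. V $ i $ i \<le> 1 + \<delta>})" by (auto simp: S_def)
    also have "\<dots> \<in> sets borel" by measurable
    finally show ?thesis .
  qed
  define g where "g V = ennreal (C1 * c * det V powr (- a1)) * (indicator {V. pos_def V} V * indicator S V)" for V :: "'k sqmat"
  have [measurable]: "(\<lambda>V :: 'k sqmat. det V) \<in> borel_measurable borel" by (rule borel_measurable_det) simp
  note S [measurable]
  have g_meas [measurable]: "g \<in> borel_measurable borel" unfolding g_def by measurable
  have diag_le: "d $ i \<le> T" if V: "orthogonal_matrix H" "\<And>i. 0 < d $ i" "conj_diag H d \<in> S" for H d i
  proof -
    have "d $ i \<le> (\<Sum>i\<in>UNIV. d $ i)" using V(2) by (intro member_le_sum) (auto intro: less_imp_le)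
    also have "\<dots> = trace (conj_diag H d)" by (simp add: trace_conj_diag[OF V(1)])
    also have "\<dots> \<le> (\<Sum>i\<in>(UNIV :: 'k set). 1 + \<delta>)" unfolding trace_def using V(3) by (intro sum_mono) (simp add: S_def)
    also have "\<dots> \<le> T" using \<delta> by (simp add: T_def k_def distrib_left mult.commute)
    finally show ?thesis .
  qed
  have ge: "(\<integral>\<^sup>+V. g V \<partial>sym_lborel) \<le> (\<integral>\<^sup>+V. reduced_density r V \<partial>sym_lborel)"
  proof (rule nn_integral_mono_AE)
    show "AE V in sym_lborel. g V \<le> reduced_density r V"
      using AE_reduced_density_ge[where r = r]
    proof eventually_elim
      case (elim V)
      show ?case
      proof (cases "pos_def V \<and> V \<in> S")
        case True
        with elim obtain H d where H: "orthogonal_matrix H" "d \<in> spectral_cone" "V = conj_diag H d"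
          and w: "ennreal (C1 * weight r d) \<le> reduced_density r V" by blast
        have pos: "0 < d $ i" for i using H(2) by (simp add: spectral_cone_def)
        have "c * (\<Prod>i\<in>UNIV. d $ i) powr (- a1) \<le> weight r d"
          using diag_le[OF H(1) pos] True H(3) by (intro c(2) H(2)) auto
        hence "C1 * c * det V powr (- a1) \<le> C1 * weight r d"
          using C1 by (simp add: H(3) det_conj_diag[OF H(1)] mult.assoc)
        hence "g V \<le> ennreal (C1 * weight r d)" using True by (simp add: g_def ennreal_leI)
        thus ?thesis using w by (rule order_trans)
      qed (auto simp: g_def)
    qed
  qed
  interpret product_sigma_finite "\<lambda>_::'k \<times> 'k. lborel :: real measure" by standard
  define G where "G x y = g (sym_of_upper (x((q, q) := y)))" for x y
  have inner: "(\<integral>\<^sup>+y. G x y \<partial>lborel) = \<infinity>"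
    if x: "\<And>i j. i \<le> j \<Longrightarrow> (i, j) \<noteq> (q, q) \<Longrightarrow> \<bar>x (i, j) - (if i = j then 1 else 0)\<bar> \<le> \<delta>" for x
  proof -
    define V where "V y = sym_of_upper (x((q, q) := y))" for y
    have Voo: "V y $ q $ q = y" for y by (simp add: V_def sym_of_upper_def)
    have Vsym: "transpose (V y) = V y" for y
      by (simp add: V_def sym_of_upper_def transpose_def vec_eq_iff min.commute max.commute)
    have Vdiff: "V y - V y' = (\<chi> i j. if i = q \<and> j = q then y - y' else 0)" for y y'
      by (auto simp: V_def sym_of_upper_def vec_eq_iff min_def max_def)
    have Vq: "z \<bullet> (V y *v z) = z \<bullet> (V y' *v z) + (y - y') * (z $ q)\<^sup>2" for y y' z
    proof -
      have "z \<bullet> (V y *v z) - z \<bullet> (V y' *v z) = z \<bullet> ((V y - V y') *v z)"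
        by (simp add: matrix_vector_mult_diff_rdistrib inner_diff_right)
      also have "((V y - V y') *v z) = (\<chi> i. if i = q then (y - y') * z $ q else 0)"
        unfolding Vdiff by (auto simp: matrix_vector_mult_def vec_eq_iff if_distrib[of "\<lambda>a. a * _"] cong: if_cong)
      also have "z \<bullet> \<dots> = (y - y') * (z $ q)\<^sup>2"
        by (simp add: inner_vec_def if_distrib[of "\<lambda>a. _ * a"] power2_eq_square cong: if_cong)
      finally show ?thesis by simp
    qed
    have V1: "z \<bullet> (V 1 *v z) \<ge> 3 / 4 * (z \<bullet> z)" for z
    proof -
      define E where "E = V 1 - mat 1"
      have "\<bar>E $ i $ j\<bar> \<le> \<delta>" for i j
      proof (cases "i = q \<and> j = q")
        case True thus ?thesis using \<delta> by (simp add: E_def Voo mat_def)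
      next
        case False
        hence "(min i j, max i j) \<noteq> (q, q)" by (auto simp: min_def max_def split: if_splits)
        moreover have "E $ i $ j = x (min i j, max i j) - (if min i j = max i j then 1 else 0)"
          using \<open>(min i j, max i j) \<noteq> (q, q)\<close> by (auto simp: E_def V_def sym_of_upper_def mat_def min_def max_def)
        ultimately show ?thesis using x[of "min i j" "max i j"] by (simp add: min.coboundedI1)
      qed
      hence "\<bar>z \<bullet> (E *v z)\<bar> \<le> \<delta> * k * (z \<bullet> z)" unfolding k_def by (rule quadratic_form_bound)
      hence "\<bar>z \<bullet> (E *v z)\<bar> \<le> 1 / 4 * (z \<bullet> z)" by (simp only: \<delta>(2))
      moreover have "z \<bullet> (V 1 *v z) = z \<bullet> z + z \<bullet> (E *v z)"
        by (simp add: E_def matrix_vector_mult_diff_rdistrib inner_diff_right)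
      ultimately show ?thesis by linarith
    qed
    define Y where "Y = {y. pos_def (V y)}"
    \<comment> \<open>At the value 1 the form is at least 3/4 of the square norm, and lowering one
      diagonal entry by 1/2 costs at most 1/2 of it.\<close>
    have Yhalf: "1 / 2 \<in> Y"
      unfolding Y_def pos_def_def
    proof (intro CollectI conjI allI impI Vsym)
      fix z :: "'k rvec" assume "z \<noteq> 0"
      have zo: "(z $ q)\<^sup>2 \<le> z \<bullet> z"
        by (rule component_square_le_inner)
      have "0 < z \<bullet> z" using \<open>z \<noteq> 0\<close> by simp
      have "0 < b" if "0 < a" "b = c + (1 / 2 - 1) * e" "3 / 4 * a \<le> c" "e \<le> a" for a b c e :: real
        using that by (simp add: field_simps)
      from this[OF \<open>0 < z \<bullet> z\<close> Vq V1 zo] show "0 < z \<bullet> (V (1 / 2) *v z)" .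
    qed
    have Ypos: "0 < y" if "y \<in> Y" for y
    proof -
      have "0 < axis q 1 \<bullet> (V y *v axis q 1)" using that by (simp add: Y_def pos_def_def)
      also have "axis q 1 \<bullet> (V y *v axis q 1) = y"
        using Voo[of y] by (simp add: matrix_vector_mult_basis column_def inner_axis')
      finally show ?thesis .
    qed
    have Yup: "y' \<in> Y" if "y \<in> Y" "y \<le> y'" for y y'
      unfolding Y_def pos_def_def
    proof (intro CollectI conjI allI impI Vsym)
      fix z :: "'k rvec" assume "z \<noteq> 0"
      hence "0 < z \<bullet> (V y *v z)" using that(1) by (simp add: Y_def pos_def_def)
      thus "0 < z \<bullet> (V y' *v z)" using Vq[of z y' y] that(2) by (simp add: add_pos_nonneg)
    qed
    \<comment> \<open>Where this line of matrices leaves the positive-definite cone. Since t \<le>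
      1/2, an interval of length 1/2 above t keeps the entry at most 1, hence the matrix in
      \<open>S\<close>.\<close>
    define t where "t = Inf Y"
    have bdd: "bdd_below Y" using Ypos by (intro bdd_belowI[of _ 0]) (auto intro: less_imp_le)
    have t_le: "t \<le> 1 / 2" unfolding t_def using Yhalf bdd by (rule cInf_lower)
    have t_gt: "y \<in> Y" if ty: "t < y" for y
    proof -
      obtain y' where "y' \<in> Y" "y' < y" using ty Yhalf bdd cInf_less_iff[of Y y] unfolding t_def by blast
      thus ?thesis using Yup by simp
    qed
    have t_lt: "y \<notin> Y" if "y < t" for y
      using that bdd cInf_lower[of y Y] unfolding t_def by auto
    define c' where "c' = C1 * c * (2 * T ^ (CARD('k) - 1)) powr (- a1)"
    have c': "c' > 0" using C1 c T by (simp add: c'_def)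
    have "ennreal c' * (ennreal (1 / (y - t)) * indicator {t<..t + 1/2} y) \<le> G x y" for y
    proof (cases "y \<in> {t<..t + 1/2}")
      case True
      define s where "s = y - t"
      have s: "0 < s" "s \<le> 1 / 2" using True by (auto simp: s_def)
      have yY: "y \<in> Y" using True t_gt by simp
      hence pd: "pos_def (V y)" by (simp add: Y_def)
      have y1: "y \<le> 1" using True t_le by simp
      have VS: "V y \<in> S"
      proof -
        have "V y $ i $ i \<le> 1 + \<delta>" for i
        proof (cases "i = q")
          case True thus ?thesis using y1 \<delta> by (simp add: Voo)
        next
          case False
          thus ?thesis using x[of i i] by (auto simp: V_def sym_of_upper_def)
        qed
        thus ?thesis by (simp add: S_def)
      qed
      obtain H d where H: "orthogonal_matrix H" "V y = conj_diag H d" and d: "\<And>i. 0 < d $ i"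
        using pos_def_diagonalization[OF pd] by blast
      have dT: "d $ i \<le> T" for i using diag_le[OF H(1) d] VS H(2) by simp
      \<comment> \<open>Reflecting y in t gives a matrix outside the cone and a vector z on which
        its form is not positive. Moving back to y adds at most 2 s times the square norm of z, so
        some eigenvalue of V y is at most 2 s.\<close>
      have "t - s \<notin> Y" using s t_lt by simp
      then obtain z where z: "z \<noteq> 0" "z \<bullet> (V (t - s) *v z) \<le> 0" using Vsym by (auto simp: Y_def pos_def_def not_less)
      have zo: "(z $ q)\<^sup>2 \<le> z \<bullet> z"
        by (rule component_square_le_inner)
      have "z \<bullet> (V y *v z) = z \<bullet> (V (t - s) *v z) + 2 * s * (z $ q)\<^sup>2"
        using Vq[of z y "t - s"] by (simp add: s_def)
      also have "\<dots> \<le> 2 * s * (z \<bullet> z)" using z(2) mult_left_mono[OF zo, of "2 * s"] s by linarith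
      finally obtain i where i: "d $ i \<le> 2 * s" using conj_diag_eigenvalue_le[OF H(1) z(1)] H(2) by metis
      have "det (V y) = d $ i * (\<Prod>j\<in>UNIV - {i}. d $ j)"
        unfolding H(2) det_conj_diag[OF H(1)] by (rule prod.remove) auto
      also have "\<dots> \<le> (2 * s) * (\<Prod>j\<in>UNIV - {i}. T)"
        using i d dT s by (intro mult_mono prod_mono prod_nonneg) (auto intro: less_imp_le)
      also have "(\<Prod>j\<in>UNIV - {i}. T) = T ^ (CARD('k) - 1)" by (simp add: card_Diff_singleton)
      finally have det: "det (V y) \<le> (2 * T ^ (CARD('k) - 1)) * s" by (simp add: mult_ac)
      \<comment> \<open>As s < 1 and a1 \<ge> 1, the power s^(-a1) dominates 1 / s, which is not
        integrable at s = 0.\<close>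
      have "(2 * T ^ (CARD('k) - 1)) powr (- a1) * (1 / s) \<le> (2 * T ^ (CARD('k) - 1)) powr (- a1) * s powr (- a1)"
      proof (rule mult_left_mono)
        have "1 / s = s powr (- 1)" using s by (simp add: powr_minus_divide)
        also have "\<dots> \<le> s powr (- a1)" using s a1 by (intro powr_mono') auto
        finally show "1 / s \<le> s powr (- a1)" .
      qed simp
      also have "\<dots> = ((2 * T ^ (CARD('k) - 1)) * s) powr (- a1)" using s T by (simp add: powr_mult)
      also have "\<dots> \<le> det (V y) powr (- a1)"
        using det pos_def_det_pos[OF pd] a1 by (intro powr_mono2') auto
      finally have "c' * (1 / s) \<le> C1 * c * det (V y) powr (- a1)"
        unfolding c'_def mult.assoc using C1 c(1) by (intro mult_left_mono) auto
      hence "ennreal c' * ennreal (1 / (y - t)) \<le> ennreal (C1 * c * det (V y) powr (- a1))"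
        using c' s unfolding s_def by (subst ennreal_mult[symmetric]) (auto intro: ennreal_leI)
      thus ?thesis using True pd VS by (simp add: G_def g_def V_def)
    qed simp
    hence "(\<integral>\<^sup>+y. ennreal c' * (ennreal (1 / (y - t)) * indicator {t<..t + 1/2} y) \<partial>lborel) \<le> (\<integral>\<^sup>+y. G x y \<partial>lborel)"
      by (rule nn_integral_mono)
    moreover have "(\<integral>\<^sup>+y. ennreal c' * (ennreal (1 / (y - t)) * indicator {t<..t + 1/2} y) \<partial>lborel) = \<infinity>"
      using c' by (subst nn_integral_cmult) (auto simp: nn_integral_inverse_infinite ennreal_mult_top)
    ultimately show ?thesis by (simp add: top_unique)
  qed
  \<comment> \<open>The remaining coordinates fill a box of positive measure, and the inner integral
    is infinite at each of its points.\<close>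
  define Bx where "Bx = (\<Pi>\<^sub>E p\<in>P'. {(if fst p = snd p then 1 else 0) - \<delta> .. (if fst p = snd p then 1 else 0) + \<delta>})"
  have Bx: "Bx \<in> sets (\<Pi>\<^sub>M p\<in>P'. (lborel :: real measure))" unfolding Bx_def using P(3) by (intro sets_PiM_I_finite) auto
  have BxM: "emeasure (\<Pi>\<^sub>M p\<in>P'. (lborel :: real measure)) Bx = ennreal ((2 * \<delta>) ^ card P')"
    unfolding Bx_def using P(3) \<delta>(1) by (subst emeasure_PiM) (auto simp: ennreal_power)
  have "(\<integral>\<^sup>+V. g V \<partial>sym_lborel) = (\<integral>\<^sup>+v. g (sym_of_upper v) \<partial>(\<Pi>\<^sub>M p\<in>?P. (lborel :: real measure)))"
    unfolding sym_lborel_def by (rule nn_integral_distr[OF measurable_sym_of_upper]) (use g_meas in simp)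
  also have "\<dots> = (\<integral>\<^sup>+x. (\<integral>\<^sup>+y. G x y \<partial>lborel) \<partial>(\<Pi>\<^sub>M p\<in>P'. (lborel :: real measure)))"
    unfolding P(1) G_def
  proof (rule product_nn_integral_insert[OF P(3,2)])
    show "(\<lambda>v. g (sym_of_upper v)) \<in> borel_measurable (\<Pi>\<^sub>M p\<in>insert (q, q) P'. (lborel :: real measure))"
      using measurable_compose[OF measurable_sym_of_upper g_meas] unfolding P(1) .
  qed
  also have "\<dots> \<ge> (\<integral>\<^sup>+x. \<infinity> * indicator Bx x \<partial>(\<Pi>\<^sub>M p\<in>P'. (lborel :: real measure)))"
  proof (rule nn_integral_mono)
    fix x :: "'k \<times> 'k \<Rightarrow> real"
    show "\<infinity> * indicator Bx x \<le> (\<integral>\<^sup>+y. G x y \<partial>lborel)"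
    proof (cases "x \<in> Bx")
      case True
      have "\<bar>x (i, j) - (if i = j then 1 else 0)\<bar> \<le> \<delta>" if "i \<le> j" "(i, j) \<noteq> (q, q)" for i j
      proof -
        have "(i, j) \<in> P'" using that by (simp add: P'_def)
        hence "x (i, j) \<in> {(if i = j then 1 else 0) - \<delta> .. (if i = j then 1 else 0) + \<delta>}"
          using True unfolding Bx_def by (metis (mono_tags, lifting) PiE_mem fst_conv snd_conv)
        thus ?thesis by (auto simp: abs_le_iff split: if_splits)
      qed
      hence "(\<integral>\<^sup>+y. G x y \<partial>lborel) = \<infinity>" by (intro inner) blast
      thus ?thesis by simp
    qed simp
  qed
  moreover have "(\<integral>\<^sup>+x. \<infinity> * indicator Bx x \<partial>(\<Pi>\<^sub>M p\<in>P'. (lborel :: real measure))) = \<infinity>"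
    using Bx \<delta>(1) by (subst nn_integral_cmult_indicator) (auto simp: BxM ennreal_top_mult)
  ultimately have "(\<integral>\<^sup>+V. g V \<partial>sym_lborel) = \<infinity>" by (simp add: top_unique)
  thus ?thesis using ge by (simp add: top_unique)
qed

end

section \<open>Necessity of the condition on the second exponent\<close>

lemma prod_greater_pairs:
  fixes f :: "'k::{finite,linorder} \<Rightarrow> 'a::comm_semiring_1"
  shows "(\<Prod>p\<in>{(i, j). i < j}. f (fst p)) = (\<Prod>i\<in>UNIV. f i ^ card {j. i < j})"
proof -
  have "{(i :: 'k, j). i < j} = Sigma UNIV (\<lambda>i. {j. i < j})" by auto
  thus ?thesis
    by (simp add: prod.Sigma[of UNIV "\<lambda>i. {j. i < j}" "\<lambda>i j. f i", symmetric, unfolded case_prod_unfold])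
qed

text \<open>The bound on the small eigenvalues comes from the second elementary symmetric function of the
  spectrum, to which the rank-one part does not contribute.\<close>

lemma rank_one_perturbation:
  fixes V :: "'k::finite sqmat" and w :: "'k \<Rightarrow> real" and t :: real
  defines "k \<equiv> real CARD('k)"
  assumes sym: "transpose V = V" and t: "1 \<le> t" and w: "\<And>i. 0 \<le> w i" "\<And>i. w i \<le> t" "w q = t"
    and near: "\<And>i j. \<bar>V $ i $ j - (w i * w j / t + (if i = j then 1 else 0))\<bar> \<le> 1 / (2 * k)"
  shows "1 / 2 * (z \<bullet> z) \<le> z \<bullet> (V *v z)"
    and "orthogonal_matrix H \<Longrightarrow> V = conj_diag H d \<Longrightarrow> (\<And>i. d $ i \<le> d $ q) \<Longrightarrow> t / k \<le> d $ q"
    and "orthogonal_matrix H \<Longrightarrow> V = conj_diag H d \<Longrightarrow> (\<And>i. d $ i \<le> d $ q) \<Longrightarrow> d $ q \<le> 3 * k * t"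
    and "orthogonal_matrix H \<Longrightarrow> V = conj_diag H d \<Longrightarrow> (\<And>i. d $ i \<le> d $ q) \<Longrightarrow> i \<noteq> q \<Longrightarrow> d $ i \<le> 12 * k ^ 3"
proof -
  have k1: "k \<ge> 1" by (simp add: k_def Suc_leI)
  define \<delta> where "\<delta> = 1 / (2 * k)"
  have \<delta>: "0 < \<delta>" "\<delta> \<le> 1 / 2" "\<delta> * k = 1 / 2" using k1 by (auto simp: \<delta>_def field_simps)
  define R where "R i j = w i * w j / t" for i j
  define N where "N i j = V $ i $ j - R i j" for i j
  have V_eq: "V $ i $ j = R i j + N i j" for i j by (simp add: N_def)
  have N\<delta>: "\<bar>N i j - (if i = j then 1 else 0)\<bar> \<le> \<delta>" for i j
    using near[of i j] by (simp add: N_def R_def \<delta>_def algebra_simps)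
  have N2: "\<bar>N i j\<bar> \<le> 2" for i j using N\<delta>[of i j] \<delta> by (auto split: if_splits)
  have R0: "0 \<le> R i j" "R i j \<le> t" for i j
  proof -
    show "0 \<le> R i j" using w t by (simp add: R_def)
    have "w i * w j \<le> t * t" using w t by (intro mult_mono) auto
    thus "R i j \<le> t" using t by (simp add: R_def divide_le_eq)
  qed
  have RR: "R i i * R j j = (R i j)\<^sup>2" for i j by (simp add: R_def power2_eq_square)
  \<comment> \<open>The rank-one part is positive semidefinite and the identity gives the full
    square norm, of which the error takes at most half.\<close>
  have lower: "1 / 2 * (z \<bullet> z) \<le> z \<bullet> (V *v z)" for z
  proof -
    define E where "E = V - (\<chi> i j. R i j) - mat 1"
    have E: "\<bar>E $ i $ j\<bar> \<le> \<delta>" for i j using N\<delta>[of i j] by (simp add: E_def N_def mat_def)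
    have "V = (\<chi> i j. R i j) + mat 1 + E" by (simp add: E_def)
    hence "z \<bullet> (V *v z) = z \<bullet> ((\<chi> i j. R i j) *v z) + z \<bullet> z + z \<bullet> (E *v z)"
      by (simp add: matrix_vector_mult_add_rdistrib inner_add_right)
    moreover have "z \<bullet> ((\<chi> i j. R i j) *v z) = (\<Sum>i\<in>UNIV. w i * z $ i)\<^sup>2 / t"
      by (simp add: inner_vec_def matrix_vector_mult_def R_def power2_eq_square sum_product sum_distrib_left sum_divide_distrib mult_ac)
    moreover have "(\<Sum>i\<in>UNIV. w i * z $ i)\<^sup>2 / t \<ge> 0" using t by simp
    moreover have "\<bar>z \<bullet> (E *v z)\<bar> \<le> 1 / 2 * (z \<bullet> z)"
      using quadratic_form_bound[of E \<delta> z, OF E, folded k_def] by (simp only: \<delta>(3))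
    ultimately show ?thesis by linarith
  qed
  show "1 / 2 * (z \<bullet> z) \<le> z \<bullet> (V *v z)" by (rule lower)
  have tr: "t \<le> trace V" "trace V \<le> 3 * k * t"
  proof -
    have Vii: "0 \<le> V $ i $ i" "V $ i $ i \<le> 3 * t" for i
      using N\<delta>[of i i] R0[of i i] \<delta> t by (auto simp: V_eq)
    have "t \<le> V $ q $ q" using N\<delta>[of q q] \<delta> t w(3) by (simp add: V_eq R_def)
    also have "\<dots> \<le> trace V" unfolding trace_def using Vii by (intro member_le_sum) auto
    finally show "t \<le> trace V" .
    have "trace V \<le> (\<Sum>i\<in>(UNIV :: 'k set). 3 * t)" unfolding trace_def using Vii by (intro sum_mono)
    thus "trace V \<le> 3 * k * t" by (simp add: k_def mult_ac)
  qed
  \<comment> \<open>The left side is twice the second elementary symmetric function of the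
    eigenvalues, written as a sum of 2 by 2 principal minors.\<close>
  have minors: "(trace V)\<^sup>2 - trace (V ** V) \<le> 12 * k\<^sup>2 * t"
  proof -
    have Vs: "V $ j $ i = V $ i $ j" for i j using arg_cong[OF sym, of "\<lambda>M. M $ i $ j"] by (simp add: transpose_def)
    have "(trace V)\<^sup>2 - trace (V ** V) = (\<Sum>i\<in>UNIV. \<Sum>j\<in>UNIV. V $ i $ i * V $ j $ j - V $ i $ j * V $ i $ j)"
      by (simp add: trace_def power2_eq_square sum_product sum_subtractf matrix_matrix_mult_def Vs)
    also have "\<dots> \<le> (\<Sum>i\<in>(UNIV :: 'k set). \<Sum>j\<in>(UNIV :: 'k set). 12 * t)"
    proof (intro sum_mono)
      fix i j
      \<comment> \<open>The quadratic terms in R cancel because R has rank one, so each minor is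
        linear in t: at most 4 t + 4 + 4 t \<le> 12 t.\<close>
      have eq: "V $ i $ i * V $ j $ j - V $ i $ j * V $ i $ j =
        R i i * N j j + R j j * N i i + N i i * N j j - 2 * (R i j * N i j) - (N i j)\<^sup>2"
        using RR[of i j] by (simp add: V_eq power2_eq_square algebra_simps)
      have RN: "\<bar>R a b * N c d\<bar> \<le> t * 2" for a b c d
        unfolding abs_mult using R0 N2 t by (intro mult_mono) auto
      have NN: "\<bar>N i i * N j j\<bar> \<le> 2 * 2" unfolding abs_mult using N2 by (intro mult_mono) auto
      have "(N i j)\<^sup>2 \<ge> 0" by simp
      thus "V $ i $ i * V $ j $ j - V $ i $ j * V $ i $ j \<le> 12 * t"
        unfolding eq using RN[of i i j j] RN[of j j i i] RN[of i j i j] NN t by linarith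
    qed
    also have "\<dots> = 12 * k\<^sup>2 * t" by (simp add: k_def power2_eq_square)
    finally show ?thesis .
  qed
  assume H: "orthogonal_matrix H" and VH: "V = conj_diag H d" and top: "\<And>i. d $ i \<le> d $ q"
  have pos: "1 / 2 \<le> d $ i" for i
    using lower unfolding VH by (intro conj_diag_eigenvalue_ge[OF H])
  have nn: "0 \<le> d $ i" for i using pos[of i] by linarith
  have trd: "trace V = (\<Sum>i\<in>UNIV. d $ i)" unfolding VH by (rule trace_conj_diag[OF H])
  have "(\<Sum>i\<in>UNIV. d $ i) \<le> (\<Sum>i\<in>(UNIV :: 'k set). d $ q)" using top by (intro sum_mono)
  hence "t \<le> k * d $ q" using tr(1) trd by (simp add: k_def)
  thus tk: "t / k \<le> d $ q" using k1 by (simp add: divide_le_eq mult.commute)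
  have "d $ q \<le> (\<Sum>i\<in>UNIV. d $ i)" using nn by (intro member_le_sum) auto
  thus "d $ q \<le> 3 * k * t" using tr(2) trd by simp
  assume iq: "i \<noteq> q"
  have "trace (V ** V) = (\<Sum>i\<in>UNIV. d $ i * d $ i)"
    unfolding VH conj_diag_mult[OF H] by (simp add: trace_conj_diag[OF H])
  hence "(trace V)\<^sup>2 - trace (V ** V) = (\<Sum>j\<in>UNIV. d $ j * ((\<Sum>i\<in>UNIV. d $ i) - d $ j))"
    by (simp add: trd power2_eq_square sum_distrib_right right_diff_distrib sum_subtractf)
  \<comment> \<open>Keeping one summand bounds d_q times the sum of the other eigenvalues by 12 k^2
    t. Since d_q is at least t / k, that sum is at most 12 k^3, independently of t.\<close>
  also have "\<dots> \<ge> d $ q * ((\<Sum>i\<in>UNIV. d $ i) - d $ q)"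
  proof (rule member_le_sum)
    fix j
    have "0 \<le> d $ i" for i using pos[of i] by linarith
    moreover from this have "d $ j \<le> (\<Sum>i\<in>UNIV. d $ i)" by (intro member_le_sum) auto
    ultimately show "0 \<le> d $ j * ((\<Sum>i\<in>UNIV. d $ i) - d $ j)" by simp
  qed auto
  finally have 1: "d $ q * ((\<Sum>i\<in>UNIV. d $ i) - d $ q) \<le> 12 * k\<^sup>2 * t" using minors by linarith
  have "d $ i \<le> (\<Sum>j\<in>UNIV - {q}. d $ j)"
    using iq nn by (intro member_le_sum) auto
  also have "\<dots> = (\<Sum>j\<in>UNIV. d $ j) - d $ q" by (simp add: sum_diff1)
  finally have 2: "d $ i \<le> (\<Sum>j\<in>UNIV. d $ j) - d $ q" .
  have "t / k * d $ i \<le> d $ q * ((\<Sum>j\<in>UNIV. d $ j) - d $ q)"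
  proof (rule mult_mono[OF tk 2])
    show "0 \<le> d $ q" "0 \<le> d $ i" using pos[of q] pos[of i] by linarith+
  qed
  hence "t / k * d $ i \<le> 12 * k\<^sup>2 * t" using 1 by linarith
  hence "t * d $ i \<le> t * (12 * k ^ 3)" using k1 by (simp add: field_simps power2_eq_square power3_eq_cube)
  thus "d $ i \<le> 12 * k ^ 3" using t by simp
qed

context comparable_prior
begin

text \<open>Only the first eigenvalue grows. It enters k - 1 differences, so the Vandermonde product
  is at most of order t^(k - 1), and both determinants are of order t; the exponent collects these
  powers. The constant must not depend on t.\<close>

lemma weight_ge_tail:
  fixes q :: 'k and B r :: real
  defines "k \<equiv> real CARD('k)"
  assumes q: "\<And>i. q \<le> i" and B: "B > 0"
  shows "\<exists>c>0. \<forall>d\<in>spectral_cone. \<forall>t\<ge>1. (\<forall>i. 1 / 2 \<le> d $ i) \<longrightarrow> t / k \<le> d $ q \<longrightarrow> d $ q \<le> 3 * k * t \<longrightarrow>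
     (\<forall>i. i \<noteq> q \<longrightarrow> d $ i \<le> B) \<longrightarrow> c * t powr ((k - 1) * (l - 1) - a2 - r) \<le> weight r d"
proof -
  have k1: "k \<ge> 1" by (simp add: k_def Suc_leI)
  have kn: "real (CARD('k) - 1) = k - 1" by (simp add: k_def of_nat_diff Suc_leI)
  define x where "x = a1 - a2 - r"
  define B' where "B' = (\<Prod>i\<in>UNIV - {q}. B ^ card {j. i < j})"
  define M where "M = (3 * k) ^ (CARD('k) - 1) * B'"
  define lo where "lo = 1 / k * (1 / 2) ^ (CARD('k) - 1)"
  define hi where "hi = 3 * k * B ^ (CARD('k) - 1)"
  define c where "c = M powr (l - 1) * (min (1 powr x) ((3 ^ CARD('k)) powr x) * min (lo powr (x - a1)) (hi powr (x - a1)))"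
  have B'0: "B' > 0" using B by (auto simp: B'_def intro!: prod_pos)
  have M0: "M > 0" using B'0 k1 by (simp add: M_def)
  have lohi: "0 < lo" "0 < hi" using k1 B by (auto simp: lo_def hi_def)
  have split: "(\<Prod>i\<in>UNIV. f i) = f q * (\<Prod>i\<in>UNIV - {q}. f i)" for f :: "'k \<Rightarrow> real"
    by (rule prod.remove) auto
  show ?thesis
  proof (intro exI[of _ c] conjI ballI allI impI)
    show "c > 0" using M0 lohi by (simp add: c_def)
    fix d :: "'k rvec" and t :: real
    assume d: "d \<in> spectral_cone" and t: "1 \<le> t" and half_all: "\<forall>i. 1 / 2 \<le> d $ i"
      and dq: "t / k \<le> d $ q" "d $ q \<le> 3 * k * t" and dB_all: "\<forall>i. i \<noteq> q \<longrightarrow> d $ i \<le> B"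
    note half = half_all[rule_format] and dB = dB_all[rule_format]
    define P where "P = (\<Prod>i\<in>UNIV. 1 + d $ i)"
    define Q where "Q = (\<Prod>i\<in>UNIV. d $ i)"
    have PQ: "P > 0" "Q > 0" using cone_prods[OF d] by (auto simp: P_def Q_def)
    have pos: "0 < d $ i" for i using d by (simp add: spectral_cone_def)
    define \<beta> where "\<beta> i = (if i = q then 3 * k * t else B)" for i
    have d\<beta>: "d $ i \<le> \<beta> i" for i using dq dB by (simp add: \<beta>_def)
    have "vandermonde d = (\<Prod>p\<in>{(i, j). i < j}. d $ fst p - d $ snd p)"
      by (simp add: vandermonde_def case_prod_unfold)
    also have "\<dots> \<le> (\<Prod>p\<in>{(i, j). i < j}. \<beta> (fst p))"
    proof (rule prod_mono)
      fix p :: "'k \<times> 'k" assume "p \<in> {(i, j). i < j}"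
      hence "d $ snd p < d $ fst p" using d by (auto simp: spectral_cone_def)
      thus "0 \<le> d $ fst p - d $ snd p \<and> d $ fst p - d $ snd p \<le> \<beta> (fst p)"
        using pos[of "snd p"] d\<beta>[of "fst p"] by auto
    qed
    also have "\<dots> = (\<Prod>i\<in>UNIV. \<beta> i ^ card {j. i < j})" by (rule prod_greater_pairs)
    also have "\<dots> = (3 * k * t) ^ card {j. q < j} * B'"
      unfolding split[of "\<lambda>i. \<beta> i ^ card {j. i < j}"] B'_def by (simp add: \<beta>_def)
    also have "{j. q < j} = UNIV - {q}" using q by (auto simp: order_less_le)
    also have "card (UNIV - {q}) = CARD('k) - 1" by (simp add: card_Diff_singleton)
    also have "(3 * k * t) ^ (CARD('k) - 1) * B' = M * t ^ (CARD('k) - 1)"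
      by (simp add: M_def power_mult_distrib)
    finally have vM: "vandermonde d \<le> M * t ^ (CARD('k) - 1)" .
    have "M powr (l - 1) * t powr ((k - 1) * (l - 1)) = (M * t ^ (CARD('k) - 1)) powr (l - 1)"
      using M0 t by (simp add: powr_mult powr_realpow[symmetric] powr_powr k_def of_nat_diff Suc_leI)
    also have "\<dots> \<le> vandermonde d powr (l - 1)"
      using vM l spectral_cone_vandermonde_pos[OF d] by (intro powr_mono2') auto
    finally have 1: "M powr (l - 1) * t powr ((k - 1) * (l - 1)) \<le> vandermonde d powr (l - 1)" .
    have Pl: "Q \<le> P" unfolding P_def Q_def using pos by (intro prod_mono) (auto intro: less_imp_le)
    \<comment> \<open>Eigenvalues of at least 1/2 satisfy 1 + d_i \<le> 3 d_i, so the two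
      determinants are comparable and a power of either sign can be moved from one to the
      other.\<close>
    have "P \<le> (\<Prod>i\<in>UNIV. 3 * d $ i)" unfolding P_def
    proof (rule prod_mono)
      fix i show "0 \<le> 1 + d $ i \<and> 1 + d $ i \<le> 3 * d $ i" using half[of i] by auto
    qed
    also have "\<dots> = 3 ^ CARD('k) * Q" by (simp add: Q_def prod.distrib)
    finally have Pu: "P \<le> 3 ^ CARD('k) * Q" .
    have "min (1 powr x) ((3 ^ CARD('k)) powr x) \<le> (P / Q) powr x"
      using Pl Pu PQ by (intro powr_ge_min) (auto simp: divide_le_eq le_divide_eq)
    hence 2: "min (1 powr x) ((3 ^ CARD('k)) powr x) * Q powr x \<le> P powr x"
      using PQ by (simp add: powr_divide le_divide_eq)
    have prodq: "(1 / 2) ^ (CARD('k) - 1) \<le> (\<Prod>i\<in>UNIV - {q}. d $ i)" "(\<Prod>i\<in>UNIV - {q}. d $ i) \<le> B ^ (CARD('k) - 1)"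
    proof -
      have "(\<Prod>i\<in>UNIV - {q}. (1 / 2 :: real)) \<le> (\<Prod>i\<in>UNIV - {q}. d $ i)" using half by (intro prod_mono) auto
      thus "(1 / 2) ^ (CARD('k) - 1) \<le> (\<Prod>i\<in>UNIV - {q}. d $ i)" by (simp add: card_Diff_singleton)
      have "(\<Prod>i\<in>UNIV - {q}. d $ i) \<le> (\<Prod>i\<in>UNIV - {q}. B)"
        using dB pos by (intro prod_mono) (auto intro: less_imp_le)
      thus "(\<Prod>i\<in>UNIV - {q}. d $ i) \<le> B ^ (CARD('k) - 1)" by (simp add: card_Diff_singleton)
    qed
    have "t / k * (1 / 2) ^ (CARD('k) - 1) \<le> Q"
      unfolding Q_def split[of "\<lambda>i. d $ i"] using dq(1) prodq(1) pos[of q] by (intro mult_mono) (auto intro: less_imp_le)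
    hence Ql: "lo \<le> Q / t" using t by (simp add: lo_def le_divide_eq mult_ac)
    have "Q \<le> (3 * k * t) * B ^ (CARD('k) - 1)"
      unfolding Q_def split[of "\<lambda>i. d $ i"] using dq(2) prodq(2) pos k1 t by (intro mult_mono prod_nonneg) (auto intro: less_imp_le)
    hence Qu: "Q / t \<le> hi" using t by (simp add: hi_def divide_le_eq mult_ac)
    have "min (lo powr (x - a1)) (hi powr (x - a1)) \<le> (Q / t) powr (x - a1)"
      using Ql Qu lohi by (intro powr_ge_min)
    hence 3: "min (lo powr (x - a1)) (hi powr (x - a1)) * t powr (x - a1) \<le> Q powr (x - a1)"
      using PQ t by (simp add: powr_divide le_divide_eq)
    have te: "t powr ((k - 1) * (l - 1) - a2 - r) = t powr ((k - 1) * (l - 1)) * t powr (x - a1)"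
    proof -
      have "(k - 1) * (l - 1) - a2 - r = (k - 1) * (l - 1) + (x - a1)" by (simp add: x_def)
      thus ?thesis by (simp only: powr_add)
    qed
    have "c * t powr ((k - 1) * (l - 1) - a2 - r) =
       (M powr (l - 1) * t powr ((k - 1) * (l - 1))) * (min (1 powr x) ((3 ^ CARD('k)) powr x) * (min (lo powr (x - a1)) (hi powr (x - a1)) * t powr (x - a1)))"
      unfolding te c_def by (simp only: mult_ac)
    also have "\<dots> \<le> vandermonde d powr (l - 1) * (min (1 powr x) ((3 ^ CARD('k)) powr x) * Q powr (x - a1))"
      using 1 3 lohi by (intro mult_mono mult_nonneg_nonneg) auto
    also have "Q powr (x - a1) = Q powr x * Q powr (- a1)" by (simp add: powr_add[symmetric])
    also have "vandermonde d powr (l - 1) * (min (1 powr x) ((3 ^ CARD('k)) powr x) * (Q powr x * Q powr (- a1)))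
       \<le> vandermonde d powr (l - 1) * (P powr x * Q powr (- a1))"
      using 2 by (intro mult_left_mono) (auto simp: mult.assoc[symmetric] intro!: mult_right_mono)
    also have "\<dots> = weight r d" by (simp add: weight_def x_def P_def Q_def)
    finally show "c * t powr ((k - 1) * (l - 1) - a2 - r) \<le> weight r d" .
  qed
qed

text \<open>The boxes around the matrices \<open>w w\<^sup>T / t + I\<close>, where \<open>w\<close> has integer entries between \<open>0\<close> and
  \<open>w\<^sub>q = t\<close>, are disjoint and of equal measure, and there are \<open>t\<close> to the power \<open>k - 1\<close> of them for each \<open>t\<close>.\<close>

theorem reduced_integral_tail:
  fixes r :: real
  defines "e \<equiv> (real CARD('k) - 1) * l - a2 - r"
  obtains c where "c > 0" "\<And>T :: nat. ennreal (c * (\<Sum>t=1..T. real t powr e)) \<le> (\<integral>\<^sup>+V. reduced_density r V \<partial>sym_lborel)"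
proof -
  define k where "k = real CARD('k)"
  have k1: "k \<ge> 1" by (simp add: k_def Suc_leI)
  have kn: "real (CARD('k) - 1) = k - 1" by (simp add: k_def of_nat_diff Suc_leI)
  \<comment> \<open>The first index, because the decreasing order assigns the largest eigenvalue to
    it.\<close>
  define q :: 'k where "q = Min UNIV"
  have q: "q \<le> i" for i unfolding q_def by (rule Min_le) auto
  define \<delta> where "\<delta> = 1 / (2 * k)"
  have \<delta>: "0 < \<delta>" "\<delta> \<le> 1 / 2" using k1 by (auto simp: \<delta>_def field_simps)
  define e' where "e' = (k - 1) * (l - 1) - a2 - r"
  have "12 * k ^ 3 > 0" using k1 by simp
  from weight_ge_tail[OF q this, of r, folded k_def, folded e'_def]
  obtain c where c: "c > 0" "\<forall>d\<in>spectral_cone. \<forall>t\<ge>1. (\<forall>i. 1 / 2 \<le> d $ i) \<longrightarrow> t / k \<le> d $ q \<longrightarrow> d $ q \<le> 3 * k * t \<longrightarrow>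
     (\<forall>i. i \<noteq> q \<longrightarrow> d $ i \<le> 12 * k ^ 3) \<longrightarrow> c * t powr e' \<le> weight r d" by (elim exE conjE)
  define w where "w t v i = (if i = q then real t else real (v i))" for t :: nat and v :: "'k \<Rightarrow> nat" and i
  define m where "m t v i j = w t v i * w t v j / real t + (if i = j then 1 else 0)" for t v i j
  define Bx where "Bx t v = sym_box (m t v) (\<lambda>i j. m t v i j + \<delta>)" for t v
  define N where "N = card {(i :: 'k, j). i \<le> j}"
  have BxM: "emeasure sym_lborel (Bx t v) = ennreal (\<delta> ^ N)" for t v
    unfolding Bx_def using \<delta> by (subst emeasure_sym_box) (auto simp: N_def case_prod_unfold)
  \<comment> \<open>Row q of the lower corner displays the labels: since w_q = t, its diagonal entry
    is t + 1 and its other entries are v_i. As \<delta> \<le> 1/2, these integers can be read off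
    from any matrix in the box, which gives disjointness.\<close>
  have Bxq: "real t + 1 \<le> V $ q $ q" "V $ q $ q \<le> real t + 1 + \<delta>" "\<And>i. i \<noteq> q \<Longrightarrow> real (v i) \<le> V $ q $ i"
      "\<And>i. i \<noteq> q \<Longrightarrow> V $ q $ i \<le> real (v i) + \<delta>" if "V \<in> Bx t v" "1 \<le> t" for V t v
  proof -
    have b: "i \<le> j \<Longrightarrow> m t v i j \<le> V $ i $ j \<and> V $ i $ j \<le> m t v i j + \<delta>" for i j
      using that(1) by (simp add: Bx_def sym_box_def)
    show "real t + 1 \<le> V $ q $ q" "V $ q $ q \<le> real t + 1 + \<delta>"
      using b[of q q] that(2) by (auto simp: m_def w_def)
    show "real (v i) \<le> V $ q $ i" "V $ q $ i \<le> real (v i) + \<delta>" if "i \<noteq> q" for i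
      using b[OF q[of i]] that \<open>1 \<le> t\<close> by (auto simp: m_def w_def)
  qed
  have nat_close: "a = b" if "real a \<le> y" "y \<le> real a + \<delta>" "real b \<le> y" "y \<le> real b + \<delta>" for a b :: nat and y
    using that \<delta>(2) by linarith
  \<comment> \<open>Values below t keep w_i \<le> t as \<open>rank_one_perturbation\<close>
    requires, and leave t^(k - 1) choices of \<open>v\<close> for each t.\<close>
  define I where "I T = Sigma {1..T} (\<lambda>t. (UNIV - {q}) \<rightarrow>\<^sub>E {..<t})" for T :: nat
  have finI: "finite (I T)" for T unfolding I_def by (intro finite_SigmaI finite_PiE) auto
  have disj: "p = p'" if p: "p \<in> I T" "V \<in> Bx (fst p) (snd p)" and p': "p' \<in> I T" "V \<in> Bx (fst p') (snd p')" for p p' T V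
  proof -
    obtain t v where tv: "p = (t, v)" by (cases p)
    obtain t' v' where tv': "p' = (t', v')" by (cases p')
    have t: "1 \<le> t" "1 \<le> t'" and v: "v \<in> (UNIV - {q}) \<rightarrow>\<^sub>E {..<t}" "v' \<in> (UNIV - {q}) \<rightarrow>\<^sub>E {..<t'}"
      using p(1) p'(1) by (auto simp: I_def tv tv')
    have V: "V \<in> Bx t v" "V \<in> Bx t' v'" using p(2) p'(2) by (auto simp: tv tv')
    have "t = t'" using Bxq(1,2)[OF V(1) t(1)] Bxq(1,2)[OF V(2) t(2)]
      by (intro nat_close[of _ "V $ q $ q - 1"]) auto
    moreover have "v = v'"
    proof (rule PiE_ext[OF v(1)])
      show "v' \<in> (UNIV - {q}) \<rightarrow>\<^sub>E {..<t}" using v(2) \<open>t = t'\<close> by simp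
      fix i assume "i \<in> UNIV - {q}"
      thus "v i = v' i" using Bxq(3,4)[OF V(1) t(1), of i] Bxq(3,4)[OF V(2) t(2), of i]
        by (intro nat_close[of _ "V $ q $ i"]) auto
    qed
    ultimately show ?thesis by (simp add: tv tv')
  qed
  define K where "K = C1 * c"
  have K: "K > 0" using C1 c by (simp add: K_def)
  have bound: "AE V in sym_lborel. \<forall>t v. 1 \<le> t \<longrightarrow> v \<in> (UNIV - {q}) \<rightarrow>\<^sub>E {..<t} \<longrightarrow> V \<in> Bx t v \<longrightarrow>
     ennreal (K * real t powr e') \<le> reduced_density r V"
    using AE_reduced_density_ge[where r = r] AE_sym_lborel
  proof eventually_elim
    case (elim V)
    show ?case
    proof (intro allI impI)
      fix t v assume t: "1 \<le> t" and v: "v \<in> (UNIV - {q}) \<rightarrow>\<^sub>E {..<t}" and V: "V \<in> Bx t v"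
      have w: "0 \<le> w t v i" "w t v i \<le> real t" "w t v q = real t" for i
      proof -
        show "0 \<le> w t v i" "w t v q = real t" by (auto simp: w_def)
        show "w t v i \<le> real t"
        proof (cases "i = q")
          case False
          hence "v i \<in> {..<t}" using v by (intro PiE_mem[OF v]) auto
          thus ?thesis using False by (simp add: w_def)
        qed (simp add: w_def)
      qed
      have sym: "V $ j $ i = V $ i $ j" for i j
        using arg_cong[OF elim(2), of "\<lambda>M. M $ i $ j"] by (simp add: transpose_def)
      have near: "\<bar>V $ i $ j - (w t v i * w t v j / real t + (if i = j then 1 else 0))\<bar> \<le> 1 / (2 * real CARD('k))" for i j
      proof -
        have b: "m t v i j \<le> V $ i $ j \<and> V $ i $ j \<le> m t v i j + \<delta>" if "i \<le> j" for i j
          using V that by (simp add: Bx_def sym_box_def)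
        have ms: "m t v i j = m t v j i" by (simp add: m_def mult.commute)
        have "m t v i j \<le> V $ i $ j \<and> V $ i $ j \<le> m t v i j + \<delta>"
          using b[of i j] b[of j i] ms sym[of i j] by (cases "i \<le> j") auto
        hence "\<bar>V $ i $ j - m t v i j\<bar> \<le> \<delta>" by auto
        thus ?thesis by (simp add: m_def \<delta>_def k_def)
      qed
      have t': "1 \<le> real t" using t by simp
      note rop = rank_one_perturbation[OF elim(2) t' w near, folded k_def]
      have low: "1 / 2 * (z \<bullet> z) \<le> z \<bullet> (V *v z)" for z by (rule rop(1))
      have "pos_def V" unfolding pos_def_def
      proof (intro conjI allI impI elim(2))
        fix z :: "'k rvec" assume "z \<noteq> 0"
        hence "0 < 1 / 2 * (z \<bullet> z)" by simp
        thus "0 < z \<bullet> (V *v z)" using low by (rule less_le_trans)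
      qed
      with elim(1) obtain H d where H: "orthogonal_matrix H" "d \<in> spectral_cone" "V = conj_diag H d"
        and wd: "ennreal (C1 * weight r d) \<le> reduced_density r V" by blast
      have top: "d $ i \<le> d $ q" for i
        using H(2) q[of i] by (cases "i = q") (auto simp: spectral_cone_def less_imp_le order_less_le)
      have half: "1 / 2 \<le> d $ i" for i
        using low unfolding H(3) by (intro conj_diag_eigenvalue_ge[OF H(1)])
      have "c * real t powr e' \<le> weight r d"
        using rop(2-4)[OF H(1,3) top] half t' c(2)[rule_format, OF H(2)] by blast
      hence "ennreal (K * real t powr e') \<le> ennreal (C1 * weight r d)"
        using C1 by (intro ennreal_leI) (simp add: K_def mult.assoc)
      thus "ennreal (K * real t powr e') \<le> reduced_density r V" using wd by (rule order_trans)
    qed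
  qed
  \<comment> \<open>The number of boxes at level t raises the exponent (k - 1) (l - 1) - a2 - r of
    the density to (k - 1) l - a2 - r.\<close>
  have te: "real t ^ (CARD('k) - 1) * real t powr e' = real t powr e" if "1 \<le> t" for t :: nat
  proof -
    have "real t ^ (CARD('k) - 1) = real t powr (k - 1)" using that by (simp add: powr_realpow[symmetric] k_def of_nat_diff Suc_leI)
    thus ?thesis by (simp add: powr_add[symmetric] e_def e'_def k_def algebra_simps)
  qed
  show ?thesis
  proof (rule that)
    show "K * \<delta> ^ N > 0" using K \<delta> by simp
    fix T :: nat
    have cardI: "card ((UNIV - {q}) \<rightarrow>\<^sub>E {..<t}) = t ^ (CARD('k) - 1)" for t :: nat
      by (simp add: card_PiE card_Diff_singleton)
    have "(\<Sum>p\<in>I T. K * real (fst p) powr e' * \<delta> ^ N) = (\<Sum>t=1..T. \<Sum>v\<in>(UNIV - {q}) \<rightarrow>\<^sub>E {..<t}. K * real t powr e' * \<delta> ^ N)"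
      unfolding I_def by (subst sum.Sigma) (auto simp: case_prod_unfold intro!: finite_PiE)
    also have "\<dots> = (\<Sum>t=1..T. (K * \<delta> ^ N) * (real t ^ (CARD('k) - 1) * real t powr e'))"
      by (simp add: cardI mult_ac)
    also have "\<dots> = (\<Sum>t=1..T. (K * \<delta> ^ N) * real t powr e)"
    proof (rule sum.cong[OF refl])
      fix t assume "t \<in> {1..T}"
      hence "1 \<le> t" by simp
      from te[OF this] show "(K * \<delta> ^ N) * (real t ^ (CARD('k) - 1) * real t powr e') = (K * \<delta> ^ N) * real t powr e"
        by (simp only:)
    qed
    finally have "K * \<delta> ^ N * (\<Sum>t=1..T. real t powr e) = (\<Sum>p\<in>I T. K * real (fst p) powr e' * \<delta> ^ N)"
      by (simp add: sum_distrib_left)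
    hence "ennreal (K * \<delta> ^ N * (\<Sum>t=1..T. real t powr e)) = (\<Sum>p\<in>I T. ennreal (K * real (fst p) powr e' * \<delta> ^ N))"
      using K \<delta>(1) by (simp add: sum_ennreal)
    also have "\<dots> = (\<Sum>p\<in>I T. ennreal (K * real (fst p) powr e') * emeasure sym_lborel (Bx (fst p) (snd p)))"
      using K \<delta>(1) by (simp add: BxM ennreal_mult)
    also have "\<dots> = (\<Sum>p\<in>I T. \<integral>\<^sup>+V. ennreal (K * real (fst p) powr e') * indicator (Bx (fst p) (snd p)) V \<partial>sym_lborel)"
      by (intro sum.cong refl nn_integral_cmult_indicator[symmetric]) (simp add: Bx_def)
    also have "\<dots> = (\<integral>\<^sup>+V. (\<Sum>p\<in>I T. ennreal (K * real (fst p) powr e') * indicator (Bx (fst p) (snd p)) V) \<partial>sym_lborel)"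
      by (rule nn_integral_sum[symmetric]) (simp add: Bx_def)
    also have "\<dots> \<le> (\<integral>\<^sup>+V. reduced_density r V \<partial>sym_lborel)"
    proof (rule nn_integral_mono_AE)
      show "AE V in sym_lborel. (\<Sum>p\<in>I T. ennreal (K * real (fst p) powr e') * indicator (Bx (fst p) (snd p)) V) \<le> reduced_density r V"
        using bound
      proof eventually_elim
        case (elim V)
        show ?case
        proof (cases "\<exists>p\<in>I T. V \<in> Bx (fst p) (snd p)")
          case True
          then obtain p where p: "p \<in> I T" "V \<in> Bx (fst p) (snd p)" by blast
          have "(\<Sum>p\<in>I T. ennreal (K * real (fst p) powr e') * indicator (Bx (fst p) (snd p)) V) =
             (\<Sum>p'\<in>I T. if p' = p then ennreal (K * real (fst p) powr e') else 0)"
          proof (rule sum.cong[OF refl])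
            fix p' assume p': "p' \<in> I T"
            show "ennreal (K * real (fst p') powr e') * indicator (Bx (fst p') (snd p')) V =
               (if p' = p then ennreal (K * real (fst p) powr e') else 0)"
            proof (cases "p' = p")
              case False
              hence "V \<notin> Bx (fst p') (snd p')" using disj[OF p p'] by blast
              thus ?thesis using False by simp
            qed (use p in simp)
          qed
          also have "\<dots> = ennreal (K * real (fst p) powr e')" using p(1) finI by simp
          also have "\<dots> \<le> reduced_density r V"
          proof -
            have "(fst p, snd p) \<in> I T" using p(1) by simp
            hence "fst p \<in> {1..T} \<and> snd p \<in> (UNIV - {q}) \<rightarrow>\<^sub>E {..<fst p}" by (simp only: I_def mem_Sigma_iff)
            moreover from this have "1 \<le> fst p" by simp
            ultimately show ?thesis using elim p(2) by blast
          qed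
          finally show ?thesis .
        next
          case False
          hence "(\<Sum>p\<in>I T. ennreal (K * real (fst p) powr e') * indicator (Bx (fst p) (snd p)) V) = 0"
            by (intro sum.neutral) auto
          thus ?thesis by simp
        qed
      qed
    qed
    finally show "ennreal (K * \<delta> ^ N * (\<Sum>t=1..T. real t powr e)) \<le> (\<integral>\<^sup>+V. reduced_density r V \<partial>sym_lborel)" .
  qed
qed

text \<open>The tail bound with the single term t = 1 already gives a positive lower bound.\<close>

corollary reduced_integral_pos: "0 < (\<integral>\<^sup>+V. reduced_density r V \<partial>sym_lborel)"
proof -
  obtain c where c: "c > 0" "\<And>T :: nat. ennreal (c * (\<Sum>t=1..T. real t powr ((real CARD('k) - 1) * l - a2 - r))) \<le> (\<integral>\<^sup>+V. reduced_density r V \<partial>sym_lborel)"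
    using reduced_integral_tail by metis
  have "0 < ennreal c" using c(1) by simp
  also have "\<dots> \<le> (\<integral>\<^sup>+V. reduced_density r V \<partial>sym_lborel)" using c(2)[of 1] by simp
  finally show ?thesis .
qed

text \<open>A finite integral bounds the partial sums of a p-series, whose exponent e must then lie
  below -1; this is the inequality for a2.\<close>

corollary reduced_integral_finite_imp:
  assumes fin: "(\<integral>\<^sup>+V. reduced_density r V \<partial>sym_lborel) < \<infinity>"
  shows "a2 > 1 - r + (real CARD('k) - 1) * l"
proof -
  define e where "e = (real CARD('k) - 1) * l - a2 - r"
  obtain c where c: "c > 0" "\<And>T :: nat. ennreal (c * (\<Sum>t=1..T. real t powr e)) \<le> (\<integral>\<^sup>+V. reduced_density r V \<partial>sym_lborel)"
    unfolding e_def using reduced_integral_tail by metis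
  obtain R where R: "R \<ge> 0" "(\<integral>\<^sup>+V. reduced_density r V \<partial>sym_lborel) = ennreal R"
    using fin by (cases "\<integral>\<^sup>+V. reduced_density r V \<partial>sym_lborel" rule: ennreal_cases) auto
  have "(\<Sum>t=1..T. real t powr e) \<le> R / c" for T
    using c(2)[of T] c(1) R by (simp add: le_divide_eq mult.commute)
  hence "(\<Sum>t<T. real t powr e) \<le> R / c" for T
  proof -
    \<comment> \<open>The index 0 adds nothing, because \<open>0 powr e\<close> is 0 for every
      e.\<close>
    have "(\<Sum>t<T. real t powr e) \<le> (\<Sum>t\<in>insert 0 {1..T}. real t powr e)"
      by (intro sum_mono2) (auto simp: Suc_le_eq)
    also have "\<dots> = (\<Sum>t=1..T. real t powr e)" by simp
    also have "\<dots> \<le> R / c" by fact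
    finally show ?thesis .
  qed
  hence "summable (\<lambda>t. real t powr e)" by (intro summableI_nonneg_bounded) auto
  hence "e < - 1" by (simp add: summable_real_powr_iff)
  thus ?thesis by (simp add: e_def)
qed

end

theorem theorem2p7:
  fixes A :: "real ^ 'k::{finite,linorder} ^ 'k::{finite,linorder}"
    and \<pi>V :: "real ^ 'k::{finite,linorder} ^ 'k::{finite,linorder} \<Rightarrow> real"
    and x :: "real ^ 'k::{finite,linorder} ^ 'm"
    and a1 a2 l C1 C2 :: real
  assumes "CARD('k) \<ge> 2"
    and "0 \<le> l" and "l \<le> 1"
    and "pos_def A"
    and "prior_V \<pi>V"
    and "C1 > 0" and "C2 > 0"
    and "\<And>(H :: real ^ 'k::{finite,linorder} ^ 'k::{finite,linorder}) (d :: real ^ 'k::{finite,linorder}).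
           orthogonal_matrix H \<Longrightarrow> (\<forall>i j. i < j \<longrightarrow> d $ j < d $ i) \<Longrightarrow> (\<forall>i. 0 < d $ i) \<Longrightarrow>
             C1 * vandermonde d powr l
               / (det (mat 1 + diag_mat d) powr (a2 - a1) * det (diag_mat d) powr a1)
               \<le> prior_HD \<pi>V H d
           \<and> prior_HD \<pi>V H d
               \<le> C2 * vandermonde d powr l
                   / (det (mat 1 + diag_mat d) powr (a2 - a1) * det (diag_mat d) powr a1)"
  shows "posterior_exists (mvn_density 0 A) \<pi>V x
           \<longleftrightarrow> a1 < 1 \<and> a2 > 1 - real CARD('m) / 2 + real (CARD('k) - 1) * l"
proof -
  interpret comparable_prior \<pi>V a1 a2 l C1 C2
    by unfold_locales (use assms in \<open>auto simp: spectral_cone_def\<close>)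
  define r where "r = real CARD('m) / 2"
  define J where "J = (\<integral>\<^sup>+V. reduced_density r V \<partial>sym_lborel)"
  have r: "- r = - real CARD('m) / 2" by (simp add: r_def)
  have J_eq: "J = (\<integral>\<^sup>+V. ennreal (det (mat 1 + V) powr (- real CARD('m) / 2)) *
      (ennreal (\<pi>V V) * indicator {V. pos_def V} V) \<partial>sym_lborel)"
    unfolding J_def reduced_density_def r ..
  obtain c1 c2 :: ennreal where c: "0 < c1" "c2 < \<infinity>"
    "c1 * J \<le> marginal (mvn_density 0 A) \<pi>V x" "marginal (mvn_density 0 A) \<pi>V x \<le> c2 * J"
    by (rule marginal_bounds[OF assms(4,5), of x, folded J_eq]) (rule that)
  \<comment> \<open>Positivity holds for all exponents, so the equivalence rests on finiteness of
    \<open>J\<close> alone.\<close>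
  have J0: "0 < J" unfolding J_def by (rule reduced_integral_pos)
  have "0 < c1 * J" using c(1) J0 by (simp add: ennreal_zero_less_mult_iff)
  hence pos: "0 < marginal (mvn_density 0 A) \<pi>V x" using c(3) by (rule less_le_trans)
  have k: "real (CARD('k) - 1) = real CARD('k) - 1" by (simp add: of_nat_diff Suc_leI)
  have "marginal (mvn_density 0 A) \<pi>V x < \<infinity> \<longleftrightarrow> J < \<infinity>"
  proof
    assume "marginal (mvn_density 0 A) \<pi>V x < \<infinity>"
    hence "c1 * J < \<infinity>" using c(3) by (rule le_less_trans[rotated])
    thus "J < \<infinity>" using c(1) by (auto simp: ennreal_mult_less_top)
  next
    assume "J < \<infinity>"
    hence "c2 * J < \<infinity>" using c(2) by (simp add: ennreal_mult_less_top)
    thus "marginal (mvn_density 0 A) \<pi>V x < \<infinity>" using c(4) by (rule le_less_trans[rotated])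
  qed
  also have "J < \<infinity> \<longleftrightarrow> a1 < 1 \<and> a2 > 1 - r + (real CARD('k) - 1) * l"
  proof
    assume fin: "J < \<infinity>"
    have "a1 < 1"
    proof (rule ccontr)
      assume "\<not> a1 < 1"
      hence "J = \<infinity>" unfolding J_def by (intro reduced_integral_infinite) simp
      thus False using fin by simp
    qed
    moreover have "a2 > 1 - r + (real CARD('k) - 1) * l"
      using fin unfolding J_def by (rule reduced_integral_finite_imp)
    ultimately show "a1 < 1 \<and> a2 > 1 - r + (real CARD('k) - 1) * l" ..
  next
    assume "a1 < 1 \<and> a2 > 1 - r + (real CARD('k) - 1) * l"
    thus "J < \<infinity>" unfolding J_def by (intro reduced_integral_finite) auto
  qed
  finally show ?thesis using pos by (simp add: posterior_exists_def r_def k)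
qed

end
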